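(* Let $R$ be a finite-dimensional algebra over a field $k$ and let $S$ be a set of indecomposable finite-dimensional left $R$-modules. Then the $S$-pure-injective left $R$-modules are exactly the direct summands of direct products of modules in $\tau S\cup R\text{-inj}$, where $\tau$ is the Auslander-Reiten translate, $\tau S=\{\tau M\mid M\in S\}$, and $R\text{-inj}$ denotes the set of indecomposable injective left $R$-modules.
   Context: A short exact sequence $0\to A\to B\to C\to 0$ of left $R$-modules is $S$-pure if $0\to \mathrm{Hom}_R(M,A)\to \mathrm{Hom}_R(M,B)\to \mathrm{Hom}_R(M,C)\to 0$ is exact for all $M\in S$; a left $R$-module is $S$-pure-injective if it is injective relative to every $S$-pure exact sequence of left $R$-modules. For a finite-dimensional module $M$, $\tau M=\mathrm{Hom}_k(DM,k)$, where $DM$ is the Auslander-Bridger dual (transpose) of $M$ computed from a minimal projective presentation of $M$ (so $\tau M=0$ if $M$ is projective). *)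

theory Defs
  imports "HOL-Algebra.Module" "HOL-Algebra.AbelCoset"
begin

section \<open>Left modules over a (not necessarily commutative) ring\<close>

text \<open>
  The library locale \<^locale>\<open>module\<close> requires a commutative ring of scalars.  Here
  the library record for modules is reused with an arbitrary ring of scalars; its fields
  \<^term>\<open>mult\<close> and \<^term>\<open>one\<close> carry no information.
\<close>

locale left_module = R: ring R + M: abelian_group M
  for R :: "('r, 'e) ring_scheme" and M :: "('r, 'm) module" +
  assumes smult_closed:
      "\<lbrakk>a \<in> carrier R; x \<in> carrier M\<rbrakk> \<Longrightarrow> a \<odot>\<^bsub>M\<^esub> x \<in> carrier M"
    and smult_l_distr:
      "\<lbrakk>a \<in> carrier R; b \<in> carrier R; x \<in> carrier M\<rbrakk>
        \<Longrightarrow> (a \<oplus>\<^bsub>R\<^esub> b) \<odot>\<^bsub>M\<^esub> x = a \<odot>\<^bsub>M\<^esub> x \<oplus>\<^bsub>M\<^esub> b \<odot>\<^bsub>M\<^esub> x"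
    and smult_r_distr:
      "\<lbrakk>a \<in> carrier R; x \<in> carrier M; y \<in> carrier M\<rbrakk>
        \<Longrightarrow> a \<odot>\<^bsub>M\<^esub> (x \<oplus>\<^bsub>M\<^esub> y) = a \<odot>\<^bsub>M\<^esub> x \<oplus>\<^bsub>M\<^esub> a \<odot>\<^bsub>M\<^esub> y"
    and smult_assoc:
      "\<lbrakk>a \<in> carrier R; b \<in> carrier R; x \<in> carrier M\<rbrakk>
        \<Longrightarrow> (a \<otimes>\<^bsub>R\<^esub> b) \<odot>\<^bsub>M\<^esub> x = a \<odot>\<^bsub>M\<^esub> (b \<odot>\<^bsub>M\<^esub> x)"
    and smult_one:
      "x \<in> carrier M \<Longrightarrow> \<one>\<^bsub>R\<^esub> \<odot>\<^bsub>M\<^esub> x = x"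

definition regular :: "('r, 'e) ring_scheme \<Rightarrow> ('r, 'r) module" where
  "regular R = \<lparr>carrier = carrier R, mult = mult R, one = \<one>\<^bsub>R\<^esub>,
     zero = \<zero>\<^bsub>R\<^esub>, add = add R, smult = mult R\<rparr>"

text \<open>Homomorphisms are extensional, so that a homomorphism is determined by its values on
  the carrier and \<open>lhom R M N\<close> is the set \<open>Hom(M, N)\<close> itself.\<close>

definition lhom ::
  "('r, 'e) ring_scheme \<Rightarrow> ('r, 'm) module \<Rightarrow> ('r, 'n) module \<Rightarrow> ('m \<Rightarrow> 'n) set" where
  "lhom R M N = {f \<in> carrier M \<rightarrow>\<^sub>E carrier N.
     (\<forall>x\<in>carrier M. \<forall>y\<in>carrier M. f (x \<oplus>\<^bsub>M\<^esub> y) = f x \<oplus>\<^bsub>N\<^esub> f y) \<and>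
     (\<forall>a\<in>carrier R. \<forall>x\<in>carrier M. f (a \<odot>\<^bsub>M\<^esub> x) = a \<odot>\<^bsub>N\<^esub> f x)}"

definition lhom_group ::
  "('r, 'e) ring_scheme \<Rightarrow> ('r, 'm) module \<Rightarrow> ('r, 'n) module \<Rightarrow> ('m \<Rightarrow> 'n) ring" where
  "lhom_group R M N = \<lparr>carrier = lhom R M N, mult = undefined, one = undefined,
     zero = (\<lambda>x\<in>carrier M. \<zero>\<^bsub>N\<^esub>),
     add = (\<lambda>f g. \<lambda>x\<in>carrier M. f x \<oplus>\<^bsub>N\<^esub> g x)\<rparr>"

definition isomorphic_modules ::
  "('r, 'e) ring_scheme \<Rightarrow> ('r, 'm) module \<Rightarrow> ('r, 'n) module \<Rightarrow> bool" where
  "isomorphic_modules R M N \<longleftrightarrow> (\<exists>f\<in>lhom R M N. bij_betw f (carrier M) (carrier N))"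

definition ker :: "('r, 'm) module \<Rightarrow> ('r, 'n) module \<Rightarrow> ('m \<Rightarrow> 'n) \<Rightarrow> 'm set" where
  "ker M N f = {x \<in> carrier M. f x = \<zero>\<^bsub>N\<^esub>}"

definition internal_direct_sum ::
  "('r, 'e) ring_scheme \<Rightarrow> ('r, 'm) module \<Rightarrow> 'm set \<Rightarrow> 'm set \<Rightarrow> bool" where
  "internal_direct_sum R M A B \<longleftrightarrow> submodule A R M \<and> submodule B R M \<and>
     A <+>\<^bsub>M\<^esub> B = carrier M \<and> A \<inter> B = {\<zero>\<^bsub>M\<^esub>}"

definition indecomposable :: "('r, 'e) ring_scheme \<Rightarrow> ('r, 'm) module \<Rightarrow> bool" where
  "indecomposable R M \<longleftrightarrow> carrier M \<noteq> {\<zero>\<^bsub>M\<^esub>} \<and>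
     (\<forall>A B. internal_direct_sum R M A B \<longrightarrow> A = {\<zero>\<^bsub>M\<^esub>} \<or> B = {\<zero>\<^bsub>M\<^esub>})"

text \<open>Up to isomorphism, \<open>N\<close> is a direct summand of \<open>P\<close>.\<close>

definition direct_summand ::
  "('r, 'e) ring_scheme \<Rightarrow> ('r, 'n) module \<Rightarrow> ('r, 'm) module \<Rightarrow> bool" where
  "direct_summand R N P \<longleftrightarrow>
     (\<exists>A B. internal_direct_sum R P A B \<and> isomorphic_modules R N (P\<lparr>carrier := A\<rparr>))"

definition direct_product :: "'i set \<Rightarrow> ('i \<Rightarrow> ('r, 'm) module) \<Rightarrow> ('r, 'i \<Rightarrow> 'm) module" where
  "direct_product I X = \<lparr>carrier = (\<Pi>\<^sub>E i\<in>I. carrier (X i)), mult = undefined, one = undefined,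
     zero = (\<lambda>i\<in>I. \<zero>\<^bsub>X i\<^esub>), add = (\<lambda>x y. \<lambda>i\<in>I. x i \<oplus>\<^bsub>X i\<^esub> y i),
     smult = (\<lambda>a x. \<lambda>i\<in>I. a \<odot>\<^bsub>X i\<^esub> x i)\<rparr>"

definition quotient_module :: "('r, 'm) module \<Rightarrow> 'm set \<Rightarrow> ('r, 'm set) module" where
  "quotient_module M H = \<lparr>carrier = a_rcosets\<^bsub>M\<^esub> H, mult = undefined, one = undefined,
     zero = H, add = set_add M, smult = (\<lambda>a X. \<Union>x\<in>X. H +>\<^bsub>M\<^esub> (a \<odot>\<^bsub>M\<^esub> x))\<rparr>"


section \<open>Exact sequences and relative injectivity\<close>

text \<open>Exactness of \<open>0 \<rightarrow> A \<rightarrow> B \<rightarrow> C \<rightarrow> 0\<close> for maps already known to be additive.\<close>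

definition short_exact ::
  "('a, 'p) ring_scheme \<Rightarrow> ('b, 'q) ring_scheme \<Rightarrow> ('c, 's) ring_scheme
    \<Rightarrow> ('a \<Rightarrow> 'b) \<Rightarrow> ('b \<Rightarrow> 'c) \<Rightarrow> bool" where
  "short_exact A B C f g \<longleftrightarrow> inj_on f (carrier A) \<and>
     f ` carrier A = {b \<in> carrier B. g b = \<zero>\<^bsub>C\<^esub>} \<and> g ` carrier B = carrier C"

definition short_exact_modules ::
  "('r, 'e) ring_scheme \<Rightarrow> ('r, 'a) module \<Rightarrow> ('r, 'b) module \<Rightarrow> ('r, 'c) module
    \<Rightarrow> ('a \<Rightarrow> 'b) \<Rightarrow> ('b \<Rightarrow> 'c) \<Rightarrow> bool" where
  "short_exact_modules R A B C f g \<longleftrightarrow>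
     left_module R A \<and> left_module R B \<and> left_module R C \<and>
     f \<in> lhom R A B \<and> g \<in> lhom R B C \<and> short_exact A B C f g"

definition pure_exact ::
  "('r, 'e) ring_scheme \<Rightarrow> ('r, 'm) module set \<Rightarrow> ('r, 'a) module \<Rightarrow> ('r, 'b) module
    \<Rightarrow> ('r, 'c) module \<Rightarrow> ('a \<Rightarrow> 'b) \<Rightarrow> ('b \<Rightarrow> 'c) \<Rightarrow> bool" where
  "pure_exact R S A B C f g \<longleftrightarrow> short_exact_modules R A B C f g \<and>
     (\<forall>M\<in>S. short_exact (lhom_group R M A) (lhom_group R M B) (lhom_group R M C)
        (compose (carrier M) f) (compose (carrier M) g))"

definition injective_relative ::
  "('r, 'e) ring_scheme \<Rightarrow> ('r, 'n) module \<Rightarrow> ('r, 'a) module \<Rightarrow> ('r, 'b) module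
    \<Rightarrow> ('a \<Rightarrow> 'b) \<Rightarrow> bool" where
  "injective_relative R N A B f \<longleftrightarrow>
     (\<forall>h\<in>lhom R A N. \<exists>h'\<in>lhom R B N. \<forall>x\<in>carrier A. h' (f x) = h x)"

text \<open>
  HOL cannot quantify over types inside a formula.  In the following definitions the argument
  \<open>U :: 'u itself\<close> is a universe: ``every exact sequence'' and ``every surjection'' range
  over all modules whose carrier is a subset of \<open>'u\<close>.
\<close>

definition pure_injective ::
  "'u itself \<Rightarrow> ('r, 'e) ring_scheme \<Rightarrow> ('r, 'm) module set \<Rightarrow> ('r, 'n) module \<Rightarrow> bool" where
  "pure_injective U R S N \<longleftrightarrow> left_module R N \<and>
     (\<forall>(A :: ('r, 'u) module) (B :: ('r, 'u) module) (C :: ('r, 'u) module) f g.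
        pure_exact R S A B C f g \<longrightarrow> injective_relative R N A B f)"

definition injective :: "'u itself \<Rightarrow> ('r, 'e) ring_scheme \<Rightarrow> ('r, 'n) module \<Rightarrow> bool" where
  "injective U R N \<longleftrightarrow> left_module R N \<and>
     (\<forall>(A :: ('r, 'u) module) (B :: ('r, 'u) module) (C :: ('r, 'u) module) f g.
        short_exact_modules R A B C f g \<longrightarrow> injective_relative R N A B f)"

definition projective :: "'u itself \<Rightarrow> ('r, 'e) ring_scheme \<Rightarrow> ('r, 'p) module \<Rightarrow> bool" where
  "projective U R P \<longleftrightarrow> left_module R P \<and>
     (\<forall>(B :: ('r, 'u) module) (C :: ('r, 'u) module) g.
        left_module R B \<and> left_module R C \<and> g \<in> lhom R B C \<and> g ` carrier B = carrier C \<longrightarrow>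
        (\<forall>h\<in>lhom R P C. \<exists>h'\<in>lhom R P B. \<forall>x\<in>carrier P. g (h' x) = h x))"


section \<open>Finite-dimensional algebras and the Auslander-Reiten translate\<close>

definition finite_dimensional :: "'k ring \<Rightarrow> ('k, 'v) module \<Rightarrow> bool" where
  "finite_dimensional K V \<longleftrightarrow> (\<exists>F. finite F \<and> F \<subseteq> carrier V \<and>
     (\<forall>x\<in>carrier V. \<exists>c\<in>F \<rightarrow> carrier K. x = (\<Oplus>\<^bsub>V\<^esub>v\<in>F. c v \<odot>\<^bsub>V\<^esub> v)))"

text \<open>The library locale \<^locale>\<open>algebra\<close> is restricted to commutative algebras.\<close>

locale fin_dim_algebra = base: module K R + K: field K + R: ring R
  for K :: "'k ring" and R :: "('k, 'r) module" +
  assumes smult_mult_left: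
      "\<lbrakk>c \<in> carrier K; x \<in> carrier R; y \<in> carrier R\<rbrakk>
        \<Longrightarrow> (c \<odot>\<^bsub>R\<^esub> x) \<otimes>\<^bsub>R\<^esub> y = c \<odot>\<^bsub>R\<^esub> (x \<otimes>\<^bsub>R\<^esub> y)"
    and smult_mult_right:
      "\<lbrakk>c \<in> carrier K; x \<in> carrier R; y \<in> carrier R\<rbrakk>
        \<Longrightarrow> x \<otimes>\<^bsub>R\<^esub> (c \<odot>\<^bsub>R\<^esub> y) = c \<odot>\<^bsub>R\<^esub> (x \<otimes>\<^bsub>R\<^esub> y)"
    and finite_dimensional: "finite_dimensional K R"

text \<open>The underlying \<open>K\<close>-vector space of a left or right \<open>R\<close>-module.\<close>

definition restrict_scalars :: "('k, 'r) module \<Rightarrow> ('r, 'm) module \<Rightarrow> ('k, 'm) module" where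
  "restrict_scalars R M = \<lparr>carrier = carrier M, mult = undefined, one = undefined,
     zero = \<zero>\<^bsub>M\<^esub>, add = add M, smult = (\<lambda>c x. (c \<odot>\<^bsub>R\<^esub> \<one>\<^bsub>R\<^esub>) \<odot>\<^bsub>M\<^esub> x)\<rparr>"

text \<open>
  The next two definitions yield right \<open>R\<close>-modules.  They are stored in the same
  record, with \<open>r \<odot> x\<close> standing for the right action \<open>x r\<close>.
  On \<open>Hom(P, R)\<close> the right action is \<open>(f r)(x) = f(x) r\<close>.
\<close>

definition ring_dual :: "('k, 'r) module \<Rightarrow> ('r, 'p) module \<Rightarrow> ('r, 'p \<Rightarrow> 'r) module" where
  "ring_dual R P = \<lparr>carrier = lhom R P (regular R), mult = undefined, one = undefined,
     zero = (\<lambda>x\<in>carrier P. \<zero>\<^bsub>R\<^esub>), add = (\<lambda>f g. \<lambda>x\<in>carrier P. f x \<oplus>\<^bsub>R\<^esub> g x),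
     smult = (\<lambda>r f. \<lambda>x\<in>carrier P. f x \<otimes>\<^bsub>R\<^esub> r)\<rparr>"

text \<open>The cokernel of \<open>Hom(d, R) : Hom(P0, R) \<rightarrow> Hom(P1, R)\<close>.\<close>

definition AB_transpose ::
  "('k, 'r) module \<Rightarrow> ('r, 'p) module \<Rightarrow> ('r, 'q) module \<Rightarrow> ('p \<Rightarrow> 'q)
    \<Rightarrow> ('r, ('p \<Rightarrow> 'r) set) module" where
  "AB_transpose R P1 P0 d = quotient_module (ring_dual R P1)
     ((\<lambda>h. compose (carrier P1) h d) ` carrier (ring_dual R P0))"

text \<open>The left module \<open>Hom(D, K)\<close> of a right module \<open>D\<close>, with action
  \<open>(r \<phi>)(x) = \<phi>(x r)\<close>.\<close>

definition field_dual ::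
  "'k ring \<Rightarrow> ('k, 'r) module \<Rightarrow> ('r, 'd) module \<Rightarrow> ('r, 'd \<Rightarrow> 'k) module" where
  "field_dual K R D = \<lparr>carrier = lhom K (restrict_scalars R D) (regular K),
     mult = undefined, one = undefined,
     zero = (\<lambda>x\<in>carrier D. \<zero>\<^bsub>K\<^esub>), add = (\<lambda>\<phi> \<psi>. \<lambda>x\<in>carrier D. \<phi> x \<oplus>\<^bsub>K\<^esub> \<psi> x),
     smult = (\<lambda>r \<phi>. \<lambda>x\<in>carrier D. \<phi> (r \<odot>\<^bsub>D\<^esub> x))\<rparr>"

definition superfluous :: "('r, 'e) ring_scheme \<Rightarrow> ('r, 'm) module \<Rightarrow> 'm set \<Rightarrow> bool" where
  "superfluous R M H \<longleftrightarrow> submodule H R M \<and>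
     (\<forall>L. submodule L R M \<and> L <+>\<^bsub>M\<^esub> H = carrier M \<longrightarrow> L = carrier M)"

definition projective_cover ::
  "'u itself \<Rightarrow> ('r, 'e) ring_scheme \<Rightarrow> ('r, 'p) module \<Rightarrow> ('r, 'm) module
    \<Rightarrow> ('p \<Rightarrow> 'm) \<Rightarrow> bool" where
  "projective_cover U R P M e \<longleftrightarrow> projective U R P \<and> e \<in> lhom R P M \<and>
     e ` carrier P = carrier M \<and> superfluous R P (ker P M e)"

definition minimal_projective_presentation ::
  "'u itself \<Rightarrow> ('r, 'e) ring_scheme \<Rightarrow> ('r, 'p) module \<Rightarrow> ('r, 'q) module \<Rightarrow> ('r, 'm) module
    \<Rightarrow> ('p \<Rightarrow> 'q) \<Rightarrow> ('q \<Rightarrow> 'm) \<Rightarrow> bool" where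
  "minimal_projective_presentation U R P1 P0 M d e \<longleftrightarrow> projective_cover U R P0 M e \<and>
     projective_cover U R P1 (P0\<lparr>carrier := ker P0 M e\<rparr>) d"

text \<open>
  The modules in a minimal projective presentation of a finite-dimensional module are summands
  of finite powers of \<open>R\<close>, so up to isomorphism their elements may be taken to be
  sequences in \<open>R\<close>.  The presentation is unique up to isomorphism; an arbitrary one
  is chosen.
\<close>

type_synonym ('k, 'r) tau_elem = "((nat \<Rightarrow> 'r) \<Rightarrow> 'r) set \<Rightarrow> 'k"

definition AR_translate ::
  "'u itself \<Rightarrow> 'k ring \<Rightarrow> ('k, 'r) module \<Rightarrow> ('r, 'm) module
    \<Rightarrow> ('r, ('k, 'r) tau_elem) module" where
  "AR_translate U K R M = (SOME T.
     \<exists>(P1 :: ('r, nat \<Rightarrow> 'r) module) (P0 :: ('r, nat \<Rightarrow> 'r) module) d e.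
       minimal_projective_presentation U R P1 P0 M d e \<and>
       T = field_dual K R (AB_transpose R P1 P0 d))"

text \<open>
  Over a finite-dimensional algebra every indecomposable injective module is isomorphic to
  a summand of \<open>Hom(R, K)\<close>, hence to a module with elements of type
  \<^typ>\<open>'r \<Rightarrow> 'k\<close>.  This type embeds into \<open>('k, 'r) tau_elem\<close>, so the following
  set contains a copy of each of them.
\<close>

definition indecomposable_injectives ::
  "'u itself \<Rightarrow> ('k, 'r) module \<Rightarrow> ('r, ('k, 'r) tau_elem) module set" where
  "indecomposable_injectives U R = {E. indecomposable R E \<and> injective U R E}"

text \<open>
  A type into which \<open>('k, 'r, 'n) universe_bound\<close> embeds is large enough to serve as
  universe for a module with elements in \<open>'n\<close>: it holds the products of the modules
  above indexed by all homomorphisms from the given module into them.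
\<close>

type_synonym ('k, 'r, 'n) universe_bound =
  "('r, ('k, 'r) tau_elem) module \<times> ('n \<Rightarrow> ('k, 'r) tau_elem) \<Rightarrow> ('k, 'r) tau_elem"

end

theory Submission
  imports Defs
begin

text \<open>
  For a presentation \<open>P1 \<rightarrow> P0 \<rightarrow> M \<rightarrow> 0\<close> by finitely generated projectives, a homomorphism from
  \<open>A\<close> to \<open>\<tau> M\<close> is the same as a \<open>K\<close>-linear functional on \<open>Hom(P1, A)\<close> that vanishes on the
  image of \<open>Hom(P0, A)\<close>. Given an exact sequence \<open>0 \<rightarrow> A \<rightarrow> B \<rightarrow> C \<rightarrow> 0\<close>, such a functional extends
  from \<open>A\<close> to \<open>B\<close> if and only if it kills every map \<open>P1 \<rightarrow> A\<close> whose composite with \<open>A \<rightarrow> B\<close>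
  extends over \<open>P0\<close>, and a diagram chase identifies these maps, modulo \<open>Hom(P0, A) d\<close>, with the
  homomorphisms \<open>M \<rightarrow> C\<close>, modulo those lifting to \<open>B\<close>. Hence \<open>Hom(M, B) \<rightarrow> Hom(M, C)\<close> is onto if
  and only if \<open>Hom(B, \<tau> M) \<rightarrow> Hom(A, \<tau> M)\<close> is onto.

  So every \<open>\<tau> M\<close> with \<open>M\<close> in \<open>S\<close> is \<open>S\<close>-pure-injective, and this passes to products and summands.
  Conversely, \<open>N\<close> embeds into the product of one copy of \<open>X\<close> for each homomorphism from \<open>N\<close>
  to some \<open>X\<close> in \<open>\<tau> S \<union> R-inj\<close>, because summands of \<open>Hom(R, K)\<close> separate points.  The embedding
  is \<open>S\<close>-pure, as every homomorphism from \<open>N\<close> to some \<open>\<tau> M\<close> factors through it, and so it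
  splits if \<open>N\<close> is \<open>S\<close>-pure-injective.
\<close>

section \<open>Left modules and their homomorphisms\<close>

text \<open>Two obstacles shape the development. First, \<open>projective\<close>,
  \<open>injective\<close> and \<open>pure_injective\<close> test against modules inside one type
  \<open>'u\<close>, while the modules at hand live in other types. Projectivity is therefore used
  as a hypothesis only to split a surjection from a finite free module, on copies in
  \<open>'u\<close>. The splitting gives a finite dual basis, which mentions no universe and makes
  every homomorphism out of \<open>P1\<close> or \<open>P0\<close> a finite sum of rank one maps;
  this is what turns functionals on Hom(P1, A) back into homomorphisms from \<open>A\<close> to the
  translate. For the embedding of \<open>N\<close>, the whole exact sequence is copied into
  \<open>'u\<close> instead. Second, \<open>AR_translate\<close> is defined by \<open>SOME\<close>,
  so minimal projective presentations with elements in \<open>nat \<Rightarrow> 'r\<close> have to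
  be constructed. Minimality then guarantees that whichever presentation is chosen has finitely
  generated terms. Both points, and the existence of indecomposable injective summands of Hom(R, K),
  rest on finite length.\<close>

lemma (in abelian_group) add_diff_add_cancel:
  assumes "x \<in> carrier G" "y \<in> carrier G" "z \<in> carrier G"
  shows "(x \<oplus> y) \<ominus> (x \<oplus> z) = y \<ominus> z"
  using assms by (simp add: a_minus_def minus_add a_assoc a_lcomm[of y] r_neg2)

lemma (in abelian_group) right_minus_eq:
  assumes "x \<in> carrier G" "y \<in> carrier G"
  shows "x \<ominus> y = \<zero> \<longleftrightarrow> x = y"
proof
  assume "x \<ominus> y = \<zero>"
  then have "(x \<ominus> y) \<oplus> y = y" using assms by simp
  then show "x = y" using assms by (simp add: a_minus_def a_assoc l_neg)
qed (use assms in \<open>simp add: a_minus_def r_neg\<close>)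

section \<open>Scalars, negatives and submodules\<close>

context left_module
begin

lemma smult_l_null: "x \<in> carrier M \<Longrightarrow> \<zero>\<^bsub>R\<^esub> \<odot>\<^bsub>M\<^esub> x = \<zero>\<^bsub>M\<^esub>"
proof -
  assume x: "x \<in> carrier M"
  have "\<zero>\<^bsub>R\<^esub> \<odot>\<^bsub>M\<^esub> x \<oplus>\<^bsub>M\<^esub> \<zero>\<^bsub>R\<^esub> \<odot>\<^bsub>M\<^esub> x = \<zero>\<^bsub>R\<^esub> \<odot>\<^bsub>M\<^esub> x"
    using smult_l_distr[of "\<zero>\<^bsub>R\<^esub>" "\<zero>\<^bsub>R\<^esub>" x] x by simp
  then show ?thesis
    using M.add.r_cancel_one'[of "\<zero>\<^bsub>R\<^esub> \<odot>\<^bsub>M\<^esub> x" "\<zero>\<^bsub>R\<^esub> \<odot>\<^bsub>M\<^esub> x"] smult_closed x by simp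
qed

lemma smult_r_null: "a \<in> carrier R \<Longrightarrow> a \<odot>\<^bsub>M\<^esub> \<zero>\<^bsub>M\<^esub> = \<zero>\<^bsub>M\<^esub>"
proof -
  assume a: "a \<in> carrier R"
  have "a \<odot>\<^bsub>M\<^esub> \<zero>\<^bsub>M\<^esub> \<oplus>\<^bsub>M\<^esub> a \<odot>\<^bsub>M\<^esub> \<zero>\<^bsub>M\<^esub> = a \<odot>\<^bsub>M\<^esub> \<zero>\<^bsub>M\<^esub>"
    using smult_r_distr[of a "\<zero>\<^bsub>M\<^esub>" "\<zero>\<^bsub>M\<^esub>"] a by simp
  then show ?thesis
    using M.add.r_cancel_one'[of "a \<odot>\<^bsub>M\<^esub> \<zero>\<^bsub>M\<^esub>" "a \<odot>\<^bsub>M\<^esub> \<zero>\<^bsub>M\<^esub>"] smult_closed a by simp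
qed

lemma smult_minus_one: "x \<in> carrier M \<Longrightarrow> (\<ominus>\<^bsub>R\<^esub> \<one>\<^bsub>R\<^esub>) \<odot>\<^bsub>M\<^esub> x = \<ominus>\<^bsub>M\<^esub> x"
proof -
  assume x: "x \<in> carrier M"
  have "(\<ominus>\<^bsub>R\<^esub> \<one>\<^bsub>R\<^esub>) \<odot>\<^bsub>M\<^esub> x \<oplus>\<^bsub>M\<^esub> x = (\<ominus>\<^bsub>R\<^esub> \<one>\<^bsub>R\<^esub> \<oplus>\<^bsub>R\<^esub> \<one>\<^bsub>R\<^esub>) \<odot>\<^bsub>M\<^esub> x"
    using smult_l_distr[of "\<ominus>\<^bsub>R\<^esub> \<one>\<^bsub>R\<^esub>" "\<one>\<^bsub>R\<^esub>" x] x by (simp add: smult_one)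
  also have "\<dots> = \<zero>\<^bsub>M\<^esub>" using x by (simp add: R.l_neg smult_l_null)
  finally show ?thesis
    using M.minus_equality x smult_closed by force
qed

lemma smult_minus: "\<lbrakk>a \<in> carrier R; x \<in> carrier M\<rbrakk> \<Longrightarrow> a \<odot>\<^bsub>M\<^esub> (\<ominus>\<^bsub>M\<^esub> x) = \<ominus>\<^bsub>M\<^esub> (a \<odot>\<^bsub>M\<^esub> x)"
  using smult_r_distr[of a "\<ominus>\<^bsub>M\<^esub> x" x] M.minus_equality[of "a \<odot>\<^bsub>M\<^esub> (\<ominus>\<^bsub>M\<^esub> x)" "a \<odot>\<^bsub>M\<^esub> x"]
  by (simp add: M.l_neg smult_closed smult_r_null)

lemma smult_diff:
  "\<lbrakk>a \<in> carrier R; x \<in> carrier M; y \<in> carrier M\<rbrakk>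
    \<Longrightarrow> a \<odot>\<^bsub>M\<^esub> (x \<ominus>\<^bsub>M\<^esub> y) = a \<odot>\<^bsub>M\<^esub> x \<ominus>\<^bsub>M\<^esub> a \<odot>\<^bsub>M\<^esub> y"
  by (simp add: a_minus_def smult_r_distr smult_minus)

lemma submoduleI:
  assumes "H \<subseteq> carrier M" "\<zero>\<^bsub>M\<^esub> \<in> H"
    and "\<And>x y. \<lbrakk>x \<in> H; y \<in> H\<rbrakk> \<Longrightarrow> x \<oplus>\<^bsub>M\<^esub> y \<in> H"
    and sc: "\<And>a x. \<lbrakk>a \<in> carrier R; x \<in> H\<rbrakk> \<Longrightarrow> a \<odot>\<^bsub>M\<^esub> x \<in> H"
  shows "submodule H R M"
proof -
  \<comment> \<open>\<open>submodule\<close> asks for a subgroup; negatives are multiples by minus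
    one.\<close>
  have "\<ominus>\<^bsub>M\<^esub> x \<in> H" if "x \<in> H" for x
    using sc[of "\<ominus>\<^bsub>R\<^esub> \<one>\<^bsub>R\<^esub>" x] that assms(1) smult_minus_one[of x] by auto
  then show ?thesis
    using assms by (intro submodule.intro subgroup.intro) (auto simp: submodule_axioms_def a_inv_def)
qed

lemma submodule_carrier: "submodule (carrier M) R M"
  by (rule submoduleI) (auto simp: smult_closed)

lemma submodule_zero: "submodule {\<zero>\<^bsub>M\<^esub>} R M"
  by (rule submoduleI) (auto simp: smult_r_null)

lemma submodule_Int:
  "submodule H R M \<Longrightarrow> submodule H' R M \<Longrightarrow> submodule (H \<inter> H') R M"
  by (rule submoduleI) (auto simp: submodule_def submodule_axioms_def subgroup_def)

end

lemma submoduleD: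
  assumes "submodule H R M"
  shows "x \<in> H \<Longrightarrow> x \<in> carrier M" "\<zero>\<^bsub>M\<^esub> \<in> H" "\<lbrakk>x \<in> H; y \<in> H\<rbrakk> \<Longrightarrow> x \<oplus>\<^bsub>M\<^esub> y \<in> H"
    "\<lbrakk>a \<in> carrier R; x \<in> H\<rbrakk> \<Longrightarrow> a \<odot>\<^bsub>M\<^esub> x \<in> H" "H \<subseteq> carrier M" "x \<in> H \<Longrightarrow> \<ominus>\<^bsub>M\<^esub> x \<in> H"
  using assms by (auto simp: submodule_def submodule_axioms_def subgroup_def a_inv_def)

text \<open>The equation \<^prop>\<open>\<zero>\<^bsub>R\<^esub> \<odot>\<^bsub>M\<^esub> x = \<zero>\<^bsub>M\<^esub>\<close> replaces the existence of negatives.\<close>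

lemma left_moduleI:
  fixes R (structure) and M (structure)
  assumes "ring R"
    and "\<And>x y. \<lbrakk>x \<in> carrier M; y \<in> carrier M\<rbrakk> \<Longrightarrow> x \<oplus>\<^bsub>M\<^esub> y \<in> carrier M"
    and "\<zero>\<^bsub>M\<^esub> \<in> carrier M"
    and "\<And>x y z. \<lbrakk>x \<in> carrier M; y \<in> carrier M; z \<in> carrier M\<rbrakk>
           \<Longrightarrow> (x \<oplus>\<^bsub>M\<^esub> y) \<oplus>\<^bsub>M\<^esub> z = x \<oplus>\<^bsub>M\<^esub> (y \<oplus>\<^bsub>M\<^esub> z)"
    and "\<And>x y. \<lbrakk>x \<in> carrier M; y \<in> carrier M\<rbrakk> \<Longrightarrow> x \<oplus>\<^bsub>M\<^esub> y = y \<oplus>\<^bsub>M\<^esub> x"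
    and "\<And>x. x \<in> carrier M \<Longrightarrow> \<zero>\<^bsub>M\<^esub> \<oplus>\<^bsub>M\<^esub> x = x"
    and "\<And>a x. \<lbrakk>a \<in> carrier R; x \<in> carrier M\<rbrakk> \<Longrightarrow> a \<odot>\<^bsub>M\<^esub> x \<in> carrier M"
    and "\<And>a b x. \<lbrakk>a \<in> carrier R; b \<in> carrier R; x \<in> carrier M\<rbrakk>
           \<Longrightarrow> (a \<oplus> b) \<odot>\<^bsub>M\<^esub> x = a \<odot>\<^bsub>M\<^esub> x \<oplus>\<^bsub>M\<^esub> b \<odot>\<^bsub>M\<^esub> x"
    and "\<And>a x y. \<lbrakk>a \<in> carrier R; x \<in> carrier M; y \<in> carrier M\<rbrakk>
           \<Longrightarrow> a \<odot>\<^bsub>M\<^esub> (x \<oplus>\<^bsub>M\<^esub> y) = a \<odot>\<^bsub>M\<^esub> x \<oplus>\<^bsub>M\<^esub> a \<odot>\<^bsub>M\<^esub> y"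
    and "\<And>a b x. \<lbrakk>a \<in> carrier R; b \<in> carrier R; x \<in> carrier M\<rbrakk>
           \<Longrightarrow> (a \<otimes> b) \<odot>\<^bsub>M\<^esub> x = a \<odot>\<^bsub>M\<^esub> (b \<odot>\<^bsub>M\<^esub> x)"
    and "\<And>x. x \<in> carrier M \<Longrightarrow> \<one> \<odot>\<^bsub>M\<^esub> x = x"
    and "\<And>x. x \<in> carrier M \<Longrightarrow> \<zero> \<odot>\<^bsub>M\<^esub> x = \<zero>\<^bsub>M\<^esub>"
  shows "left_module R M"
proof -
  interpret R: ring R by fact
  have "\<exists>y\<in>carrier M. y \<oplus>\<^bsub>M\<^esub> x = \<zero>\<^bsub>M\<^esub>" if "x \<in> carrier M" for x
  proof
    have "(\<ominus> \<one>) \<odot>\<^bsub>M\<^esub> x \<oplus>\<^bsub>M\<^esub> x = (\<ominus> \<one> \<oplus> \<one>) \<odot>\<^bsub>M\<^esub> x"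
      using assms(8)[of "\<ominus> \<one>" \<one> x] assms(11) that by simp
    then show "(\<ominus> \<one>) \<odot>\<^bsub>M\<^esub> x \<oplus>\<^bsub>M\<^esub> x = \<zero>\<^bsub>M\<^esub>"
      using assms(12) that by (simp add: R.l_neg)
    show "(\<ominus> \<one>) \<odot>\<^bsub>M\<^esub> x \<in> carrier M" using assms(7) that by simp
  qed
  then have "abelian_group M"
    using assms by (intro abelian_groupI) auto
  with assms show ?thesis
    unfolding left_module_def left_module_axioms_def by auto
qed

lemma left_module_submodule:
  assumes M: "left_module R M" and H: "submodule H R M"
  shows "left_module R (M\<lparr>carrier := H\<rparr>)"
proof -
  interpret M: left_module R M by fact
  note s = submoduleD[OF H]
  show ?thesis
    by (rule left_moduleI)
      (auto simp: s M.R.ring_axioms M.M.a_ac M.smult_l_distr M.smult_r_distr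
        M.smult_assoc M.smult_one M.smult_l_null intro: s(1))
qed

lemma submodule_submodule_iff:
  assumes M: "left_module R M" and H: "submodule H R M"
  shows "submodule W R (M\<lparr>carrier := H\<rparr>) \<longleftrightarrow> submodule W R M \<and> W \<subseteq> H"
proof -
  interpret M: left_module R M by fact
  interpret H: left_module R "M\<lparr>carrier := H\<rparr>" by (rule left_module_submodule) fact+
  note s = submoduleD[OF H]
  show ?thesis
  proof (intro iffI conjI)
    assume W: "submodule W R (M\<lparr>carrier := H\<rparr>)"
    show "W \<subseteq> H" using submoduleD(5)[OF W] by simp
    then show "submodule W R M"
      using submoduleD[OF W] s(5) by (intro M.submoduleI) auto
  next
    assume W: "submodule W R M \<and> W \<subseteq> H"
    then have "submodule W R M" ..
    from submoduleD[OF this] W show "submodule W R (M\<lparr>carrier := H\<rparr>)"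
      by (intro H.submoduleI) auto
  qed
qed

section \<open>The regular module and homomorphisms\<close>

lemma regular_simps [simp]:
  "carrier (regular R) = carrier R" "zero (regular R) = \<zero>\<^bsub>R\<^esub>"
  "add (regular R) = add R" "smult (regular R) = mult R"
  by (simp_all add: regular_def)

lemma left_module_regular: "ring R \<Longrightarrow> left_module R (regular R)"
proof -
  assume "ring R"
  then interpret R: ring R .
  show ?thesis
    by (rule left_moduleI) (auto simp: R.ring_axioms R.a_ac R.l_distr R.r_distr R.m_assoc)
qed

lemma lhomI:
  assumes "\<And>x. x \<in> carrier M \<Longrightarrow> f x \<in> carrier N"
    and "\<And>x y. \<lbrakk>x \<in> carrier M; y \<in> carrier M\<rbrakk> \<Longrightarrow> f (x \<oplus>\<^bsub>M\<^esub> y) = f x \<oplus>\<^bsub>N\<^esub> f y"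
    and "\<And>a x. \<lbrakk>a \<in> carrier R; x \<in> carrier M\<rbrakk> \<Longrightarrow> f (a \<odot>\<^bsub>M\<^esub> x) = a \<odot>\<^bsub>N\<^esub> f x"
    and "left_module R M"
  shows "restrict f (carrier M) \<in> lhom R M N"
proof -
  interpret M: left_module R M by fact
  show ?thesis using assms by (auto simp: lhom_def M.smult_closed)
qed

lemma lhomD:
  assumes "f \<in> lhom R M N"
  shows "x \<in> carrier M \<Longrightarrow> f x \<in> carrier N"
    and "\<lbrakk>x \<in> carrier M; y \<in> carrier M\<rbrakk> \<Longrightarrow> f (x \<oplus>\<^bsub>M\<^esub> y) = f x \<oplus>\<^bsub>N\<^esub> f y"
    and "\<lbrakk>a \<in> carrier R; x \<in> carrier M\<rbrakk> \<Longrightarrow> f (a \<odot>\<^bsub>M\<^esub> x) = a \<odot>\<^bsub>N\<^esub> f x"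
    and "f \<in> extensional (carrier M)"
  using assms by (auto simp: lhom_def PiE_def)

lemma lhom_ext:
  "\<lbrakk>f \<in> lhom R M N; g \<in> lhom R M N'; \<And>x. x \<in> carrier M \<Longrightarrow> f x = g x\<rbrakk> \<Longrightarrow> f = g"
  by (metis extensionalityI lhomD(4))

lemma lhom_zero:
  assumes "left_module R M" "left_module R N" "f \<in> lhom R M N"
  shows "f \<zero>\<^bsub>M\<^esub> = \<zero>\<^bsub>N\<^esub>"
proof -
  interpret M: left_module R M by fact
  interpret N: left_module R N by fact
  have "f (\<zero>\<^bsub>R\<^esub> \<odot>\<^bsub>M\<^esub> \<zero>\<^bsub>M\<^esub>) = \<zero>\<^bsub>R\<^esub> \<odot>\<^bsub>N\<^esub> f \<zero>\<^bsub>M\<^esub>" using lhomD(3)[OF assms(3)] by simp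
  then show ?thesis using lhomD(1)[OF assms(3)] by (simp add: M.smult_l_null N.smult_l_null)
qed

lemma lhom_minus:
  assumes "left_module R M" "left_module R N" "f \<in> lhom R M N" "x \<in> carrier M"
  shows "f (\<ominus>\<^bsub>M\<^esub> x) = \<ominus>\<^bsub>N\<^esub> f x"
proof -
  interpret M: left_module R M by fact
  interpret N: left_module R N by fact
  show ?thesis
    using lhomD(3)[OF assms(3), of "\<ominus>\<^bsub>R\<^esub> \<one>\<^bsub>R\<^esub>" x] lhomD(1)[OF assms(3)] assms(4)
    by (simp add: M.smult_minus_one N.smult_minus_one)
qed

lemma lhom_diff:
  assumes "left_module R M" "left_module R N" "f \<in> lhom R M N" "x \<in> carrier M" "y \<in> carrier M"
  shows "f (x \<ominus>\<^bsub>M\<^esub> y) = f x \<ominus>\<^bsub>N\<^esub> f y"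
proof -
  interpret M: left_module R M by fact
  show ?thesis using assms lhom_minus[OF assms(1-3,5)] lhomD(2)[OF assms(3)] by (simp add: a_minus_def)
qed

lemma lhom_finsum:
  assumes M: "left_module R M" and N: "left_module R N" and f: "f \<in> lhom R M N"
    and "finite I" "a \<in> I \<rightarrow> carrier M"
  shows "f (\<Oplus>\<^bsub>M\<^esub>i\<in>I. a i) = (\<Oplus>\<^bsub>N\<^esub>i\<in>I. f (a i))"
  using assms(4,5)
proof (induction I rule: finite_induct)
  case empty
  interpret M: left_module R M by fact
  interpret N: left_module R N by fact
  show ?case by (simp add: lhom_zero[OF M N f])
next
  case (insert i I)
  interpret M: left_module R M by fact
  interpret N: left_module R N by fact
  have "(\<Oplus>\<^bsub>M\<^esub>i\<in>I. a i) \<in> carrier M" using insert by (intro M.M.finsum_closed) auto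
  then show ?case
    using insert by (simp add: lhomD[OF f] Pi_def)
qed

lemma compose_lhom:
  assumes "left_module R M" "f \<in> lhom R M N" "g \<in> lhom R N P"
  shows "compose (carrier M) g f \<in> lhom R M P"
  unfolding compose_def
  by (rule lhomI) (use lhomD[OF assms(2)] lhomD[OF assms(3)] assms(1) in auto)

lemma id_lhom: "left_module R M \<Longrightarrow> (\<lambda>x\<in>carrier M. x) \<in> lhom R M M"
  by (rule lhomI) auto

lemma zero_lhom:
  assumes M: "left_module R M" and N: "left_module R N"
  shows "(\<lambda>x\<in>carrier M. \<zero>\<^bsub>N\<^esub>) \<in> lhom R M N"
proof -
  interpret N: left_module R N by fact
  show ?thesis by (rule lhomI) (use M in \<open>auto simp: N.smult_r_null\<close>)
qed

lemma restrict_lhom: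
  assumes M: "left_module R M" and H: "submodule H R M" and f: "f \<in> lhom R M N"
  shows "restrict f H \<in> lhom R (M\<lparr>carrier := H\<rparr>) N"
  using lhomI[of "M\<lparr>carrier := H\<rparr>" f N R] left_module_submodule[OF M H] submoduleD(1)[OF H] lhomD[OF f]
  by simp

lemma inclusion_lhom:
  assumes M: "left_module R M" and H: "submodule H R M"
  shows "(\<lambda>x\<in>H. x) \<in> lhom R (M\<lparr>carrier := H\<rparr>) M"
  using lhomI[of "M\<lparr>carrier := H\<rparr>" "\<lambda>x. x" M R] left_module_submodule[OF M H] submoduleD(1)[OF H]
  by simp

lemma scaling_lhom:
  assumes M: "left_module R M" and x: "x \<in> carrier M"
  shows "(\<lambda>a\<in>carrier R. a \<odot>\<^bsub>M\<^esub> x) \<in> lhom R (regular R) M"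
proof -
  interpret M: left_module R M by fact
  have "restrict (\<lambda>a. a \<odot>\<^bsub>M\<^esub> x) (carrier (regular R)) \<in> lhom R (regular R) M"
    by (rule lhomI) (use x in \<open>auto simp: M.smult_closed M.smult_l_distr M.smult_assoc
      left_module_regular[OF M.R.ring_axioms]\<close>)
  then show ?thesis by simp
qed

lemma lhom_add_closed:
  assumes "left_module R M" "left_module R N" "f \<in> lhom R M N" "g \<in> lhom R M N"
  shows "(\<lambda>x\<in>carrier M. f x \<oplus>\<^bsub>N\<^esub> g x) \<in> lhom R M N"
proof -
  interpret N: left_module R N by fact
  show ?thesis
    by (rule lhomI)
      (use lhomD[OF assms(3)] lhomD[OF assms(4)] assms(1) in \<open>auto simp: N.M.a_ac N.smult_r_distr\<close>)
qed

lemma lhom_minus_closed: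
  assumes "left_module R M" "left_module R N" "f \<in> lhom R M N"
  shows "(\<lambda>x\<in>carrier M. \<ominus>\<^bsub>N\<^esub> f x) \<in> lhom R M N"
proof -
  interpret M: left_module R M by fact
  interpret N: left_module R N by fact
  have e: "\<ominus>\<^bsub>N\<^esub> f x = f (\<ominus>\<^bsub>M\<^esub> x)" if "x \<in> carrier M" for x
    using lhom_minus[OF assms that] by simp
  \<comment> \<open>Minus one is central in \<open>R\<close>, so negation commutes with the action
    even though \<open>R\<close> need not be commutative.\<close>
  have "\<ominus>\<^bsub>N\<^esub> (a \<odot>\<^bsub>N\<^esub> y) = a \<odot>\<^bsub>N\<^esub> (\<ominus>\<^bsub>N\<^esub> y)" if "a \<in> carrier R" "y \<in> carrier N" for a y
  proof -
    have "\<ominus>\<^bsub>N\<^esub> (a \<odot>\<^bsub>N\<^esub> y) = ((\<ominus>\<^bsub>R\<^esub> \<one>\<^bsub>R\<^esub>) \<otimes>\<^bsub>R\<^esub> a) \<odot>\<^bsub>N\<^esub> y"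
      using that by (simp add: N.smult_assoc N.smult_minus_one N.smult_closed)
    also have "(\<ominus>\<^bsub>R\<^esub> \<one>\<^bsub>R\<^esub>) \<otimes>\<^bsub>R\<^esub> a = a \<otimes>\<^bsub>R\<^esub> (\<ominus>\<^bsub>R\<^esub> \<one>\<^bsub>R\<^esub>)"
      using that by (simp add: M.R.l_minus M.R.r_minus)
    finally show ?thesis
      using that by (simp add: N.smult_assoc N.smult_minus_one)
  qed
  then show ?thesis
    by (intro lhomI) (use lhomD[OF assms(3)] assms(1) in \<open>auto simp: N.M.minus_add\<close>)
qed

lemma lhom_diff_closed:
  assumes "left_module R M" "left_module R N" "f \<in> lhom R M N" "g \<in> lhom R M N"
  shows "(\<lambda>x\<in>carrier M. f x \<ominus>\<^bsub>N\<^esub> g x) \<in> lhom R M N"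
proof -
  have "(\<lambda>x\<in>carrier M. f x \<oplus>\<^bsub>N\<^esub> (\<lambda>x\<in>carrier M. \<ominus>\<^bsub>N\<^esub> g x) x) \<in> lhom R M N"
    by (intro lhom_add_closed lhom_minus_closed assms)
  then show ?thesis by (simp add: a_minus_def cong: restrict_cong)
qed

section \<open>Kernels, images and factorization\<close>

lemma submodule_ker:
  assumes "left_module R M" "left_module R N" "f \<in> lhom R M N"
  shows "submodule (ker M N f) R M"
proof -
  interpret M: left_module R M by fact
  interpret N: left_module R N by fact
  show ?thesis
    by (rule M.submoduleI) (auto simp: ker_def lhomD[OF assms(3)] lhom_zero[OF assms] M.smult_closed N.smult_r_null)
qed

lemma submodule_image:
  assumes "left_module R M" "left_module R N" "f \<in> lhom R M N" "submodule H R M"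
  shows "submodule (f ` H) R N"
proof -
  interpret N: left_module R N by fact
  note s = submoduleD[OF assms(4)] note f = lhomD[OF assms(3)]
  show ?thesis
  proof (rule N.submoduleI)
    show "f ` H \<subseteq> carrier N" using f s by auto
    show "\<zero>\<^bsub>N\<^esub> \<in> f ` H" using lhom_zero[OF assms(1-3)] s(2) by force
    show "x \<oplus>\<^bsub>N\<^esub> y \<in> f ` H" if "x \<in> f ` H" "y \<in> f ` H" for x y
    proof -
      from that obtain a b where "a \<in> H" "b \<in> H" "x = f a" "y = f b" by blast
      then show ?thesis using f(2)[of a b] s by (metis imageI)
    qed
    show "a \<odot>\<^bsub>N\<^esub> x \<in> f ` H" if "a \<in> carrier R" "x \<in> f ` H" for a x
    proof -
      from that obtain y where "y \<in> H" "x = f y" by auto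
      then show ?thesis using f(3)[of a y] s that(1) by (metis imageI)
    qed
  qed
qed

lemma submodule_vimage:
  assumes "left_module R M" "left_module R N" "f \<in> lhom R M N" "submodule H R N"
  shows "submodule {x \<in> carrier M. f x \<in> H} R M"
proof -
  interpret M: left_module R M by fact
  note s = submoduleD[OF assms(4)] note f = lhomD[OF assms(3)]
  show ?thesis
    by (rule M.submoduleI) (auto simp: f s M.smult_closed lhom_zero[OF assms(1-3)])
qed

lemma inj_on_lhom:
  assumes "left_module R M" "left_module R N" "f \<in> lhom R M N"
    and "\<And>x. x \<in> carrier M \<Longrightarrow> f x = \<zero>\<^bsub>N\<^esub> \<Longrightarrow> x = \<zero>\<^bsub>M\<^esub>"
  shows "inj_on f (carrier M)"
proof (rule inj_onI)
  interpret M: left_module R M by fact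
  interpret N: left_module R N by fact
  fix x y assume xy: "x \<in> carrier M" "y \<in> carrier M" "f x = f y"
  then have "f (x \<ominus>\<^bsub>M\<^esub> y) = \<zero>\<^bsub>N\<^esub>"
    using lhom_diff[OF assms(1-3), of x y] lhomD(1)[OF assms(3)] by (simp add: a_minus_def N.M.r_neg)
  then have "x \<ominus>\<^bsub>M\<^esub> y = \<zero>\<^bsub>M\<^esub>" using assms(4) xy by auto
  then show "x = y" using xy by (simp add: M.M.right_minus_eq)
qed

text \<open>The homomorphism theorem for an arbitrary surjection in place of a quotient map. It
  serves to invert bijections, to descend maps from \<open>P0\<close> to \<open>M\<close>, and to
  descend functionals to the transpose.\<close>

lemma factor_surj:
  assumes M: "left_module R M" and N: "left_module R N" and Q: "left_module R Q"
    and g: "g \<in> lhom R M Q" and surj: "g ` carrier M = carrier Q"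
    and f: "f \<in> lhom R M N"
    and k: "\<And>x. x \<in> carrier M \<Longrightarrow> g x = \<zero>\<^bsub>Q\<^esub> \<Longrightarrow> f x = \<zero>\<^bsub>N\<^esub>"
  shows "\<exists>h\<in>lhom R Q N. \<forall>x\<in>carrier M. h (g x) = f x"
proof -
  interpret M: left_module R M by fact
  interpret N: left_module R N by fact
  interpret Q: left_module R Q by fact
  define s where "s = inv_into (carrier M) g"
  have s: "s y \<in> carrier M" "g (s y) = y" if "y \<in> carrier Q" for y
    using that surj unfolding s_def by (simp_all add: inv_into_into f_inv_into_f)
  \<comment> \<open>The value of \<open>f\<close> does not depend on the preimage that
    \<open>s\<close> selects.\<close>
  have fs: "f x = f y" if "x \<in> carrier M" "y \<in> carrier M" "g x = g y" for x y
  proof -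
    have "g (x \<ominus>\<^bsub>M\<^esub> y) = \<zero>\<^bsub>Q\<^esub>"
      using that lhom_diff[OF M Q g, of x y] lhomD(1)[OF g] by (simp add: a_minus_def Q.M.r_neg)
    then have "f x \<ominus>\<^bsub>N\<^esub> f y = \<zero>\<^bsub>N\<^esub>" using k[of "x \<ominus>\<^bsub>M\<^esub> y"] lhom_diff[OF M N f, of x y] that by auto
    then show ?thesis using that lhomD(1)[OF f] by (simp add: N.M.right_minus_eq)
  qed
  let ?h = "\<lambda>y\<in>carrier Q. f (s y)"
  have "?h \<in> lhom R Q N"
  proof (rule lhomI)
    show "f (s x) \<in> carrier N" if "x \<in> carrier Q" for x using that s lhomD(1)[OF f] by auto
    show "f (s (x \<oplus>\<^bsub>Q\<^esub> y)) = f (s x) \<oplus>\<^bsub>N\<^esub> f (s y)" if "x \<in> carrier Q" "y \<in> carrier Q" for x y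
    proof -
      have "f (s (x \<oplus>\<^bsub>Q\<^esub> y)) = f (s x \<oplus>\<^bsub>M\<^esub> s y)"
        by (rule fs) (use that s lhomD[OF g] in auto)
      then show ?thesis using that s lhomD(2)[OF f] by auto
    qed
    show "f (s (a \<odot>\<^bsub>Q\<^esub> x)) = a \<odot>\<^bsub>N\<^esub> f (s x)" if "a \<in> carrier R" "x \<in> carrier Q" for a x
    proof -
      have "f (s (a \<odot>\<^bsub>Q\<^esub> x)) = f (a \<odot>\<^bsub>M\<^esub> s x)"
        by (rule fs) (use that s lhomD[OF g] in \<open>auto simp: Q.smult_closed M.smult_closed\<close>)
      then show ?thesis using that s lhomD(3)[OF f] by auto
    qed
  qed fact
  moreover have "?h (g x) = f x" if "x \<in> carrier M" for x
    using that lhomD(1)[OF g] s by (auto intro!: fs)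
  ultimately show ?thesis by blast
qed

subsection \<open>Constructions\<close>

text \<open>Module laws are equations, so they pass along any surjection that respects the
  operations. \<open>Q\<close> is a bare record here, which is how \<open>transport\<close> and
  \<open>quotient_module\<close> are seen to be modules.\<close>

lemma left_module_surj_image:
  assumes M: "left_module R M" and surj: "\<pi> ` carrier M = carrier Q"
    and add: "\<And>x y. \<lbrakk>x \<in> carrier M; y \<in> carrier M\<rbrakk> \<Longrightarrow> \<pi> (x \<oplus>\<^bsub>M\<^esub> y) = \<pi> x \<oplus>\<^bsub>Q\<^esub> \<pi> y"
    and smult: "\<And>a x. \<lbrakk>a \<in> carrier R; x \<in> carrier M\<rbrakk> \<Longrightarrow> \<pi> (a \<odot>\<^bsub>M\<^esub> x) = a \<odot>\<^bsub>Q\<^esub> \<pi> x"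
    and zero: "\<pi> \<zero>\<^bsub>M\<^esub> = \<zero>\<^bsub>Q\<^esub>"
  shows "left_module R Q" "restrict \<pi> (carrier M) \<in> lhom R M Q"
proof -
  interpret M: left_module R M by fact
  have ex: "\<exists>x\<in>carrier M. y = \<pi> x" if "y \<in> carrier Q" for y
    using that surj by auto
  have cl: "\<pi> x \<in> carrier Q" if "x \<in> carrier M" for x
    using that surj by auto
  show "left_module R Q"
  proof (rule left_moduleI)
    show "ring R" ..
    show "\<zero>\<^bsub>Q\<^esub> \<in> carrier Q" using cl[OF M.M.zero_closed] zero by simp
    fix x assume "x \<in> carrier Q"
    then obtain x' where x: "x = \<pi> x'" "x' \<in> carrier M" using ex by blast
    show "\<zero>\<^bsub>Q\<^esub> \<oplus>\<^bsub>Q\<^esub> x = x" using add[of "\<zero>\<^bsub>M\<^esub>" x'] x zero by simp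
    show "\<one>\<^bsub>R\<^esub> \<odot>\<^bsub>Q\<^esub> x = x" using smult[of "\<one>\<^bsub>R\<^esub>" x'] x by (simp add: M.smult_one)
    show "\<zero>\<^bsub>R\<^esub> \<odot>\<^bsub>Q\<^esub> x = \<zero>\<^bsub>Q\<^esub>" using smult[of "\<zero>\<^bsub>R\<^esub>" x'] x zero by (simp add: M.smult_l_null)
    {
      fix a assume a: "a \<in> carrier R"
      show "a \<odot>\<^bsub>Q\<^esub> x \<in> carrier Q" using smult[of a x'] x a cl[of "a \<odot>\<^bsub>M\<^esub> x'"] M.smult_closed by simp
      fix b assume b: "b \<in> carrier R"
      show "(a \<oplus>\<^bsub>R\<^esub> b) \<odot>\<^bsub>Q\<^esub> x = a \<odot>\<^bsub>Q\<^esub> x \<oplus>\<^bsub>Q\<^esub> b \<odot>\<^bsub>Q\<^esub> x"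
        using a b x by (simp flip: smult add add: M.smult_closed M.smult_l_distr)
      show "(a \<otimes>\<^bsub>R\<^esub> b) \<odot>\<^bsub>Q\<^esub> x = a \<odot>\<^bsub>Q\<^esub> (b \<odot>\<^bsub>Q\<^esub> x)"
        using a b x by (simp flip: smult add: M.smult_closed M.smult_assoc)
    }
    fix y assume "y \<in> carrier Q"
    then obtain y' where y: "y = \<pi> y'" "y' \<in> carrier M" using ex by blast
    show "x \<oplus>\<^bsub>Q\<^esub> y \<in> carrier Q" using add[of x' y'] cl[of "x' \<oplus>\<^bsub>M\<^esub> y'"] x y by simp
    show "x \<oplus>\<^bsub>Q\<^esub> y = y \<oplus>\<^bsub>Q\<^esub> x" using x y by (simp flip: add add: M.M.a_comm)
    show "a \<odot>\<^bsub>Q\<^esub> (x \<oplus>\<^bsub>Q\<^esub> y) = a \<odot>\<^bsub>Q\<^esub> x \<oplus>\<^bsub>Q\<^esub> a \<odot>\<^bsub>Q\<^esub> y" if "a \<in> carrier R" for a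
      using that x y by (simp flip: smult add add: M.smult_closed M.smult_r_distr)
    fix z assume "z \<in> carrier Q"
    then obtain z' where z: "z = \<pi> z'" "z' \<in> carrier M" using ex by blast
    show "x \<oplus>\<^bsub>Q\<^esub> y \<oplus>\<^bsub>Q\<^esub> z = x \<oplus>\<^bsub>Q\<^esub> (y \<oplus>\<^bsub>Q\<^esub> z)"
      using x y z by (simp flip: add add: M.M.a_assoc)
  qed
  show "restrict \<pi> (carrier M) \<in> lhom R M Q"
    by (rule lhomI) (use assms cl in auto)
qed

text \<open>Universes are types, so a module can be tested by \<open>injective\<close>,
  \<open>projective\<close> or \<open>pure_injective\<close> only after an isomorphic copy with
  elements in \<open>'u\<close> has been made.\<close>

definition transport :: "('m \<Rightarrow> 'u) \<Rightarrow> ('r, 'm) module \<Rightarrow> ('r, 'u) module" where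
  "transport j M = (let i = inv_into (carrier M) j in
     \<lparr>carrier = j ` carrier M, mult = undefined, one = undefined, zero = j \<zero>\<^bsub>M\<^esub>,
      add = (\<lambda>x y. j (i x \<oplus>\<^bsub>M\<^esub> i y)), smult = (\<lambda>a x. j (a \<odot>\<^bsub>M\<^esub> i x))\<rparr>)"

lemma transport:
  assumes M: "left_module R M" and j: "inj_on j (carrier M)"
  shows left_module_transport: "left_module R (transport j M)"
    and transport_lhom: "restrict j (carrier M) \<in> lhom R M (transport j M)"
    and transport_carrier: "carrier (transport j M) = j ` carrier M"
proof -
  interpret M: left_module R M by fact
  have c: "j ` carrier M = carrier (transport j M)" by (simp add: transport_def Let_def)
  have z: "j \<zero>\<^bsub>M\<^esub> = \<zero>\<^bsub>transport j M\<^esub>" by (simp add: transport_def Let_def)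
  have add: "j (x \<oplus>\<^bsub>M\<^esub> y) = j x \<oplus>\<^bsub>transport j M\<^esub> j y"
    if "x \<in> carrier M" "y \<in> carrier M" for x y
    using that j by (simp add: transport_def Let_def)
  have sm: "j (a \<odot>\<^bsub>M\<^esub> x) = a \<odot>\<^bsub>transport j M\<^esub> j x"
    if "a \<in> carrier R" "x \<in> carrier M" for a x
    using that j by (simp add: transport_def Let_def)
  show "left_module R (transport j M)" "restrict j (carrier M) \<in> lhom R M (transport j M)"
    by (rule left_module_surj_image[OF M c add sm z]; assumption)+
  show "carrier (transport j M) = j ` carrier M" using c by simp
qed

text \<open>The inverse is the factorization of the identity through \<open>f\<close>.\<close>

lemma lhom_inverse:
  assumes M: "left_module R M" and N: "left_module R N" and f: "f \<in> lhom R M N"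
    and bij: "bij_betw f (carrier M) (carrier N)"
  shows "\<exists>g\<in>lhom R N M. (\<forall>x\<in>carrier M. g (f x) = x) \<and> (\<forall>y\<in>carrier N. f (g y) = y)"
proof -
  interpret M: left_module R M by fact
  have surj: "f ` carrier M = carrier N" and inj: "inj_on f (carrier M)"
    using bij by (auto simp: bij_betw_def)
  have "\<exists>g\<in>lhom R N M. \<forall>x\<in>carrier M. g (f x) = (\<lambda>x\<in>carrier M. x) x"
  proof (rule factor_surj[OF M M N f surj id_lhom[OF M]])
    fix x assume "x \<in> carrier M" "f x = \<zero>\<^bsub>N\<^esub>"
    then have "x = \<zero>\<^bsub>M\<^esub>" using inj lhom_zero[OF M N f] by (metis M.M.zero_closed inj_onD)
    then show "(\<lambda>x\<in>carrier M. x) x = \<zero>\<^bsub>M\<^esub>" by simp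
  qed
  then obtain g where g: "g \<in> lhom R N M" "\<forall>x\<in>carrier M. g (f x) = x" by auto
  moreover have "f (g y) = y" if "y \<in> carrier N" for y
    using that g(2) by (metis imageE surj)
  ultimately show ?thesis by blast
qed

lemma direct_product_simps [simp]:
  "carrier (direct_product I X) = (\<Pi>\<^sub>E i\<in>I. carrier (X i))"
  "zero (direct_product I X) = (\<lambda>i\<in>I. \<zero>\<^bsub>X i\<^esub>)"
  "add (direct_product I X) = (\<lambda>x y. \<lambda>i\<in>I. x i \<oplus>\<^bsub>X i\<^esub> y i)"
  "smult (direct_product I X) = (\<lambda>a x. \<lambda>i\<in>I. a \<odot>\<^bsub>X i\<^esub> x i)"
  by (simp_all add: direct_product_def)

lemma left_module_direct_product:
  assumes R: "ring R" and X: "\<And>i. i \<in> I \<Longrightarrow> left_module R (X i)"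
  shows "left_module R (direct_product I X)"
proof -
  have ab: "abelian_group (X i)" if "i \<in> I" for i
    using X[OF that] by (simp add: left_module_def)
  note am = abelian_group.axioms(1)[OF ab]
  show ?thesis
    apply (rule left_moduleI[OF R])
    apply (auto simp: PiE_iff abelian_monoid.a_closed[OF am] abelian_monoid.zero_closed[OF am]
        left_module.smult_closed[OF X])
    apply (auto simp: fun_eq_iff extensional_def PiE_iff abelian_monoid.a_assoc[OF am]
        abelian_monoid.a_comm[OF am] abelian_monoid.l_zero[OF am]
        left_module.smult_l_distr[OF X] left_module.smult_r_distr[OF X] left_module.smult_assoc[OF X]
        left_module.smult_one[OF X] left_module.smult_l_null[OF X])
    done
qed

lemma direct_product_proj_lhom:
  assumes R: "ring R" and X: "\<And>i. i \<in> I \<Longrightarrow> left_module R (X i)" and "i \<in> I"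
  shows "(\<lambda>x\<in>carrier (direct_product I X). x i) \<in> lhom R (direct_product I X) (X i)"
  by (rule lhomI) (use assms left_module_direct_product[OF R X] in auto)

lemma direct_product_tuple_lhom:
  assumes M: "left_module R M" and f: "\<And>i. i \<in> I \<Longrightarrow> f i \<in> lhom R M (X i)"
  shows "(\<lambda>m\<in>carrier M. \<lambda>i\<in>I. f i m) \<in> lhom R M (direct_product I X)"
  by (rule lhomI) (use M lhomD(1-3)[OF f] in \<open>auto intro!: restrict_ext\<close>)

lemma quotient_module:
  assumes M: "left_module R M" and H: "submodule H R M"
  shows left_module_quotient: "left_module R (quotient_module M H)"
    and quotient_proj_lhom: "(\<lambda>x\<in>carrier M. H +>\<^bsub>M\<^esub> x) \<in> lhom R M (quotient_module M H)"
    and quotient_proj_surj: "(\<lambda>x. H +>\<^bsub>M\<^esub> x) ` carrier M = carrier (quotient_module M H)"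
    and quotient_proj_zero_iff:
      "x \<in> carrier M \<Longrightarrow> H +>\<^bsub>M\<^esub> x = zero (quotient_module M H) \<longleftrightarrow> x \<in> H"
proof -
  interpret M: left_module R M by fact
  interpret H: abelian_subgroup H M
    using H by (intro abelian_subgroupI3 additive_subgroupI) (auto simp: submodule_def M.M.abelian_group_axioms)
  note s = submoduleD[OF H]
  have eq: "H +>\<^bsub>M\<^esub> x = H +>\<^bsub>M\<^esub> y \<longleftrightarrow> x \<ominus>\<^bsub>M\<^esub> y \<in> H" if "x \<in> carrier M" "y \<in> carrier M" for x y
    
    using H.a_rcos_module[of y x] H.a_rcos_self[of x] H.a_repr_independence'[of x y] that
    by (auto simp: a_minus_def)
  \<comment> \<open>\<open>quotient_module\<close> defines the action as a union over a coset; all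
    the sets in that union are the same coset.\<close>
  have sm: "(\<Union>y\<in>H +>\<^bsub>M\<^esub> x. H +>\<^bsub>M\<^esub> (a \<odot>\<^bsub>M\<^esub> y)) = H +>\<^bsub>M\<^esub> (a \<odot>\<^bsub>M\<^esub> x)"
    if ax: "a \<in> carrier R" "x \<in> carrier M" for a x
  proof -
    have "H +>\<^bsub>M\<^esub> (a \<odot>\<^bsub>M\<^esub> y) = H +>\<^bsub>M\<^esub> (a \<odot>\<^bsub>M\<^esub> x)" if "y \<in> H +>\<^bsub>M\<^esub> x" for y

    proof -
      have y: "y \<in> carrier M" "y \<ominus>\<^bsub>M\<^esub> x \<in> H"
        using that ax H.a_elemrcos_carrier[of x y] H.a_rcos_module[of x y] by (auto simp: a_minus_def)
      then have "a \<odot>\<^bsub>M\<^esub> y \<ominus>\<^bsub>M\<^esub> a \<odot>\<^bsub>M\<^esub> x \<in> H"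
        using M.smult_diff[of a y x] s(4)[of a "y \<ominus>\<^bsub>M\<^esub> x"] ax by simp
      then show ?thesis using eq y ax M.smult_closed by simp
    qed
    moreover have "x \<in> H +>\<^bsub>M\<^esub> x" using H.a_rcos_self ax by blast
    ultimately show ?thesis by blast
  qed
  have surj: "(\<lambda>x. H +>\<^bsub>M\<^esub> x) ` carrier M = carrier (quotient_module M H)"
    by (auto simp: quotient_module_def A_RCOSETS_def')
  show "(\<lambda>x. H +>\<^bsub>M\<^esub> x) ` carrier M = carrier (quotient_module M H)" by (fact surj)
  show "left_module R (quotient_module M H)"
    "(\<lambda>x\<in>carrier M. H +>\<^bsub>M\<^esub> x) \<in> lhom R M (quotient_module M H)"
    using left_module_surj_image[OF M surj] M.M.a_coset_add_zero[OF s(5)]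
    by (simp_all add: quotient_module_def H.a_rcos_sum sm)
  show "H +>\<^bsub>M\<^esub> x = zero (quotient_module M H) \<longleftrightarrow> x \<in> H" if "x \<in> carrier M"
    using that eq[of x "\<zero>\<^bsub>M\<^esub>"] M.M.a_coset_add_zero[OF s(5)]
    by (simp add: quotient_module_def a_minus_def M.M.minus_equality[of "\<zero>\<^bsub>M\<^esub>" "\<zero>\<^bsub>M\<^esub>"])
qed

section \<open>Direct summands and retractions\<close>

lemma internal_direct_sum_projection:
  assumes M: "left_module R M" and "internal_direct_sum R M A B"
  shows "\<exists>p\<in>lhom R M (M\<lparr>carrier := A\<rparr>). (\<forall>a\<in>A. p a = a) \<and> (\<forall>x\<in>carrier M. \<exists>b\<in>B. x = p x \<oplus>\<^bsub>M\<^esub> b)"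
proof -
  interpret M: left_module R M by fact
  have A: "submodule A R M" and B: "submodule B R M" and sum: "A <+>\<^bsub>M\<^esub> B = carrier M"
    and int: "A \<inter> B = {\<zero>\<^bsub>M\<^esub>}"
    using assms by (auto simp: internal_direct_sum_def)
  note a = submoduleD[OF A] and b = submoduleD[OF B]
  define p where "p x = (THE a. a \<in> A \<and> (\<exists>b\<in>B. x = a \<oplus>\<^bsub>M\<^esub> b))" for x
  have p: "p (a \<oplus>\<^bsub>M\<^esub> b) = a" if "a \<in> A" "b \<in> B" for a b
    unfolding p_def
  proof (rule the_equality)
    fix a' assume "a' \<in> A \<and> (\<exists>b'\<in>B. a \<oplus>\<^bsub>M\<^esub> b = a' \<oplus>\<^bsub>M\<^esub> b')"
    then obtain b' where b': "a' \<in> A" "b' \<in> B" "a \<oplus>\<^bsub>M\<^esub> b = a' \<oplus>\<^bsub>M\<^esub> b'" by auto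
    note c = a(1)[OF that(1)] a(1)[OF b'(1)] b(1)[OF that(2)] b(1)[OF b'(2)]
    \<comment> \<open>The difference of the two \<open>A\<close>-components is also a difference of
      \<open>B\<close>-components, so it lies in both summands.\<close>
    have "a' \<ominus>\<^bsub>M\<^esub> a = (b' \<oplus>\<^bsub>M\<^esub> a') \<ominus>\<^bsub>M\<^esub> (b' \<oplus>\<^bsub>M\<^esub> a)"
      using c by (simp add: M.M.add_diff_add_cancel)
    also have "\<dots> = (a \<oplus>\<^bsub>M\<^esub> b) \<ominus>\<^bsub>M\<^esub> (a \<oplus>\<^bsub>M\<^esub> b')" using b'(3) c by (simp add: M.M.a_comm)
    also have "\<dots> = b \<ominus>\<^bsub>M\<^esub> b'"
      using c by (simp add: M.M.add_diff_add_cancel)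
    finally have "a' \<ominus>\<^bsub>M\<^esub> a \<in> A \<inter> B" using that b' a b by (simp add: a_minus_def) metis
    then show "a' = a" using int c by (simp add: M.M.right_minus_eq)
  qed (use that in auto)
  have ex: "\<exists>a\<in>A. \<exists>b\<in>B. x = a \<oplus>\<^bsub>M\<^esub> b" if "x \<in> carrier M" for x
  proof -
    have "x \<in> A <+>\<^bsub>M\<^esub> B" using that sum by simp
    then show ?thesis by (auto simp: set_add_def')
  qed
  have pA: "p x \<in> A" if "x \<in> carrier M" for x using ex[OF that] p by auto
  have "restrict p (carrier M) \<in> lhom R M (M\<lparr>carrier := A\<rparr>)"
  proof (rule lhomI)
    fix x assume x: "x \<in> carrier M"
    show "p x \<in> carrier (M\<lparr>carrier := A\<rparr>)" using pA[OF x] by simp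
    from ex[OF x] obtain a1 b1 where x: "a1 \<in> A" "b1 \<in> B" "x = a1 \<oplus>\<^bsub>M\<^esub> b1" by auto
    {
      fix y assume "y \<in> carrier M"
      from ex[OF this] obtain a2 b2 where y: "a2 \<in> A" "b2 \<in> B" "y = a2 \<oplus>\<^bsub>M\<^esub> b2" by auto
      have "x \<oplus>\<^bsub>M\<^esub> y = (a1 \<oplus>\<^bsub>M\<^esub> a2) \<oplus>\<^bsub>M\<^esub> (b1 \<oplus>\<^bsub>M\<^esub> b2)"
        using x y a(1) b(1) by (simp add: M.M.a_ac)
      then show "p (x \<oplus>\<^bsub>M\<^esub> y) = p x \<oplus>\<^bsub>M\<lparr>carrier := A\<rparr>\<^esub> p y"
        using x y p a b by simp
    }
    show "p (r \<odot>\<^bsub>M\<^esub> x) = r \<odot>\<^bsub>M\<lparr>carrier := A\<rparr>\<^esub> p x" if "r \<in> carrier R" for r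
    proof -
      have "r \<odot>\<^bsub>M\<^esub> x = r \<odot>\<^bsub>M\<^esub> a1 \<oplus>\<^bsub>M\<^esub> r \<odot>\<^bsub>M\<^esub> b1"
        using x that a(1) b(1) M.smult_r_distr by simp
      then show ?thesis using x p a b that by simp
    qed
  qed fact
  moreover have "p x = x" if "x \<in> A" for x using p[OF that b(2)] a(1)[OF that] by simp
  moreover have "\<exists>b\<in>B. x = p x \<oplus>\<^bsub>M\<^esub> b" if "x \<in> carrier M" for x using ex[OF that] p by auto
  ultimately show ?thesis using a(1) by (intro bexI[of _ "restrict p (carrier M)"]) auto
qed

text \<open>Trades a complement for a section and a retraction, which behave well under composition.
  Conversely, the kernel of the retraction is the complement.\<close>

lemma direct_summand_iff_retract:
  assumes N: "left_module R N" and P: "left_module R P"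
  shows "direct_summand R N P \<longleftrightarrow> (\<exists>s\<in>lhom R N P. \<exists>r\<in>lhom R P N. \<forall>x\<in>carrier N. r (s x) = x)"
    (is "?L \<longleftrightarrow> ?R")
proof
  interpret N: left_module R N by fact
  interpret P: left_module R P by fact
  assume ?L
  then obtain A B f where AB: "internal_direct_sum R P A B" and f: "f \<in> lhom R N (P\<lparr>carrier := A\<rparr>)"
    and bij: "bij_betw f (carrier N) A"
    by (auto simp: direct_summand_def isomorphic_modules_def)
  have A: "submodule A R P" using AB by (simp add: internal_direct_sum_def)
  note PA = left_module_submodule[OF P A]
  obtain p where p: "p \<in> lhom R P (P\<lparr>carrier := A\<rparr>)" "\<forall>a\<in>A. p a = a"
    using internal_direct_sum_projection[OF P AB] by auto
  obtain g where g: "g \<in> lhom R (P\<lparr>carrier := A\<rparr>) N" "\<forall>x\<in>carrier N. g (f x) = x"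
    using lhom_inverse[OF N PA f] bij by auto
  have "f \<in> lhom R N P"
    using f submoduleD(1)[OF A] by (auto simp: lhom_def)
  moreover have "compose (carrier P) g p \<in> lhom R P N" by (rule compose_lhom[OF P p(1) g(1)])
  moreover have "compose (carrier P) g p (f x) = x" if "x \<in> carrier N" for x
    using that p(2) g(2) lhomD(1)[OF f, of x] submoduleD(1)[OF A] by (simp add: compose_def)
  ultimately show ?R by blast
next
  interpret N: left_module R N by fact
  interpret P: left_module R P by fact
  assume ?R
  then obtain s r where s: "s \<in> lhom R N P" and r: "r \<in> lhom R P N"
    and rs: "\<And>x. x \<in> carrier N \<Longrightarrow> r (s x) = x" by auto
  let ?A = "s ` carrier N" and ?B = "ker P N r"
  have A: "submodule ?A R P" by (rule submodule_image[OF N P s N.submodule_carrier])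
  have B: "submodule ?B R P" by (rule submodule_ker[OF P N r])
  have "x \<in> ?A <+>\<^bsub>P\<^esub> ?B" if x: "x \<in> carrier P" for x
  proof -
    have c: "s (r x) \<in> carrier P" using x lhomD(1)[OF s] lhomD(1)[OF r] by auto
    have "x = s (r x) \<oplus>\<^bsub>P\<^esub> (x \<ominus>\<^bsub>P\<^esub> s (r x))"
      using x c by (simp add: a_minus_def P.M.a_ac P.M.r_neg1 P.M.r_neg2 P.M.r_neg)
    moreover have "x \<ominus>\<^bsub>P\<^esub> s (r x) \<in> ?B"
      using x c lhom_diff[OF P N r x c] rs lhomD(1)[OF r] by (simp add: ker_def N.M.r_neg a_minus_def)
    ultimately show ?thesis using x lhomD(1)[OF r] by (auto simp: set_add_def')
  qed
  moreover have "?A <+>\<^bsub>P\<^esub> ?B \<subseteq> carrier P"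
    using submoduleD(1)[OF A] submoduleD(1)[OF B] by (auto simp: set_add_def')
  moreover have "?A \<inter> ?B = {\<zero>\<^bsub>P\<^esub>}"
    
  proof -
    have "s x = \<zero>\<^bsub>P\<^esub>" if "x \<in> carrier N" "r (s x) = \<zero>\<^bsub>N\<^esub>" for x
      using that rs[OF that(1)] lhom_zero[OF N P s] by simp
    then show ?thesis using submoduleD(2)[OF A] submoduleD(2)[OF B] by (auto simp: ker_def)
  qed
  ultimately have "internal_direct_sum R P ?A ?B"
    using A B by (auto simp: internal_direct_sum_def)
  moreover have "isomorphic_modules R N (P\<lparr>carrier := ?A\<rparr>)"
    unfolding isomorphic_modules_def
  proof
    show "s \<in> lhom R N (P\<lparr>carrier := ?A\<rparr>)" using s by (auto simp: lhom_def)
    show "bij_betw s (carrier N) (carrier (P\<lparr>carrier := ?A\<rparr>))"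
      using rs by (auto simp: bij_betw_def intro: inj_on_inverseI)
  qed
  ultimately show ?L unfolding direct_summand_def by blast
qed

subsection \<open>Scalars\<close>

text \<open>Right \<^term>\<open>R\<close>-modules, as they are stored in the definitions, are left modules over
  the opposite ring.\<close>

definition opposite :: "('r, 'e) ring_scheme \<Rightarrow> ('r, 'e) ring_scheme" where
  "opposite R = R\<lparr>mult := (\<lambda>x y. y \<otimes>\<^bsub>R\<^esub> x)\<rparr>"

lemma opposite_simps [simp]:
  "carrier (opposite R) = carrier R" "\<zero>\<^bsub>opposite R\<^esub> = \<zero>\<^bsub>R\<^esub>" "add (opposite R) = add R"
  "\<one>\<^bsub>opposite R\<^esub> = \<one>\<^bsub>R\<^esub>" "x \<otimes>\<^bsub>opposite R\<^esub> y = y \<otimes>\<^bsub>R\<^esub> x"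
  by (simp_all add: opposite_def)

lemma opposite_smult [simp]: "smult (opposite R) = smult R"
  by (simp add: opposite_def)

lemma ring_opposite: "ring R \<Longrightarrow> ring (opposite R)"
proof -
  assume "ring R"
  then interpret R: ring R .
  have "abelian_group (opposite R)"
    by (rule abelian_groupI) (auto simp: R.a_ac intro: bexI[of _ "\<ominus>\<^bsub>R\<^esub> x" for x] R.l_neg)
  then show ?thesis
    by (intro ringI monoidI) (auto simp: R.m_assoc R.l_distr R.r_distr)
qed

lemma restrict_scalars_simps [simp]:
  "carrier (restrict_scalars R M) = carrier M" "\<zero>\<^bsub>restrict_scalars R M\<^esub> = \<zero>\<^bsub>M\<^esub>"
  "add (restrict_scalars R M) = add M"
  "c \<odot>\<^bsub>restrict_scalars R M\<^esub> x = (c \<odot>\<^bsub>R\<^esub> \<one>\<^bsub>R\<^esub>) \<odot>\<^bsub>M\<^esub> x"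
  by (simp_all add: restrict_scalars_def)

context fin_dim_algebra
begin

abbreviation (input) scalar :: "'k \<Rightarrow> 'r" where
  "scalar c \<equiv> c \<odot>\<^bsub>R\<^esub> \<one>\<^bsub>R\<^esub>"

lemma scalar_mult: "\<lbrakk>c \<in> carrier K; d \<in> carrier K\<rbrakk> \<Longrightarrow> scalar (c \<otimes>\<^bsub>K\<^esub> d) = scalar c \<otimes>\<^bsub>R\<^esub> scalar d"
  by (simp add: smult_mult_left base.smult_assoc1)

lemma scalar_commute: "\<lbrakk>c \<in> carrier K; x \<in> carrier R\<rbrakk> \<Longrightarrow> x \<otimes>\<^bsub>R\<^esub> scalar c = scalar c \<otimes>\<^bsub>R\<^esub> x"
  by (simp add: smult_mult_left smult_mult_right)

lemma left_module_restrict_scalars: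
  assumes "left_module R M"
  shows "left_module K (restrict_scalars R M)"
proof -
  interpret M: left_module R M by fact
  show ?thesis
    by (rule left_moduleI)
      (auto simp: base.R.ring_axioms M.M.a_ac M.smult_closed M.smult_l_distr M.smult_r_distr
        M.smult_assoc M.smult_one M.smult_l_null scalar_mult base.smult_l_distr)
qed

text \<open>Through the opposite algebra, facts about left modules become available for right
  modules such as \<open>ring_dual\<close> and the transpose.\<close>

lemma fin_dim_algebra_opposite: "fin_dim_algebra K (opposite R)"
proof -
  interpret op: ring "opposite R" by (rule ring_opposite) (rule R.ring_axioms)
  have "module K (opposite R)"
    by (rule moduleI)
      (auto simp: base.R.is_cring op.abelian_group_axioms base.smult_l_distr base.smult_r_distr base.smult_assoc1)
  \<comment> \<open>\<open>finsum\<close> sees only the additive structure, so the same finite set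
    spans the opposite algebra.\<close>
  moreover have "finsum (opposite R) f F = finsum R f F" for f :: "'r \<Rightarrow> 'r" and F
    by (simp add: finsum_def opposite_def)
  ultimately show ?thesis
    using finite_dimensional
    by (auto simp: fin_dim_algebra_def fin_dim_algebra_axioms_def smult_mult_left smult_mult_right
       finite_dimensional_def K.field_axioms op.ring_axioms)
qed

lemma left_module_restrict_scalars_right:
  assumes "left_module (opposite R) D"
  shows "left_module K (restrict_scalars R D)"
proof -
  interpret op: fin_dim_algebra K "opposite R" by (rule fin_dim_algebra_opposite)
  have "restrict_scalars (opposite R) D = restrict_scalars R D"
    by (simp add: restrict_scalars_def)
  then show ?thesis using op.left_module_restrict_scalars[OF assms] by simp
qed

lemma field_dual_simps [simp]:
  "carrier (field_dual K R D) = lhom K (restrict_scalars R D) (regular K)"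
  "\<zero>\<^bsub>field_dual K R D\<^esub> = (\<lambda>x\<in>carrier D. \<zero>\<^bsub>K\<^esub>)"
  "\<phi> \<oplus>\<^bsub>field_dual K R D\<^esub> \<psi> = (\<lambda>x\<in>carrier D. \<phi> x \<oplus>\<^bsub>K\<^esub> \<psi> x)"
  "r \<odot>\<^bsub>field_dual K R D\<^esub> \<phi> = (\<lambda>x\<in>carrier D. \<phi> (r \<odot>\<^bsub>D\<^esub> x))"
  by (simp_all add: field_dual_def)

lemma ring_dual_simps [simp]:
  "carrier (ring_dual R P) = lhom R P (regular R)"
  "\<zero>\<^bsub>ring_dual R P\<^esub> = (\<lambda>x\<in>carrier P. \<zero>\<^bsub>R\<^esub>)"
  "f \<oplus>\<^bsub>ring_dual R P\<^esub> g = (\<lambda>x\<in>carrier P. f x \<oplus>\<^bsub>R\<^esub> g x)"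
  "r \<odot>\<^bsub>ring_dual R P\<^esub> f = (\<lambda>x\<in>carrier P. f x \<otimes>\<^bsub>R\<^esub> r)"
  by (simp_all add: ring_dual_def)

lemma left_module_field_dual:
  assumes D: "left_module (opposite R) D"
  shows "left_module R (field_dual K R D)"
proof -
  interpret D: left_module "opposite R" D by fact
  note KD = left_module_restrict_scalars_right[OF D] and KK = left_module_regular[OF base.R.ring_axioms]
  note d = D.smult_closed[simplified]
  show ?thesis
  proof (rule left_moduleI)
    fix \<phi> assume "\<phi> \<in> carrier (field_dual K R D)"
    then have \<phi>: "\<phi> \<in> lhom K (restrict_scalars R D) (regular K)" by simp
    note \<phi>D = lhomD[OF \<phi>, simplified]
    show "\<zero>\<^bsub>field_dual K R D\<^esub> \<oplus>\<^bsub>field_dual K R D\<^esub> \<phi> = \<phi>"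
      using \<phi>D by (auto simp: fun_eq_iff extensional_def)
    show "\<one>\<^bsub>R\<^esub> \<odot>\<^bsub>field_dual K R D\<^esub> \<phi> = \<phi>"
      using \<phi>D D.smult_one by (auto simp: fun_eq_iff extensional_def)
    show "\<zero>\<^bsub>R\<^esub> \<odot>\<^bsub>field_dual K R D\<^esub> \<phi> = \<zero>\<^bsub>field_dual K R D\<^esub>"
      using lhom_zero[OF KD KK \<phi>] D.smult_l_null by (auto simp: fun_eq_iff)
    {
      fix \<psi> assume "\<psi> \<in> carrier (field_dual K R D)"
      then have \<psi>: "\<psi> \<in> lhom K (restrict_scalars R D) (regular K)" by simp
      note \<psi>D = lhomD[OF \<psi>, simplified]
      show "\<phi> \<oplus>\<^bsub>field_dual K R D\<^esub> \<psi> \<in> carrier (field_dual K R D)"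
        using lhom_add_closed[OF KD KK \<phi> \<psi>] by simp
      show "\<phi> \<oplus>\<^bsub>field_dual K R D\<^esub> \<psi> = \<psi> \<oplus>\<^bsub>field_dual K R D\<^esub> \<phi>"
        using \<phi>D \<psi>D by (auto simp: fun_eq_iff base.R.a_comm)
      show "a \<odot>\<^bsub>field_dual K R D\<^esub> (\<phi> \<oplus>\<^bsub>field_dual K R D\<^esub> \<psi>) =
         a \<odot>\<^bsub>field_dual K R D\<^esub> \<phi> \<oplus>\<^bsub>field_dual K R D\<^esub> a \<odot>\<^bsub>field_dual K R D\<^esub> \<psi>" if "a \<in> carrier R" for a
        using that d by (auto simp: fun_eq_iff)
      show "\<phi> \<oplus>\<^bsub>field_dual K R D\<^esub> \<psi> \<oplus>\<^bsub>field_dual K R D\<^esub> \<rho> = \<phi> \<oplus>\<^bsub>field_dual K R D\<^esub> (\<psi> \<oplus>\<^bsub>field_dual K R D\<^esub> \<rho>)"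
        if "\<rho> \<in> carrier (field_dual K R D)" for \<rho>
      proof -
        have "\<rho> \<in> lhom K (restrict_scalars R D) (regular K)" using that by simp
        note \<rho>D = lhomD[OF this, simplified]
        show ?thesis using \<phi>D \<psi>D \<rho>D by (auto simp: fun_eq_iff base.R.a_assoc)
      qed
    }
    fix a assume a: "a \<in> carrier R"
    \<comment> \<open>Elements of \<open>K\<close> act centrally; this keeps \<open>a\<close> times
      a \<open>K\<close>-linear functional \<open>K\<close>-linear.\<close>
    have e: "a \<odot>\<^bsub>D\<^esub> ((c \<odot>\<^bsub>R\<^esub> \<one>\<^bsub>R\<^esub>) \<odot>\<^bsub>D\<^esub> x) = (c \<odot>\<^bsub>R\<^esub> \<one>\<^bsub>R\<^esub>) \<odot>\<^bsub>D\<^esub> (a \<odot>\<^bsub>D\<^esub> x)"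
      if "c \<in> carrier K" "x \<in> carrier D" for c x
      using that a D.smult_assoc[of a "scalar c" x] D.smult_assoc[of "scalar c" a x] scalar_commute[of c a]
      by simp
    have "restrict (\<lambda>x. \<phi> (a \<odot>\<^bsub>D\<^esub> x)) (carrier (restrict_scalars R D)) \<in> lhom K (restrict_scalars R D) (regular K)"
      by (rule lhomI) (use \<phi>D a d KD D.smult_r_distr e in auto)
    then show "a \<odot>\<^bsub>field_dual K R D\<^esub> \<phi> \<in> carrier (field_dual K R D)" by simp
    fix b assume b: "b \<in> carrier R"
    show "(a \<oplus>\<^bsub>R\<^esub> b) \<odot>\<^bsub>field_dual K R D\<^esub> \<phi> = a \<odot>\<^bsub>field_dual K R D\<^esub> \<phi> \<oplus>\<^bsub>field_dual K R D\<^esub> b \<odot>\<^bsub>field_dual K R D\<^esub> \<phi>"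
      using a b \<phi>D d D.smult_l_distr by (auto simp: fun_eq_iff)
    \<comment> \<open>The right action on \<open>D\<close> reverses products and precomposition
      reverses them again, so the result is a left module over \<open>R\<close>.\<close>
    show "(a \<otimes>\<^bsub>R\<^esub> b) \<odot>\<^bsub>field_dual K R D\<^esub> \<phi> = a \<odot>\<^bsub>field_dual K R D\<^esub> (b \<odot>\<^bsub>field_dual K R D\<^esub> \<phi>)"
      using a b d D.smult_assoc[of b a] by (auto simp: fun_eq_iff)
  next
    have "restrict (\<lambda>x. \<zero>\<^bsub>K\<^esub>) (carrier (restrict_scalars R D)) \<in> lhom K (restrict_scalars R D) (regular K)"
      by (rule lhomI) (use KD in auto)
    then show "\<zero>\<^bsub>field_dual K R D\<^esub> \<in> carrier (field_dual K R D)" by simp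
  qed (rule R.ring_axioms)
qed

text \<open>Inside the product of copies of \<open>R\<close>, taken as a right module and indexed by
  \<open>carrier P\<close>, only closure of Hom(P, R) has to be checked.\<close>

lemma left_module_ring_dual:
  assumes P: "left_module R P"
  shows "left_module (opposite R) (ring_dual R P)"
proof -
  let ?D = "direct_product (carrier P) (\<lambda>_. regular (opposite R))"
  have op: "ring (opposite R)" by (rule ring_opposite[OF R.ring_axioms])
  have D: "left_module (opposite R) ?D"
    by (rule left_module_direct_product[OF op left_module_regular[OF op]])
  interpret D: left_module "opposite R" ?D by (rule D)
  note RR = left_module_regular[OF R.ring_axioms]
  have "submodule (lhom R P (regular R)) (opposite R) ?D"
  proof (rule D.submoduleI)
    show "lhom R P (regular R) \<subseteq> carrier ?D" by (auto simp: lhom_def)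
    show "\<zero>\<^bsub>?D\<^esub> \<in> lhom R P (regular R)" using zero_lhom[OF P RR] by simp
    fix f assume f: "f \<in> lhom R P (regular R)"
    show "f \<oplus>\<^bsub>?D\<^esub> g \<in> lhom R P (regular R)" if "g \<in> lhom R P (regular R)" for g
      using lhom_add_closed[OF P RR f that] by simp
    show "r \<odot>\<^bsub>?D\<^esub> f \<in> lhom R P (regular R)" if "r \<in> carrier (opposite R)" for r
      using lhomI[of P "\<lambda>x. f x \<otimes>\<^bsub>R\<^esub> r" "regular R" R] lhomD[OF f] that P by (simp add: R.m_assoc R.l_distr)
  qed
  from left_module_submodule[OF D this] show ?thesis
    by (simp add: ring_dual_def direct_product_def)
qed

end

subsection \<open>Extension of linear functionals\<close>

text \<open>A functional is built as a maximal single-valued linear relation, which covers at once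
  functionals prescribed on a subspace and functionals required to vanish on another one.\<close>

lemma extend_functional:
  assumes K: "field K" and V: "left_module K V" and sub: "G \<subseteq> carrier V \<times> carrier K"
    and zero: "(\<zero>\<^bsub>V\<^esub>, \<zero>\<^bsub>K\<^esub>) \<in> G"
    and add: "\<And>v a w b. \<lbrakk>(v, a) \<in> G; (w, b) \<in> G\<rbrakk> \<Longrightarrow> (v \<oplus>\<^bsub>V\<^esub> w, a \<oplus>\<^bsub>K\<^esub> b) \<in> G"
    and smult: "\<And>c v a. \<lbrakk>c \<in> carrier K; (v, a) \<in> G\<rbrakk> \<Longrightarrow> (c \<odot>\<^bsub>V\<^esub> v, c \<otimes>\<^bsub>K\<^esub> a) \<in> G"
    and single: "\<And>a. (\<zero>\<^bsub>V\<^esub>, a) \<in> G \<Longrightarrow> a = \<zero>\<^bsub>K\<^esub>"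
  shows "\<exists>\<phi>\<in>lhom K V (regular K). \<forall>v a. (v, a) \<in> G \<longrightarrow> \<phi> v = a"
proof -
  interpret K: field K by fact
  interpret V: left_module K V by fact
  define lin where "lin H \<longleftrightarrow> H \<subseteq> carrier V \<times> carrier K \<and> (\<zero>\<^bsub>V\<^esub>, \<zero>\<^bsub>K\<^esub>) \<in> H \<and>
    (\<forall>v a w b. (v, a) \<in> H \<and> (w, b) \<in> H \<longrightarrow> (v \<oplus>\<^bsub>V\<^esub> w, a \<oplus>\<^bsub>K\<^esub> b) \<in> H) \<and>
    (\<forall>c v a. c \<in> carrier K \<and> (v, a) \<in> H \<longrightarrow> (c \<odot>\<^bsub>V\<^esub> v, c \<otimes>\<^bsub>K\<^esub> a) \<in> H) \<and>
    (\<forall>a. (\<zero>\<^bsub>V\<^esub>, a) \<in> H \<longrightarrow> a = \<zero>\<^bsub>K\<^esub>)" for H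
  have "\<exists>H\<in>{H. G \<subseteq> H \<and> lin H}. \<forall>X\<in>{H. G \<subseteq> H \<and> lin H}. H \<subseteq> X \<longrightarrow> X = H"
  proof (rule subset_Zorn_nonempty)
    have "lin G" unfolding lin_def using assms by blast
    then show "{H. G \<subseteq> H \<and> lin H} \<noteq> {}" by blast
    fix C assume C: "C \<noteq> {}" "subset.chain {H. G \<subseteq> H \<and> lin H} C"
    have l: "lin H" "G \<subseteq> H" if "H \<in> C" for H
      using C(2) that by (auto simp: subset.chain_def)
    have ch: "H \<subseteq> H' \<or> H' \<subseteq> H" if "H \<in> C" "H' \<in> C" for H H'
      using C(2) that unfolding subset_chain_def by blast
    have "lin (\<Union>C)" unfolding lin_def
    proof (intro conjI allI impI)
      show "\<Union>C \<subseteq> carrier V \<times> carrier K" using l(1) unfolding lin_def by blast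
      show "(\<zero>\<^bsub>V\<^esub>, \<zero>\<^bsub>K\<^esub>) \<in> \<Union>C" using C(1) l(1) unfolding lin_def by blast
      show "a = \<zero>\<^bsub>K\<^esub>" if "(\<zero>\<^bsub>V\<^esub>, a) \<in> \<Union>C" for a using that l(1) unfolding lin_def by blast
      show "(c \<odot>\<^bsub>V\<^esub> v, c \<otimes>\<^bsub>K\<^esub> a) \<in> \<Union>C" if "c \<in> carrier K \<and> (v, a) \<in> \<Union>C" for c v a
        using that l(1) unfolding lin_def by blast
      fix v a w b assume "(v, a) \<in> \<Union>C \<and> (w, b) \<in> \<Union>C"
      then obtain H H' where H: "H \<in> C" "H' \<in> C" "(v, a) \<in> H" "(w, b) \<in> H'" by blast
      then obtain H'' where "H'' \<in> C" "(v, a) \<in> H''" "(w, b) \<in> H''" using ch[of H H'] by blast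
      then show "(v \<oplus>\<^bsub>V\<^esub> w, a \<oplus>\<^bsub>K\<^esub> b) \<in> \<Union>C" using l(1) unfolding lin_def by blast
    qed
    moreover have "G \<subseteq> \<Union>C" using C(1) l(2) by blast
    ultimately show "\<Union>C \<in> {H. G \<subseteq> H \<and> lin H}" by blast
  qed
  then obtain H where *: "H \<in> {H. G \<subseteq> H \<and> lin H}" "\<forall>X\<in>{H. G \<subseteq> H \<and> lin H}. H \<subseteq> X \<longrightarrow> X = H"
    by (rule bexE)
  have GH: "G \<subseteq> H" and H: "lin H" using *(1) by auto
  have max: "X = H" if "G \<subseteq> X" "lin X" "H \<subseteq> X" for X using *(2) that by simp
  have Hs: "v \<in> carrier V" "a \<in> carrier K" if "(v, a) \<in> H" for v a
    using H that unfolding lin_def by auto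
  have H0: "(\<zero>\<^bsub>V\<^esub>, \<zero>\<^bsub>K\<^esub>) \<in> H" and H1: "\<And>a. (\<zero>\<^bsub>V\<^esub>, a) \<in> H \<Longrightarrow> a = \<zero>\<^bsub>K\<^esub>"
    using H unfolding lin_def by auto
  have Ha: "(v \<oplus>\<^bsub>V\<^esub> w, a \<oplus>\<^bsub>K\<^esub> b) \<in> H" if "(v, a) \<in> H" "(w, b) \<in> H" for v a w b
    using H that unfolding lin_def by blast
  have Hm: "(c \<odot>\<^bsub>V\<^esub> v, c \<otimes>\<^bsub>K\<^esub> a) \<in> H" if "c \<in> carrier K" "(v, a) \<in> H" for c v a
    using H that unfolding lin_def by blast
  have Hn: "(\<ominus>\<^bsub>V\<^esub> v, \<ominus>\<^bsub>K\<^esub> a) \<in> H" if "(v, a) \<in> H" for v a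
    using Hm[of "\<ominus>\<^bsub>K\<^esub> \<one>\<^bsub>K\<^esub>" v a] that Hs[OF that] by (simp add: V.smult_minus_one K.l_minus)
  have dom: "\<exists>a. (x, a) \<in> H" if x: "x \<in> carrier V" for x
  proof (rule ccontr)
    assume nx: "\<nexists>a. (x, a) \<in> H"
    \<comment> \<open>The enlargement of \<open>H\<close> that assigns zero to \<open>x\<close>; any
      other value would do as well.\<close>
    define X where "X = {(v \<oplus>\<^bsub>V\<^esub> c \<odot>\<^bsub>V\<^esub> x, a) |v c a. c \<in> carrier K \<and> (v, a) \<in> H}"
    have XI: "(v \<oplus>\<^bsub>V\<^esub> c \<odot>\<^bsub>V\<^esub> x, a) \<in> X" if "c \<in> carrier K" "(v, a) \<in> H" for v c a
      unfolding X_def using that by blast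
    have HX: "H \<subseteq> X"
    proof
      fix z assume z: "z \<in> H"
      obtain v a where "z = (v, a)" by (cases z)
      then show "z \<in> X" using XI[of "\<zero>\<^bsub>K\<^esub>" v a] z Hs[of v a] x by (simp add: V.smult_l_null)
    qed
    have "lin X" unfolding lin_def
    proof (intro conjI allI impI)
      show "X \<subseteq> carrier V \<times> carrier K" unfolding X_def using Hs x V.smult_closed by blast
      show "(\<zero>\<^bsub>V\<^esub>, \<zero>\<^bsub>K\<^esub>) \<in> X" using HX H0 by blast
      show "(v \<oplus>\<^bsub>V\<^esub> w, a \<oplus>\<^bsub>K\<^esub> b) \<in> X" if "(v, a) \<in> X \<and> (w, b) \<in> X" for v a w b
      proof -
        from that obtain v' c w' d where *: "v = v' \<oplus>\<^bsub>V\<^esub> c \<odot>\<^bsub>V\<^esub> x" "w = w' \<oplus>\<^bsub>V\<^esub> d \<odot>\<^bsub>V\<^esub> x"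
          "c \<in> carrier K" "d \<in> carrier K" "(v', a) \<in> H" "(w', b) \<in> H" unfolding X_def by blast
        have "v \<oplus>\<^bsub>V\<^esub> w = (v' \<oplus>\<^bsub>V\<^esub> w') \<oplus>\<^bsub>V\<^esub> (c \<oplus>\<^bsub>K\<^esub> d) \<odot>\<^bsub>V\<^esub> x"
          using * Hs x by (simp add: V.smult_l_distr V.smult_closed V.M.a_ac)
        then show ?thesis using XI[OF _ Ha[OF *(5,6)], of "c \<oplus>\<^bsub>K\<^esub> d"] * by simp
      qed
      show "(c \<odot>\<^bsub>V\<^esub> v, c \<otimes>\<^bsub>K\<^esub> a) \<in> X" if "c \<in> carrier K \<and> (v, a) \<in> X" for c v a
      proof -
        from that obtain v' d where *: "c \<in> carrier K" "v = v' \<oplus>\<^bsub>V\<^esub> d \<odot>\<^bsub>V\<^esub> x"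
          "d \<in> carrier K" "(v', a) \<in> H" unfolding X_def by blast
        have "c \<odot>\<^bsub>V\<^esub> v = c \<odot>\<^bsub>V\<^esub> v' \<oplus>\<^bsub>V\<^esub> (c \<otimes>\<^bsub>K\<^esub> d) \<odot>\<^bsub>V\<^esub> x"
          using * Hs x by (simp add: V.smult_r_distr V.smult_closed V.smult_assoc)
        then show ?thesis using XI[OF _ Hm[OF *(1,4)], of "c \<otimes>\<^bsub>K\<^esub> d"] * by simp
      qed
      fix a assume "(\<zero>\<^bsub>V\<^esub>, a) \<in> X"
      then obtain v c where *: "\<zero>\<^bsub>V\<^esub> = v \<oplus>\<^bsub>V\<^esub> c \<odot>\<^bsub>V\<^esub> x" "c \<in> carrier K" "(v, a) \<in> H"
        unfolding X_def by blast
      have cx: "c \<odot>\<^bsub>V\<^esub> x = \<ominus>\<^bsub>V\<^esub> v"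
        using * Hs x V.M.minus_equality[of "c \<odot>\<^bsub>V\<^esub> x" v] by (simp add: V.smult_closed V.M.a_comm)
      \<comment> \<open>Otherwise \<open>c\<close> is invertible and \<open>x\<close> is a multiple
        of \<open>v\<close>, hence already in the domain of \<open>H\<close>.\<close>
      have "c = \<zero>\<^bsub>K\<^esub>"
      proof (rule ccontr)
        assume "c \<noteq> \<zero>\<^bsub>K\<^esub>"
        then have c: "inv\<^bsub>K\<^esub> c \<in> carrier K" "inv\<^bsub>K\<^esub> c \<otimes>\<^bsub>K\<^esub> c = \<one>\<^bsub>K\<^esub>"
          using *(2) K.field_Units by (auto simp: K.Units_inv_closed K.Units_l_inv)
        then have "x = inv\<^bsub>K\<^esub> c \<odot>\<^bsub>V\<^esub> (c \<odot>\<^bsub>V\<^esub> x)"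
          using * x by (simp flip: V.smult_assoc add: V.smult_one)
        also have "\<dots> = inv\<^bsub>K\<^esub> c \<odot>\<^bsub>V\<^esub> (\<ominus>\<^bsub>V\<^esub> v)" by (simp add: cx)
        finally show False using nx Hm[OF c(1) Hn[OF *(3)]] by auto
      qed
      then have "v = \<zero>\<^bsub>V\<^esub>" using * x Hs by (simp add: V.smult_l_null)
      then show "a = \<zero>\<^bsub>K\<^esub>" using * H1 by simp
    qed
    then have "X = H" using max HX GH by blast
    moreover have "(x, \<zero>\<^bsub>K\<^esub>) \<in> X"
      using XI[OF _ H0, of "\<one>\<^bsub>K\<^esub>"] x by (simp add: V.smult_one)
    ultimately show False using nx by blast
  qed
  \<comment> \<open>Single-valuedness at zero spreads to every point by subtraction.\<close>
  have uniq: "a = b" if "(v, a) \<in> H" "(v, b) \<in> H" for v a b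
  proof -
    have "(\<zero>\<^bsub>V\<^esub>, a \<ominus>\<^bsub>K\<^esub> b) \<in> H"
      using Ha[OF that(1) Hn[OF that(2)]] Hs that by (simp add: V.M.r_neg a_minus_def)
    then show ?thesis using H1 Hs(2) that K.right_minus_eq[of a b] by blast
  qed
  define \<phi> where "\<phi> v = (THE a. (v, a) \<in> H)" for v
  have \<phi>: "\<phi> v = a" if "(v, a) \<in> H" for v a
    unfolding \<phi>_def using that uniq by blast
  have \<phi>H: "(v, \<phi> v) \<in> H" if "v \<in> carrier V" for v
    using dom[OF that] \<phi> by auto
  have "restrict \<phi> (carrier V) \<in> lhom K V (regular K)"
  proof (rule lhomI)
    show "\<phi> v \<in> carrier (regular K)" if "v \<in> carrier V" for v
      using \<phi>H[OF that] Hs by simp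
    show "\<phi> (v \<oplus>\<^bsub>V\<^esub> w) = \<phi> v \<oplus>\<^bsub>regular K\<^esub> \<phi> w" if "v \<in> carrier V" "w \<in> carrier V" for v w
      using \<phi>[OF Ha[OF \<phi>H \<phi>H]] that by simp
    show "\<phi> (c \<odot>\<^bsub>V\<^esub> v) = c \<odot>\<^bsub>regular K\<^esub> \<phi> v" if "c \<in> carrier K" "v \<in> carrier V" for c v
      using \<phi>[OF Hm[OF _ \<phi>H]] that by simp
  qed fact
  moreover have "restrict \<phi> (carrier V) v = a" if "(v, a) \<in> G" for v a
    using \<phi> that GH sub by auto
  ultimately show ?thesis by blast
qed

text \<open>The relation handed to \<open>extend_functional\<close> consists of the pairs of
  \<open>s x + t y\<close> and \<open>\<phi> x\<close>. Both \<open>s\<close> and \<open>t\<close>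
  may have kernels, and their images may meet: \<open>single\<close> says exactly that zero is
  related to zero alone.\<close>

lemma extend_functional_along:
  assumes K: "field K" and V: "left_module K V" and V1: "left_module K V1" and V2: "left_module K V2"
    and s: "s \<in> lhom K V1 V" and t: "t \<in> lhom K V2 V" and \<phi>: "\<phi> \<in> lhom K V1 (regular K)"
    and single: "\<And>x y. \<lbrakk>x \<in> carrier V1; y \<in> carrier V2; s x \<oplus>\<^bsub>V\<^esub> t y = \<zero>\<^bsub>V\<^esub>\<rbrakk> \<Longrightarrow> \<phi> x = \<zero>\<^bsub>K\<^esub>"
  shows "\<exists>\<psi>\<in>lhom K V (regular K). (\<forall>x\<in>carrier V1. \<psi> (s x) = \<phi> x) \<and> (\<forall>y\<in>carrier V2. \<psi> (t y) = \<zero>\<^bsub>K\<^esub>)"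
proof -
  interpret K: field K by fact
  interpret V: left_module K V by fact
  interpret V1: left_module K V1 by fact
  interpret V2: left_module K V2 by fact
  note sD = lhomD[OF s] and tD = lhomD[OF t] and \<phi>D = lhomD[OF \<phi>, simplified]
  have z: "s \<zero>\<^bsub>V1\<^esub> = \<zero>\<^bsub>V\<^esub>" "t \<zero>\<^bsub>V2\<^esub> = \<zero>\<^bsub>V\<^esub>" "\<phi> \<zero>\<^bsub>V1\<^esub> = \<zero>\<^bsub>K\<^esub>"
    using lhom_zero[OF V1 V s] lhom_zero[OF V2 V t]
      lhom_zero[OF V1 left_module_regular[OF K.ring_axioms] \<phi>] by simp_all
  let ?G = "{(s x \<oplus>\<^bsub>V\<^esub> t y, \<phi> x) |x y. x \<in> carrier V1 \<and> y \<in> carrier V2}"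
  have GI: "(v, a) \<in> ?G" if "x \<in> carrier V1" "y \<in> carrier V2" "v = s x \<oplus>\<^bsub>V\<^esub> t y" "a = \<phi> x" for v a x y
    using that by blast
  have "\<exists>\<psi>\<in>lhom K V (regular K). \<forall>v a. (v, a) \<in> ?G \<longrightarrow> \<psi> v = a"
  proof (rule extend_functional[OF K V])
    show "?G \<subseteq> carrier V \<times> carrier K" using sD(1) tD(1) \<phi>D(1) by auto
    show "(\<zero>\<^bsub>V\<^esub>, \<zero>\<^bsub>K\<^esub>) \<in> ?G" by (rule GI[OF V1.M.zero_closed V2.M.zero_closed]) (simp_all add: z)
    show "(v \<oplus>\<^bsub>V\<^esub> w, a \<oplus>\<^bsub>K\<^esub> b) \<in> ?G" if vw: "(v, a) \<in> ?G" "(w, b) \<in> ?G" for v a w b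
    proof -
      from vw obtain x y x' y' where "x \<in> carrier V1" "y \<in> carrier V2" "x' \<in> carrier V1" "y' \<in> carrier V2"
        "v = s x \<oplus>\<^bsub>V\<^esub> t y" "a = \<phi> x" "w = s x' \<oplus>\<^bsub>V\<^esub> t y'" "b = \<phi> x'" by blast
      then show ?thesis
        by (intro GI[of "x \<oplus>\<^bsub>V1\<^esub> x'" "y \<oplus>\<^bsub>V2\<^esub> y'"]) (simp_all add: sD tD \<phi>D V.M.a_ac)
    qed
    show "(c \<odot>\<^bsub>V\<^esub> v, c \<otimes>\<^bsub>K\<^esub> a) \<in> ?G" if c: "c \<in> carrier K" and va: "(v, a) \<in> ?G" for c v a
    proof -
      from va obtain x y where "x \<in> carrier V1" "y \<in> carrier V2" "v = s x \<oplus>\<^bsub>V\<^esub> t y" "a = \<phi> x" by blast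
      then show ?thesis
        using c by (intro GI[of "c \<odot>\<^bsub>V1\<^esub> x" "c \<odot>\<^bsub>V2\<^esub> y"])
          (simp_all add: sD tD \<phi>D V.smult_r_distr V1.smult_closed V2.smult_closed)
    qed
    show "a = \<zero>\<^bsub>K\<^esub>" if "(\<zero>\<^bsub>V\<^esub>, a) \<in> ?G" for a using that single by auto
  qed
  then obtain \<psi> where \<psi>: "\<psi> \<in> lhom K V (regular K)" "\<And>v a. (v, a) \<in> ?G \<Longrightarrow> \<psi> v = a" by blast
  have "\<psi> (s x) = \<phi> x" if "x \<in> carrier V1" for x
    by (rule \<psi>(2), rule GI[OF that V2.M.zero_closed]) (use that sD(1) in \<open>simp_all add: z\<close>)
  moreover have "\<psi> (t y) = \<zero>\<^bsub>K\<^esub>" if "y \<in> carrier V2" for y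
    by (rule \<psi>(2), rule GI[OF V1.M.zero_closed that]) (use that tD(1) in \<open>simp_all add: z\<close>)
  ultimately show ?thesis using \<psi>(1) by blast
qed

text \<open>The case in which \<open>t\<close> is the zero map.\<close>

corollary extend_functional_kernel:
  assumes K: "field K" and V: "left_module K V" and V1: "left_module K V1"
    and s: "s \<in> lhom K V1 V" and \<phi>: "\<phi> \<in> lhom K V1 (regular K)"
    and ker: "\<And>x. \<lbrakk>x \<in> carrier V1; s x = \<zero>\<^bsub>V\<^esub>\<rbrakk> \<Longrightarrow> \<phi> x = \<zero>\<^bsub>K\<^esub>"
  shows "\<exists>\<psi>\<in>lhom K V (regular K). \<forall>x\<in>carrier V1. \<psi> (s x) = \<phi> x"
proof -
  interpret V: left_module K V by fact
  show ?thesis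
    using extend_functional_along[OF K V V1 V1 s zero_lhom[OF V1 V] \<phi>] ker lhomD(1)[OF s] by auto
qed

subsection \<open>Finite length\<close>

text \<open>A strictly monotone measure on the lattice of submodules exists exactly for modules of
  finite length, and plays the role of the length.\<close>

definition finite_length :: "('r, 'e) ring_scheme \<Rightarrow> ('r, 'm) module \<Rightarrow> bool" where
  "finite_length R M \<longleftrightarrow> (\<exists>\<mu> :: 'm set \<Rightarrow> nat. \<forall>W W'.
     submodule W R M \<longrightarrow> submodule W' R M \<longrightarrow> W \<subset> W' \<longrightarrow> \<mu> W < \<mu> W')"

lemma finite_lengthI:
  assumes "\<And>W W'. \<lbrakk>submodule W R M; submodule W' R M; W \<subset> W'\<rbrakk> \<Longrightarrow> (\<mu> W :: nat) < \<mu> W'"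
  shows "finite_length R M"
  unfolding finite_length_def using assms by (intro exI[of _ \<mu>] allI impI)

lemma finite_lengthE:
  assumes "finite_length R M"
  obtains \<mu> :: "'m set \<Rightarrow> nat" where
    "\<And>W W'. \<lbrakk>submodule W R M; submodule W' R M; W \<subset> W'\<rbrakk> \<Longrightarrow> \<mu> W < \<mu> W'"
  using assms unfolding finite_length_def by metis

lemma finite_length_inj:
  assumes M: "left_module R M" and N: "left_module R N" and f: "f \<in> lhom R M N"
    and inj: "inj_on f (carrier M)" and "finite_length R N"
  shows "finite_length R M"
proof -
  obtain \<mu> :: "_ set \<Rightarrow> nat" where \<mu>: "\<And>W W'. submodule W R N \<Longrightarrow> submodule W' R N \<Longrightarrow> W \<subset> W' \<Longrightarrow> \<mu> W < \<mu> W'"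
    by (rule finite_lengthE[OF assms(5)]) blast
  have "\<mu> (f ` W) < \<mu> (f ` W')" if "submodule W R M" "submodule W' R M" "W \<subset> W'" for W W'
  proof (rule \<mu>)
    show "f ` W \<subset> f ` W'"
      using that(3) inj_on_image_eq_iff[OF inj submoduleD(5)[OF that(1)] submoduleD(5)[OF that(2)]] by blast
  qed (rule submodule_image[OF M N f], fact)+
  then show ?thesis by (rule finite_lengthI)
qed

lemma finite_length_surj:
  assumes M: "left_module R M" and N: "left_module R N" and f: "f \<in> lhom R M N"
    and surj: "f ` carrier M = carrier N" and "finite_length R M"
  shows "finite_length R N"
proof -
  obtain \<mu> :: "_ set \<Rightarrow> nat" where \<mu>: "\<And>W W'. submodule W R M \<Longrightarrow> submodule W' R M \<Longrightarrow> W \<subset> W' \<Longrightarrow> \<mu> W < \<mu> W'"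
    by (rule finite_lengthE[OF assms(5)]) blast
  have "\<mu> {x \<in> carrier M. f x \<in> W} < \<mu> {x \<in> carrier M. f x \<in> W'}"
    if "submodule W R N" "submodule W' R N" "W \<subset> W'" for W W'
  proof (rule \<mu>)
    from that(3) obtain y where y: "y \<in> W'" "y \<notin> W" by blast
    then have "y \<in> f ` carrier M" using submoduleD(1)[OF that(2)] surj by blast
    then show "{x \<in> carrier M. f x \<in> W} \<subset> {x \<in> carrier M. f x \<in> W'}"
      using that(3) y by blast
  qed (rule submodule_vimage[OF M N f], fact)+
  then show ?thesis by (rule finite_lengthI)
qed

text \<open>A submodule is measured by its trace on the kernel plus its image. Both parts grow
  weakly, and if neither grows then the two submodules coincide by the modular law.\<close>

lemma finite_length_extension:
  assumes M: "left_module R M" and N: "left_module R N" and f: "f \<in> lhom R M N"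
    and "finite_length R (M\<lparr>carrier := ker M N f\<rparr>)" and "finite_length R N"
  shows "finite_length R M"
proof -
  interpret M: left_module R M by fact
  interpret N: left_module R N by fact
  let ?k = "ker M N f"
  have k: "submodule ?k R M" by (rule submodule_ker[OF M N f])
  obtain \<mu> :: "_ set \<Rightarrow> nat" where \<mu>: "\<And>W W'. submodule W R N \<Longrightarrow> submodule W' R N \<Longrightarrow> W \<subset> W' \<Longrightarrow> \<mu> W < \<mu> W'"
    by (rule finite_lengthE[OF assms(5)]) blast
  obtain \<nu> :: "_ set \<Rightarrow> nat" where \<nu>: "\<And>W W'. submodule W R (M\<lparr>carrier := ?k\<rparr>) \<Longrightarrow>
      submodule W' R (M\<lparr>carrier := ?k\<rparr>) \<Longrightarrow> W \<subset> W' \<Longrightarrow> \<nu> W < \<nu> W'"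
    by (rule finite_lengthE[OF assms(4)]) blast
  have "\<nu> (W \<inter> ?k) + \<mu> (f ` W) < \<nu> (W' \<inter> ?k) + \<mu> (f ` W')"
    if W: "submodule W R M" and W': "submodule W' R M" and "W \<subset> W'" for W W'
  proof -
    note s = submodule_image[OF M N f W] submodule_image[OF M N f W']
    have t: "submodule (W \<inter> ?k) R (M\<lparr>carrier := ?k\<rparr>)" "submodule (W' \<inter> ?k) R (M\<lparr>carrier := ?k\<rparr>)"
      using submodule_submodule_iff[OF M k] M.submodule_Int W W' k by blast+
    have "W \<inter> ?k \<subset> W' \<inter> ?k \<or> f ` W \<subset> f ` W'"
    proof (rule ccontr)
      assume "\<not> ?thesis"
      then have e: "W \<inter> ?k = W' \<inter> ?k" "f ` W = f ` W'" using \<open>W \<subset> W'\<close> by blast+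
      have "x \<in> W" if x: "x \<in> W'" for x
      proof -
        obtain w where w: "w \<in> W" "f x = f w" using e(2) x by blast
        note c = submoduleD(1)[OF W' x] submoduleD(1)[OF W w(1)]
        have "x \<ominus>\<^bsub>M\<^esub> w \<in> W'" using x w \<open>W \<subset> W'\<close> submoduleD(3,6)[OF W'] by (auto simp: a_minus_def)
        moreover have "x \<ominus>\<^bsub>M\<^esub> w \<in> ?k"
          using c w lhom_diff[OF M N f] lhomD(1)[OF f] by (simp add: ker_def a_minus_def N.M.r_neg)
        ultimately have "x \<ominus>\<^bsub>M\<^esub> w \<in> W" using e by blast
        then have "x \<ominus>\<^bsub>M\<^esub> w \<oplus>\<^bsub>M\<^esub> w \<in> W" using w submoduleD(3)[OF W] by blast
        then show ?thesis using c by (simp add: a_minus_def M.M.a_assoc M.M.l_neg)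
      qed
      then show False using \<open>W \<subset> W'\<close> by blast
    qed
    then show ?thesis
    proof
      assume "W \<inter> ?k \<subset> W' \<inter> ?k"
      moreover have "\<mu> (f ` W) \<le> \<mu> (f ` W')"
        using \<mu>[OF s] \<open>W \<subset> W'\<close> by (cases "f ` W = f ` W'") (auto intro: less_imp_le)
      ultimately show ?thesis using \<nu>[OF t] by simp
    next
      assume "f ` W \<subset> f ` W'"
      moreover have "\<nu> (W \<inter> ?k) \<le> \<nu> (W' \<inter> ?k)"
        using \<nu>[OF t] \<open>W \<subset> W'\<close> by (cases "W \<inter> ?k = W' \<inter> ?k") (auto intro: less_imp_le)
      ultimately show ?thesis using \<mu>[OF s] by simp
    qed
  qed
  then show ?thesis by (rule finite_lengthI)
qed

text \<open>The iterated preimages of \<^term>\<open>{\<zero>\<^bsub>M\<^esub>}\<close> would form a strictly ascending chain.\<close>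

lemma finite_length_surj_endomorphism:
  assumes M: "left_module R M" and fl: "finite_length R M" and u: "u \<in> lhom R M M"
    and surj: "u ` carrier M = carrier M"
  shows "inj_on u (carrier M)"
proof (rule inj_on_lhom[OF M M u], rule ccontr)
  interpret M: left_module R M by fact
  obtain \<mu> :: "_ set \<Rightarrow> nat" where \<mu>: "\<And>W W'. submodule W R M \<Longrightarrow> submodule W' R M \<Longrightarrow> W \<subset> W' \<Longrightarrow> \<mu> W < \<mu> W'"
    by (rule finite_lengthE[OF fl]) blast
  fix x assume x: "x \<in> carrier M" "u x = \<zero>\<^bsub>M\<^esub>" "x \<noteq> \<zero>\<^bsub>M\<^esub>"
  define k where "k m = ((\<lambda>W. {x \<in> carrier M. u x \<in> W}) ^^ m) {\<zero>\<^bsub>M\<^esub>}" for m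
  have kS: "k (Suc m) = {x \<in> carrier M. u x \<in> k m}" for m by (simp add: k_def)
  have k: "submodule (k m) R M" for m
  proof (induction m)
    case 0 show ?case using M.submodule_zero by (simp add: k_def)
  next
    case (Suc m) then show ?case unfolding kS by (rule submodule_vimage[OF M M u])
  qed
  have lt: "k m \<subset> k (Suc m)" for m
  proof (induction m)
    case 0 show ?case using x lhom_zero[OF M M u] by (auto simp: k_def)
  next
    case (Suc m)
    then obtain y where y: "y \<in> k (Suc m)" "y \<notin> k m" by blast
    then have "y \<in> u ` carrier M" using surj submoduleD(1)[OF k] by auto
    then obtain z where "z \<in> carrier M" "u z = y" by blast
    then have "z \<in> k (Suc (Suc m))" "z \<notin> k (Suc m)" using y by (simp_all add: kS)
    moreover have "k (Suc m) \<subseteq> k (Suc (Suc m))" using Suc by (auto simp: kS)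
    ultimately show ?case by blast
  qed
  \<comment> \<open>Strict growth pushes the measure of \<open>k m\<close> up to at least
    \<open>m\<close>, which eventually exceeds the measure of the whole module.\<close>
  have "m \<le> \<mu> (k m)" for m
  proof (induction m)
    case (Suc m) then show ?case using \<mu>[OF k k lt, of m] by simp
  qed simp
  moreover have "\<mu> (k m) \<le> \<mu> (carrier M)" for m
    using \<mu>[OF k[of m] M.submodule_carrier] submoduleD(5)[OF k[of m]]
    by (cases "k m = carrier M") (auto simp: psubset_eq intro: less_imp_le)
  ultimately have "Suc (\<mu> (carrier M)) \<le> \<mu> (carrier M)" using le_trans by blast
  then show False by simp
qed

text \<open>By induction: the kernel of the projection to the new factor embeds into the product of
  the old ones.\<close>

lemma finite_length_direct_product:
  assumes R: "ring R" and "finite I"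
    and "\<And>i. i \<in> I \<Longrightarrow> left_module R (X i) \<and> finite_length R (X i)"
  shows "finite_length R (direct_product I X)"
  using assms(2,3)
proof (induction I rule: finite_induct)
  case empty
  \<comment> \<open>The empty product has a single element and hence a single submodule.\<close>
  have "W = W'" if "submodule W R (direct_product {} X)" "submodule W' R (direct_product {} X)" for W W'
    using submoduleD(2,5)[OF that(1)] submoduleD(2,5)[OF that(2)] by (auto simp: restrict_def)
  then show ?case by (intro finite_lengthI[of _ _ "\<lambda>_. 0"]) blast
next
  case (insert i I)
  have X: "left_module R (X k)" if "k \<in> insert i I" for k using insert that by blast
  let ?P = "direct_product (insert i I) X" and ?Q = "direct_product I X"
  let ?f = "\<lambda>x\<in>carrier ?P. x i"
  have P: "left_module R ?P" by (rule left_module_direct_product[OF R X])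
  have Q: "left_module R ?Q" by (rule left_module_direct_product[OF R]) (use X in auto)
  have f: "?f \<in> lhom R ?P (X i)" by (rule direct_product_proj_lhom[OF R X]) auto
  let ?k = "ker ?P (X i) ?f"
  have k: "submodule ?k R ?P" by (rule submodule_ker[OF P _ f]) (use X in auto)
  have Pk: "left_module R (?P\<lparr>carrier := ?k\<rparr>)" by (rule left_module_submodule[OF P k])
  interpret Pk: left_module R "?P\<lparr>carrier := ?k\<rparr>" by (rule Pk)
  have g: "(\<lambda>x\<in>?k. restrict x I) \<in> lhom R (?P\<lparr>carrier := ?k\<rparr>) ?Q"
  proof -
    have "restrict (\<lambda>x. restrict x I) (carrier (?P\<lparr>carrier := ?k\<rparr>)) \<in> lhom R (?P\<lparr>carrier := ?k\<rparr>) ?Q"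
      by (rule lhomI) (use Pk insert(2) in \<open>auto simp: ker_def fun_eq_iff\<close>)
    then show ?thesis by simp
  qed
  have inj: "inj_on (\<lambda>x\<in>?k. restrict x I) ?k"
  proof (rule inj_onI)
    fix x y assume xy: "x \<in> ?k" "y \<in> ?k" "(\<lambda>x\<in>?k. restrict x I) x = (\<lambda>x\<in>?k. restrict x I) y"
    then have "x j = y j" if "j \<in> I" for j using that by (auto dest: fun_cong[of _ _ j])
    moreover have "x i = y i" using xy by (auto simp: ker_def)
    moreover have "x \<in> extensional (insert i I)" "y \<in> extensional (insert i I)"
      using xy by (auto simp: ker_def PiE_def)
    ultimately show "x = y" by (auto intro: extensionalityI)
  qed
  have "finite_length R (?P\<lparr>carrier := ?k\<rparr>)"
    by (rule finite_length_inj[OF Pk Q g]) (use inj insert in auto)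
  then show ?case
    using finite_length_extension[OF P _ f] insert(4)[of i] by blast
qed

lemma finite_length_field:
  assumes K: "field K" shows "finite_length K (regular K)"
proof -
  interpret K: field K by fact
  interpret KK: left_module K "regular K" by (rule left_module_regular) (rule K.ring_axioms)
  \<comment> \<open>A nonzero element can be rescaled to any element of \<open>K\<close>, so there
    are only the two trivial subspaces.\<close>
  have "W' = carrier K" if W': "submodule W' K (regular K)" and "x \<in> W'" "x \<noteq> \<zero>\<^bsub>K\<^esub>" for W' x
  proof -
    have x: "x \<in> carrier K" "inv\<^bsub>K\<^esub> x \<in> carrier K" "inv\<^bsub>K\<^esub> x \<otimes>\<^bsub>K\<^esub> x = \<one>\<^bsub>K\<^esub>"
      using that submoduleD(1)[OF W'] K.field_Units by (auto simp: K.Units_inv_closed K.Units_l_inv)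
    have "y \<in> W'" if "y \<in> carrier K" for y
      using submoduleD(4)[OF W', of "y \<otimes>\<^bsub>K\<^esub> inv\<^bsub>K\<^esub> x" x] \<open>x \<in> W'\<close> x that
      by (simp add: K.m_assoc)
    then show ?thesis using submoduleD(5)[OF W'] by auto
  qed
  note top = this
  show ?thesis
  proof (rule finite_lengthI[of _ _ "\<lambda>W. if W = {\<zero>\<^bsub>K\<^esub>} then 0 else 1"])
    fix W W' assume W: "submodule W K (regular K)" "submodule W' K (regular K)" "W \<subset> W'"
    note z = submoduleD(2)[OF W(1), simplified]
    have "W = {\<zero>\<^bsub>K\<^esub>}"
    proof (rule ccontr)
      assume "W \<noteq> {\<zero>\<^bsub>K\<^esub>}"
      then obtain x where "x \<in> W" "x \<noteq> \<zero>\<^bsub>K\<^esub>" using z by blast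
      then have "W = carrier K" using top W(1) by blast
      then show False using W(3) submoduleD(5)[OF W(2)] by auto
    qed
    then show "(if W = {\<zero>\<^bsub>K\<^esub>} then 0 else 1) < (if W' = {\<zero>\<^bsub>K\<^esub>} then 0 else (1::nat))"
      using W(3) by auto
  qed
qed

lemma (in fin_dim_algebra) submodule_restrict_scalars:
  assumes "left_module R M" "submodule W R M"
  shows "submodule W K (restrict_scalars R M)"
proof -
  interpret KM: left_module K "restrict_scalars R M" by (rule left_module_restrict_scalars) fact
  show ?thesis by (rule KM.submoduleI) (use submoduleD[OF assms(2)] in auto)
qed

text \<open>Every \<open>R\<close>-submodule is a \<open>K\<close>-subspace, so a measure for
  subspaces also measures submodules.\<close>

lemma (in fin_dim_algebra) finite_length_restrict_scalars:
  assumes "left_module R M" "finite_length K (restrict_scalars R M)"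
  shows "finite_length R M"
proof -
  obtain \<mu> :: "_ set \<Rightarrow> nat" where \<mu>: "\<And>W W'. submodule W K (restrict_scalars R M) \<Longrightarrow>
      submodule W' K (restrict_scalars R M) \<Longrightarrow> W \<subset> W' \<Longrightarrow> \<mu> W < \<mu> W'"
    by (rule finite_lengthE[OF assms(2)]) blast
  show ?thesis
    by (rule finite_lengthI[of _ _ \<mu>]) (intro \<mu> submodule_restrict_scalars[OF assms(1)])
qed

subsection \<open>Free modules and finite generation\<close>

text \<open>For finite \<open>I\<close> this is the free module on the unit vectors. The form as a
  product makes the facts about tuples, projections and length of products applicable.\<close>

definition free :: "('r, 'e) ring_scheme \<Rightarrow> 'i set \<Rightarrow> ('r, 'i \<Rightarrow> 'r) module" where
  "free R I = direct_product I (\<lambda>_. regular R)"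

definition linear_combination ::
  "('r, 'e) ring_scheme \<Rightarrow> ('r, 'm) module \<Rightarrow> 'i set \<Rightarrow> ('i \<Rightarrow> 'm) \<Rightarrow> ('i \<Rightarrow> 'r) \<Rightarrow> 'm" where
  "linear_combination R M I m = (\<lambda>c\<in>carrier (free R I). \<Oplus>\<^bsub>M\<^esub>i\<in>I. c i \<odot>\<^bsub>M\<^esub> m i)"

definition unit_vector :: "('r, 'e) ring_scheme \<Rightarrow> 'i set \<Rightarrow> 'i \<Rightarrow> 'i \<Rightarrow> 'r" where
  "unit_vector R I i = (\<lambda>j\<in>I. if i = j then \<one>\<^bsub>R\<^esub> else \<zero>\<^bsub>R\<^esub>)"

lemma left_module_free: "ring R \<Longrightarrow> left_module R (free R I)"
  unfolding free_def by (intro left_module_direct_product left_module_regular)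

lemma free_simps [simp]:
  "carrier (free R I) = (\<Pi>\<^sub>E i\<in>I. carrier R)"
  "zero (free R I) = (\<lambda>i\<in>I. \<zero>\<^bsub>R\<^esub>)"
  "add (free R I) = (\<lambda>x y. \<lambda>i\<in>I. x i \<oplus>\<^bsub>R\<^esub> y i)"
  "smult (free R I) = (\<lambda>a x. \<lambda>i\<in>I. a \<otimes>\<^bsub>R\<^esub> x i)"
  by (simp_all add: free_def)

lemma linear_combination_lhom:
  assumes M: "left_module R M" and "finite I" and m: "\<And>i. i \<in> I \<Longrightarrow> m i \<in> carrier M"
  shows "linear_combination R M I m \<in> lhom R (free R I) M"
proof -
  interpret M: left_module R M by fact
  have R: "ring R" ..
  have smult: "a \<odot>\<^bsub>M\<^esub> (\<Oplus>\<^bsub>M\<^esub>i\<in>I. x i) = (\<Oplus>\<^bsub>M\<^esub>i\<in>I. a \<odot>\<^bsub>M\<^esub> x i)"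
    if "a \<in> carrier R" "x \<in> I \<rightarrow> carrier M" for a x
  proof -
    show ?thesis using \<open>finite I\<close> that
    proof (induction I rule: finite_induct)
      case (insert i I)
      then have "(\<Oplus>\<^bsub>M\<^esub>i\<in>I. x i) \<in> carrier M" by (intro M.M.finsum_closed) auto
      then show ?case
        using insert by (simp add: M.smult_r_distr M.smult_closed Pi_def)
    qed (simp add: M.smult_r_null)
  qed
  show ?thesis unfolding linear_combination_def
  proof (rule lhomI)
    fix x assume x: "x \<in> carrier (free R I)"
    then have xi: "x i \<in> carrier R" if "i \<in> I" for i using that by auto
    have xm: "(\<lambda>i. x i \<odot>\<^bsub>M\<^esub> m i) \<in> I \<rightarrow> carrier M" using xi m M.smult_closed by auto
    then show "(\<Oplus>\<^bsub>M\<^esub>i\<in>I. x i \<odot>\<^bsub>M\<^esub> m i) \<in> carrier M" by (intro M.M.finsum_closed)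
    {
      fix y assume y: "y \<in> carrier (free R I)"
      then have yi: "y i \<in> carrier R" if "i \<in> I" for i using that by auto
      have ym: "(\<lambda>i. y i \<odot>\<^bsub>M\<^esub> m i) \<in> I \<rightarrow> carrier M" using yi m M.smult_closed by auto
      have "(\<Oplus>\<^bsub>M\<^esub>i\<in>I. (x \<oplus>\<^bsub>free R I\<^esub> y) i \<odot>\<^bsub>M\<^esub> m i) = (\<Oplus>\<^bsub>M\<^esub>i\<in>I. x i \<odot>\<^bsub>M\<^esub> m i \<oplus>\<^bsub>M\<^esub> y i \<odot>\<^bsub>M\<^esub> m i)"
        by (rule M.M.finsum_cong') (use xi yi m M.smult_closed M.smult_l_distr in auto)
      then show "(\<Oplus>\<^bsub>M\<^esub>i\<in>I. (x \<oplus>\<^bsub>free R I\<^esub> y) i \<odot>\<^bsub>M\<^esub> m i) =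
        (\<Oplus>\<^bsub>M\<^esub>i\<in>I. x i \<odot>\<^bsub>M\<^esub> m i) \<oplus>\<^bsub>M\<^esub> (\<Oplus>\<^bsub>M\<^esub>i\<in>I. y i \<odot>\<^bsub>M\<^esub> m i)"
        using M.M.finsum_addf[OF xm ym] by simp
    }
    show "(\<Oplus>\<^bsub>M\<^esub>i\<in>I. (a \<odot>\<^bsub>free R I\<^esub> x) i \<odot>\<^bsub>M\<^esub> m i) = a \<odot>\<^bsub>M\<^esub> (\<Oplus>\<^bsub>M\<^esub>i\<in>I. x i \<odot>\<^bsub>M\<^esub> m i)"
      if a: "a \<in> carrier R" for a
    proof -
      have "(\<Oplus>\<^bsub>M\<^esub>i\<in>I. (a \<odot>\<^bsub>free R I\<^esub> x) i \<odot>\<^bsub>M\<^esub> m i) = (\<Oplus>\<^bsub>M\<^esub>i\<in>I. a \<odot>\<^bsub>M\<^esub> (x i \<odot>\<^bsub>M\<^esub> m i))"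
        by (rule M.M.finsum_cong') (use xi m a M.smult_closed M.smult_assoc in auto)
      then show ?thesis using smult[OF a xm] by simp
    qed
  qed (rule left_module_free[OF R])
qed

lemma unit_vector_closed: "ring R \<Longrightarrow> unit_vector R I i \<in> carrier (free R I)"
  using ring.ring_simprules(2,6) by (auto simp: unit_vector_def)

lemma linear_combination_unit_vector:
  assumes M: "left_module R M" and "finite I" and m: "\<And>i. i \<in> I \<Longrightarrow> m i \<in> carrier M" and "i \<in> I"
  shows "linear_combination R M I m (unit_vector R I i) = m i"
proof -
  interpret M: left_module R M by fact
  have "linear_combination R M I m (unit_vector R I i) = (\<Oplus>\<^bsub>M\<^esub>j\<in>I. unit_vector R I i j \<odot>\<^bsub>M\<^esub> m j)"
    using unit_vector_closed[OF M.R.ring_axioms, of I i] by (simp add: linear_combination_def)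
  also have "\<dots> = (\<Oplus>\<^bsub>M\<^esub>j\<in>I. if i = j then m j else \<zero>\<^bsub>M\<^esub>)"
    by (rule M.M.finsum_cong') (auto simp: unit_vector_def M.smult_one M.smult_l_null m)
  also have "\<dots> = m i" using assms by (intro M.M.finsum_singleton) auto
  finally show ?thesis .
qed

lemma finite_dimensionalE:
  assumes "finite_dimensional K V"
  obtains F where "finite F" "F \<subseteq> carrier V"
    "\<And>x. x \<in> carrier V \<Longrightarrow> \<exists>c\<in>F \<rightarrow> carrier K. x = (\<Oplus>\<^bsub>V\<^esub>v\<in>F. c v \<odot>\<^bsub>V\<^esub> v)"
proof -
  from assms obtain F where F: "finite F \<and> F \<subseteq> carrier V \<and>
     (\<forall>x\<in>carrier V. \<exists>c\<in>F \<rightarrow> carrier K. x = (\<Oplus>\<^bsub>V\<^esub>v\<in>F. c v \<odot>\<^bsub>V\<^esub> v))"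
    unfolding finite_dimensional_def by (rule exE)
  show thesis by (rule that[of F]) (use F in simp_all)
qed

text \<open>A finite spanning set presents \<open>V\<close> as an image of a finite power of
  \<open>K\<close>.\<close>

lemma finite_length_finite_dimensional:
  assumes K: "field K" and V: "left_module K V" and fd: "finite_dimensional K V"
  shows "finite_length K V"
proof -
  interpret K: field K by fact
  obtain F where F: "finite F" "F \<subseteq> carrier V"
    "\<And>x. x \<in> carrier V \<Longrightarrow> \<exists>c\<in>F \<rightarrow> carrier K. x = (\<Oplus>\<^bsub>V\<^esub>v\<in>F. c v \<odot>\<^bsub>V\<^esub> v)"
    by (rule finite_dimensionalE[OF fd]) blast
  interpret V: left_module K V by fact
  let ?l = "linear_combination K V F (\<lambda>v. v)"
  have l: "?l \<in> lhom K (free K F) V"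
    by (rule linear_combination_lhom[OF V]) (use F in auto)
  have "x \<in> ?l ` carrier (free K F)" if x: "x \<in> carrier V" for x
  proof -
    obtain c where c: "c \<in> F \<rightarrow> carrier K" "x = (\<Oplus>\<^bsub>V\<^esub>v\<in>F. c v \<odot>\<^bsub>V\<^esub> v)" using F(3)[OF x] by blast
    \<comment> \<open>Elements of \<open>free K F\<close> are extensional, so the coefficients are
      cut down to \<open>F\<close> without changing the sum.\<close>
    have "(\<Oplus>\<^bsub>V\<^esub>v\<in>F. restrict c F v \<odot>\<^bsub>V\<^esub> v) = (\<Oplus>\<^bsub>V\<^esub>v\<in>F. c v \<odot>\<^bsub>V\<^esub> v)"
      by (rule V.M.finsum_cong') (use c F in \<open>auto intro!: V.smult_closed\<close>)
    then have "x = ?l (restrict c F)" "restrict c F \<in> carrier (free K F)"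
      using c by (auto simp: linear_combination_def)
    then show ?thesis by blast
  qed
  then have "?l ` carrier (free K F) = carrier V" using lhomD(1)[OF l] by blast
  moreover have "finite_length K (free K F)" unfolding free_def
    using F(1) by (intro finite_length_direct_product)
      (auto simp: K.ring_axioms left_module_regular finite_length_field[OF K])
  ultimately show ?thesis
    using finite_length_surj[OF left_module_free[OF K.ring_axioms] V l] by blast
qed

definition finitely_generated :: "('r, 'e) ring_scheme \<Rightarrow> ('r, 'm) module \<Rightarrow> bool" where
  "finitely_generated R M \<longleftrightarrow> (\<exists>F. finite F \<and> F \<subseteq> carrier M \<and>
     (\<forall>W. submodule W R M \<and> F \<subseteq> W \<longrightarrow> W = carrier M))"

lemma (in left_module) exists_span:
  assumes "F \<subseteq> carrier M"
  shows "\<exists>W. submodule W R M \<and> F \<subseteq> W \<and> (\<forall>W'. submodule W' R M \<and> F \<subseteq> W' \<longrightarrow> W \<subseteq> W')"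
proof (intro exI conjI allI impI)
  let ?W = "\<Inter>{W. submodule W R M \<and> F \<subseteq> W}"
  have c: "carrier M \<in> {W. submodule W R M \<and> F \<subseteq> W}" using submodule_carrier assms by blast
  show "submodule ?W R M"
  proof (rule submoduleI)
    show "?W \<subseteq> carrier M" using c by (rule Inter_lower)
    show "\<zero>\<^bsub>M\<^esub> \<in> ?W" by (auto intro: submoduleD(2))
    show "x \<oplus>\<^bsub>M\<^esub> y \<in> ?W" if "x \<in> ?W" "y \<in> ?W" for x y
      using that by (auto intro!: submoduleD(3))
    show "a \<odot>\<^bsub>M\<^esub> x \<in> ?W" if "a \<in> carrier R" "x \<in> ?W" for a x
      using that by (auto intro!: submoduleD(4))
  qed
qed blast+

text \<open>Take a finite set whose span has the largest possible measure. Adding one more element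
  cannot enlarge the span, so the span is everything.\<close>

lemma finite_length_imp_finitely_generated:
  assumes M: "left_module R M" and "finite_length R M"
  shows "finitely_generated R M"
proof -
  interpret M: left_module R M by fact
  obtain \<mu> :: "_ set \<Rightarrow> nat" where \<mu>: "\<And>W W'. submodule W R M \<Longrightarrow> submodule W' R M \<Longrightarrow> W \<subset> W' \<Longrightarrow> \<mu> W < \<mu> W'"
    by (rule finite_lengthE[OF assms(2)]) blast
  define sp where "sp F = (SOME W. submodule W R M \<and> F \<subseteq> W \<and> (\<forall>W'. submodule W' R M \<and> F \<subseteq> W' \<longrightarrow> W \<subseteq> W'))" for F
  have sp: "submodule (sp F) R M" "F \<subseteq> sp F" "\<And>W'. submodule W' R M \<Longrightarrow> F \<subseteq> W' \<Longrightarrow> sp F \<subseteq> W'"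
    if "F \<subseteq> carrier M" for F
    using someI_ex[OF M.exists_span[OF that]] unfolding sp_def by blast+
  have "\<mu> (sp F) < Suc (\<mu> (carrier M))" if "finite F \<and> F \<subseteq> carrier M" for F
    using that sp(1)[of F] \<mu>[OF sp(1)[of F] M.submodule_carrier] submoduleD(5)[OF sp(1)[of F]]
    by (cases "sp F = carrier M") (auto simp: psubset_eq)
  then obtain F where F: "finite F" "F \<subseteq> carrier M"
    and max: "\<And>F'. finite F' \<and> F' \<subseteq> carrier M \<Longrightarrow> \<mu> (sp F') \<le> \<mu> (sp F)"
    using ex_has_greatest_nat[of "\<lambda>F. finite F \<and> F \<subseteq> carrier M" "{}" "\<lambda>F. \<mu> (sp F)"
      "Suc (\<mu> (carrier M))"] by (auto intro: less_imp_le)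
  have "x \<in> sp F" if x: "x \<in> carrier M" for x
  proof (rule ccontr)
    assume n: "x \<notin> sp F"
    have s: "insert x F \<subseteq> carrier M" using x F by auto
    have "sp F \<subset> sp (insert x F)"
      using n sp(2)[OF s] sp(3)[OF F(2) sp(1)[OF s]] by blast
    from \<mu>[OF sp(1)[OF F(2)] sp(1)[OF s] this] max[of "insert x F"] s F show False by simp
  qed
  then have "W = carrier M" if "submodule W R M" "F \<subseteq> W" for W
    using sp(3)[OF F(2) that] submoduleD(5)[OF that(1)] by blast
  then show ?thesis using F unfolding finitely_generated_def by blast
qed

text \<open>Generators are numbered by naturals because \<open>AR_translate\<close> expects
  presentations with elements in \<open>nat \<Rightarrow> 'r\<close>.\<close>

lemma finitely_generated_surj:
  assumes M: "left_module R M" and "finitely_generated R M"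
  shows "\<exists>(n::nat) g. g \<in> lhom R (free R {..<n}) M \<and> g ` carrier (free R {..<n}) = carrier M"
proof -
  interpret M: left_module R M by fact
  obtain F where F: "finite F" "F \<subseteq> carrier M" "\<And>W. submodule W R M \<Longrightarrow> F \<subseteq> W \<Longrightarrow> W = carrier M"
    using assms(2) unfolding finitely_generated_def by metis
  obtain n :: nat and p where p: "F = p ` {..<n}"
    using finite_imp_nat_seg_image_inj_on[OF F(1)] by (auto simp: lessThan_def)
  let ?g = "linear_combination R M {..<n} p"
  have m: "p i \<in> carrier M" if "i \<in> {..<n}" for i using that p F by auto
  have g: "?g \<in> lhom R (free R {..<n}) M" by (rule linear_combination_lhom[OF M _ m]) auto
  interpret F: left_module R "free R {..<n}" by (rule left_module_free) (rule M.R.ring_axioms)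
  have "submodule (?g ` carrier (free R {..<n})) R M"
    by (rule submodule_image[OF F.left_module_axioms M g F.submodule_carrier])
  moreover have "F \<subseteq> ?g ` carrier (free R {..<n})"
  proof
    fix v assume "v \<in> F"
    then obtain i where i: "i < n" "v = p i" using p by auto
    then have "v = ?g (unit_vector R {..<n} i)"
      using linear_combination_unit_vector[OF M, of "{..<n}" p i] m i by simp
    then show "v \<in> ?g ` carrier (free R {..<n})" 
      by (rule image_eqI[OF _ unit_vector_closed[OF M.R.ring_axioms]])
  qed
  ultimately show ?thesis using F(3) g by blast
qed

subsection \<open>Dual bases and projective covers\<close>

text \<open>The dual basis lemma characterizes finitely generated projective modules in this way.
  The condition refers to \<open>P\<close> alone, so it yields liftings against modules of every
  type.\<close>

definition dual_basis ::
  "('r, 'e) ring_scheme \<Rightarrow> ('r, 'p) module \<Rightarrow> 'i set \<Rightarrow> ('i \<Rightarrow> 'p) \<Rightarrow> ('i \<Rightarrow> 'p \<Rightarrow> 'r) \<Rightarrow> bool" where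
  "dual_basis R P I p \<xi> \<longleftrightarrow> finite I \<and>
     (\<forall>i\<in>I. p i \<in> carrier P \<and> \<xi> i \<in> lhom R P (regular R)) \<and>
     (\<forall>x\<in>carrier P. x = (\<Oplus>\<^bsub>P\<^esub>i\<in>I. \<xi> i x \<odot>\<^bsub>P\<^esub> p i))"

lemma dual_basisD:
  assumes "dual_basis R P I p \<xi>"
  shows "finite I" "i \<in> I \<Longrightarrow> p i \<in> carrier P" "i \<in> I \<Longrightarrow> \<xi> i \<in> lhom R P (regular R)"
    "x \<in> carrier P \<Longrightarrow> (\<Oplus>\<^bsub>P\<^esub>i\<in>I. \<xi> i x \<odot>\<^bsub>P\<^esub> p i) = x"
  using assms by (auto simp: dual_basis_def)

lemma dual_basis_free:
  assumes R: "ring R" and "finite I"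
  shows "dual_basis R (free R I) I (unit_vector R I) (\<lambda>i. \<lambda>x\<in>carrier (free R I). x i)"
proof -
  interpret R: ring R by fact
  have F: "left_module R (free R I)" by (rule left_module_free[OF R])
  interpret F: left_module R "free R I" by (rule F)
  have pr: "(\<lambda>x\<in>carrier (free R I). x i) \<in> lhom R (free R I) (regular R)" if "i \<in> I" for i
    using direct_product_proj_lhom[OF R left_module_regular[OF R] that]
    unfolding free_def by simp
  have "x = (\<Oplus>\<^bsub>free R I\<^esub>i\<in>I. x i \<odot>\<^bsub>free R I\<^esub> unit_vector R I i)" if x: "x \<in> carrier (free R I)" for x
  proof -
    have c: "(\<lambda>i. x i \<odot>\<^bsub>free R I\<^esub> unit_vector R I i) \<in> I \<rightarrow> carrier (free R I)"
      using x by (intro Pi_I F.smult_closed unit_vector_closed[OF R]) auto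
    let ?y = "\<Oplus>\<^bsub>free R I\<^esub>i\<in>I. x i \<odot>\<^bsub>free R I\<^esub> unit_vector R I i"
    have y: "?y \<in> carrier (free R I)" using c by (rule F.M.finsum_closed)
    have "?y j = x j" if j: "j \<in> I" for j
    proof -
      have "?y j = (\<lambda>x\<in>carrier (free R I). x j) ?y" using y by simp
      also have "\<dots> = (\<Oplus>\<^bsub>regular R\<^esub>i\<in>I. (\<lambda>x\<in>carrier (free R I). x j) (x i \<odot>\<^bsub>free R I\<^esub> unit_vector R I i))"
        by (rule lhom_finsum[OF F left_module_regular[OF R] pr[OF j] \<open>finite I\<close> c])
      also have "\<dots> = (\<Oplus>\<^bsub>regular R\<^esub>i\<in>I. if j = i then x i else \<zero>\<^bsub>regular R\<^esub>)"
      proof (rule abelian_monoid.finsum_cong')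
        show "abelian_monoid (regular R)"
          using left_module_regular[OF R] by (simp add: left_module_def abelian_group_def)
        show "(\<lambda>i. if j = i then x i else \<zero>\<^bsub>regular R\<^esub>) \<in> I \<rightarrow> carrier (regular R)" using x by auto
        fix i assume i: "i \<in> I"
        then have "x i \<in> carrier R" using x by auto
        with i show "(\<lambda>x\<in>carrier (free R I). x j) (x i \<odot>\<^bsub>free R I\<^esub> unit_vector R I i) =
            (if j = i then x i else \<zero>\<^bsub>regular R\<^esub>)"
          using c x j by (auto simp: unit_vector_def)
      qed simp
      also have "\<dots> = x j"
      proof (rule abelian_monoid.finsum_singleton)
        show "abelian_monoid (regular R)"
          using left_module_regular[OF R] by (simp add: left_module_def abelian_group_def)
      qed (use x j \<open>finite I\<close> in auto)
      finally show ?thesis .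
    qed
    then show ?thesis using x y by (intro extensionalityI[of _ I]) (auto simp: PiE_def)
  qed
  then show ?thesis
    using assms pr unit_vector_closed[OF R] by (auto simp: dual_basis_def simp del: free_simps)
qed

text \<open>Apply \<open>r\<close> to the expansion of \<open>s x\<close> in
  \<open>P\<close>.\<close>

lemma dual_basis_retract:
  assumes P: "left_module R P" and Q: "left_module R Q"
    and s: "s \<in> lhom R Q P" and r: "r \<in> lhom R P Q" and rs: "\<And>x. x \<in> carrier Q \<Longrightarrow> r (s x) = x"
    and db: "dual_basis R P I p \<xi>"
  shows "dual_basis R Q I (\<lambda>i. r (p i)) (\<lambda>i. compose (carrier Q) (\<xi> i) s)"
proof -
  note d = dual_basisD[OF db]
  interpret P: left_module R P by fact
  interpret Q: left_module R Q by fact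
  have "x = (\<Oplus>\<^bsub>Q\<^esub>i\<in>I. compose (carrier Q) (\<xi> i) s x \<odot>\<^bsub>Q\<^esub> r (p i))" if x: "x \<in> carrier Q" for x
  proof -
    have sx: "s x \<in> carrier P" using lhomD(1)[OF s x] .
    have c: "\<xi> i (s x) \<in> carrier R" if "i \<in> I" for i
      using lhomD(1)[OF d(3)[OF that] sx] by simp
    have "x = r (\<Oplus>\<^bsub>P\<^esub>i\<in>I. \<xi> i (s x) \<odot>\<^bsub>P\<^esub> p i)" using d(4)[OF sx] rs[OF x] by simp
    also have "\<dots> = (\<Oplus>\<^bsub>Q\<^esub>i\<in>I. r (\<xi> i (s x) \<odot>\<^bsub>P\<^esub> p i))"
      by (rule lhom_finsum[OF P Q r d(1)]) (use c d(2) P.smult_closed in auto)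
    also have "\<dots> = (\<Oplus>\<^bsub>Q\<^esub>i\<in>I. compose (carrier Q) (\<xi> i) s x \<odot>\<^bsub>Q\<^esub> r (p i))"
      by (rule Q.M.finsum_cong')
        (use c d(2) x lhomD(1,3)[OF r] in \<open>auto simp: compose_def intro!: Q.smult_closed\<close>)
    finally show ?thesis .
  qed
  then show ?thesis
    using d(1-3) lhomD(1)[OF r] by (auto simp: dual_basis_def intro!: compose_lhom[OF Q s])
qed

text \<open>Only the finitely many elements \<open>h (p i)\<close> are lifted by choice; the
  coordinates \<open>\<xi> i\<close> spread these choices linearly over \<open>P\<close>.\<close>

lemma dual_basis_lift:
  assumes P: "left_module R P" and db: "dual_basis R P I p \<xi>"
    and B: "left_module R B" and C: "left_module R C" and g: "g \<in> lhom R B C"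
    and surj: "g ` carrier B = carrier C" and h: "h \<in> lhom R P C"
  shows "\<exists>h'\<in>lhom R P B. \<forall>x\<in>carrier P. g (h' x) = h x"
proof -
  note d = dual_basisD[OF db]
  interpret P: left_module R P by fact
  interpret B: left_module R B by fact
  interpret C: left_module R C by fact
  define b where "b i = inv_into (carrier B) g (h (p i))" for i
  have b: "b i \<in> carrier B" "g (b i) = h (p i)" if "i \<in> I" for i
    using lhomD(1)[OF h d(2)[OF that]] surj unfolding b_def
    by (simp_all add: inv_into_into f_inv_into_f)
  let ?t = "\<lambda>x\<in>carrier P. \<lambda>i\<in>I. \<xi> i x" and ?l = "linear_combination R B I b"
  have t: "?t \<in> lhom R P (free R I)"
    unfolding free_def by (rule direct_product_tuple_lhom[OF P d(3)])
  have l: "?l \<in> lhom R (free R I) B" by (rule linear_combination_lhom[OF B d(1) b(1)])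
  have "g (compose (carrier P) ?l ?t x) = h x" if x: "x \<in> carrier P" for x
  proof -
    have c: "\<xi> i x \<in> carrier R" if "i \<in> I" for i
      using lhomD(1)[OF d(3)[OF that] x] by simp
    have "compose (carrier P) ?l ?t x = (\<Oplus>\<^bsub>B\<^esub>i\<in>I. (?t x) i \<odot>\<^bsub>B\<^esub> b i)"
      using lhomD(1)[OF t x] x by (simp add: compose_def linear_combination_def)
    also have "\<dots> = (\<Oplus>\<^bsub>B\<^esub>i\<in>I. \<xi> i x \<odot>\<^bsub>B\<^esub> b i)"
      by (rule B.M.finsum_cong') (use x b c in \<open>auto intro!: B.smult_closed\<close>)
    finally have "g (compose (carrier P) ?l ?t x) = g (\<Oplus>\<^bsub>B\<^esub>i\<in>I. \<xi> i x \<odot>\<^bsub>B\<^esub> b i)" by simp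
    also have "\<dots> = (\<Oplus>\<^bsub>C\<^esub>i\<in>I. g (\<xi> i x \<odot>\<^bsub>B\<^esub> b i))"
      by (rule lhom_finsum[OF B C g d(1)]) (use b c in \<open>auto intro!: B.smult_closed\<close>)
    also have "\<dots> = (\<Oplus>\<^bsub>C\<^esub>i\<in>I. h (\<xi> i x \<odot>\<^bsub>P\<^esub> p i))"
      by (rule C.M.finsum_cong')
        (use b c d(2) lhomD(1,3)[OF g] lhomD(1,3)[OF h] in \<open>auto intro!: C.smult_closed\<close>)
    also have "\<dots> = h (\<Oplus>\<^bsub>P\<^esub>i\<in>I. \<xi> i x \<odot>\<^bsub>P\<^esub> p i)"
      by (rule lhom_finsum[OF P C h d(1), symmetric]) (use d(2) c in \<open>auto intro!: P.smult_closed\<close>)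
    also have "\<dots> = h x" using d(4)[OF x] by simp
    finally show ?thesis .
  qed
  moreover have "compose (carrier P) ?l ?t \<in> lhom R P B" by (rule compose_lhom[OF P t l])
  ultimately show ?thesis by blast
qed

lemma dual_basis_projective:
  "\<lbrakk>left_module R P; dual_basis R P I p \<xi>\<rbrakk> \<Longrightarrow> projective U R P"
  unfolding projective_def by (intro conjI allI impI ballI) (auto intro: dual_basis_lift)

text \<open>\<open>projective\<close> lifts only along maps between modules inside
  \<open>'u\<close>. The injections \<open>j\<close> and \<open>j'\<close> move the lifting problem
  there, and the inverse of the first copy brings the answer back.\<close>

lemma projective_lift:
  fixes P :: "('r, 'p) module" and B :: "('r, 'b) module" and C :: "('r, 'c) module"
    and j :: "'b \<Rightarrow> 'u" and j' :: "'c \<Rightarrow> 'u"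
  assumes proj: "projective TYPE('u) R P"
    and B: "left_module R B" and C: "left_module R C" and g: "g \<in> lhom R B C"
    and surj: "g ` carrier B = carrier C" and h: "h \<in> lhom R P C"
    and j: "inj_on j (carrier B)" and j': "inj_on j' (carrier C)"
  shows "\<exists>h'\<in>lhom R P B. \<forall>x\<in>carrier P. g (h' x) = h x"
proof -
  have P: "left_module R P" using proj by (simp add: projective_def)
  let ?B = "transport j B" and ?C = "transport j' C"
  note tB = transport[OF B j] and tC = transport[OF C j']
  have bB: "bij_betw (restrict j (carrier B)) (carrier B) (carrier ?B)"
    using j tB(3) by (auto simp: bij_betw_def)
  obtain iB where iB: "iB \<in> lhom R ?B B" "\<forall>x\<in>carrier B. iB (restrict j (carrier B) x) = x"
    "\<forall>y\<in>carrier ?B. restrict j (carrier B) (iB y) = y"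
    using lhom_inverse[OF B tB(1,2) bB] by blast
  let ?g = "compose (carrier ?B) (restrict j' (carrier C)) (compose (carrier ?B) g iB)"
  have g1: "?g \<in> lhom R ?B ?C"
    by (rule compose_lhom[OF tB(1) compose_lhom[OF tB(1) iB(1) g] tC(2)])
  have gj: "?g (j b) = j' (g b)" if "b \<in> carrier B" for b
    using that tB(3) iB(2) lhomD(1)[OF g that] by (auto simp: compose_def)
  have "?g ` carrier ?B = carrier ?C"
  proof -
    have "?g ` (j ` carrier B) = (\<lambda>b. j' (g b)) ` carrier B"
      unfolding image_image by (rule image_cong[OF refl gj])
    also have "\<dots> = carrier ?C" using surj tC(3) by (metis image_image)
    finally have "?g ` (j ` carrier B) = carrier ?C" .
    then show ?thesis by (simp only: tB(3))
  qed
  moreover have "compose (carrier P) (restrict j' (carrier C)) h \<in> lhom R P ?C"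
    by (rule compose_lhom[OF P h tC(2)])
  ultimately obtain k where k: "k \<in> lhom R P ?B"
    "\<forall>x\<in>carrier P. ?g (k x) = compose (carrier P) (restrict j' (carrier C)) h x"
    using proj tB(1) tC(1) g1 unfolding projective_def by blast
  have "g (compose (carrier P) iB k x) = h x" if x: "x \<in> carrier P" for x
  proof -
    have kx: "k x \<in> carrier ?B" using lhomD(1)[OF k(1) x] .
    then have ik: "iB (k x) \<in> carrier B" using lhomD(1)[OF iB(1)] by blast
    have "j' (g (iB (k x))) = ?g (k x)"
      using kx ik lhomD(1)[OF g ik] by (simp add: compose_def)
    also have "\<dots> = j' (h x)" using k(2) x lhomD(1)[OF h x] by (simp add: compose_def)
    finally show ?thesis
      using j' lhomD(1)[OF h x] lhomD(1)[OF g ik] x by (simp add: compose_def inj_on_def)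
  qed
  then show ?thesis using compose_lhom[OF P k(1) iB(1)] by blast
qed

lemma projective_cover_finitely_generated:
  assumes cov: "projective_cover U R P M e" and M: "left_module R M" and fg: "finitely_generated R M"
  shows "finitely_generated R P"
proof -
  have P: "left_module R P" and e: "e \<in> lhom R P M" and surj: "e ` carrier P = carrier M"
    and sup: "superfluous R P (ker P M e)"
    using cov by (auto simp: projective_cover_def projective_def)
  interpret P: left_module R P by fact
  interpret M: left_module R M by fact
  obtain F where F: "finite F" "F \<subseteq> carrier M" "\<And>W. submodule W R M \<Longrightarrow> F \<subseteq> W \<Longrightarrow> W = carrier M"
    using fg unfolding finitely_generated_def by metis
  let ?F = "inv_into (carrier P) e ` F"
  have F': "?F \<subseteq> carrier P" using F(2) surj inv_into_into[of _ e "carrier P"] by blast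
  have eF: "e ` ?F = F" using F(2) surj by (force simp: image_image f_inv_into_f)
  have "L = carrier P" if L: "submodule L R P" "?F \<subseteq> L" for L
  proof -
    have eL: "e ` L = carrier M"
      using F(3)[OF submodule_image[OF P M e L(1)]] L(2) eF by blast
    have "x \<in> L <+>\<^bsub>P\<^esub> ker P M e" if x: "x \<in> carrier P" for x
    proof -
      have "e x \<in> e ` L" using eL lhomD(1)[OF e x] by simp
      then obtain l where l: "l \<in> L" "e x = e l" by blast
      note c = submoduleD(1)[OF L(1) l(1)]
      have "x \<ominus>\<^bsub>P\<^esub> l \<in> ker P M e"
        using x l c lhom_diff[OF P M e x c] lhomD(1)[OF e] by (simp add: ker_def a_minus_def M.M.r_neg)
      moreover have "x = l \<oplus>\<^bsub>P\<^esub> (x \<ominus>\<^bsub>P\<^esub> l)"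
        using x c by (simp add: a_minus_def P.M.a_lcomm[of l] P.M.r_neg)
      ultimately show ?thesis using l(1) by (auto simp: set_add_def')
    qed
    moreover have "L <+>\<^bsub>P\<^esub> ker P M e \<subseteq> carrier P"
      using submoduleD(1)[OF L(1)] by (auto simp: set_add_def' ker_def)
    ultimately show ?thesis using sup L(1) unfolding superfluous_def by blast
  qed
  then show ?thesis unfolding finitely_generated_def using F(1) F' by (intro exI[of _ ?F]) auto
qed

text \<open>Lifting the identity of \<open>P\<close> splits a surjection from a finite free module,
  and a dual basis passes to the retract.\<close>

lemma projective_dual_basis:
  fixes P :: "('r, 'p) module" and j :: "(nat \<Rightarrow> 'r) \<Rightarrow> 'u" and j' :: "'p \<Rightarrow> 'u"
  assumes proj: "projective TYPE('u) R P" and fg: "finitely_generated R P"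
    and j: "inj j" and j': "inj_on j' (carrier P)"
  shows "\<exists>(I :: nat set) p \<xi>. dual_basis R P I p \<xi>"
proof -
  have P: "left_module R P" using proj by (simp add: projective_def)
  interpret P: left_module R P by fact
  obtain n :: nat and g where g: "g \<in> lhom R (free R {..<n}) P"
    "g ` carrier (free R {..<n}) = carrier P"
    using finitely_generated_surj[OF P fg] by blast
  note F = left_module_free[OF P.R.ring_axioms, of "{..<n}"]
  have "inj_on j (carrier (free R {..<n}))" using j by (rule inj_on_subset) simp
  from projective_lift[OF proj F P g id_lhom[OF P] this j']
  obtain s where "s \<in> lhom R P (free R {..<n})" "\<forall>x\<in>carrier P. g (s x) = x" by auto
  then show ?thesis
    using dual_basis_retract[OF F P _ g(1) _ dual_basis_free[OF P.R.ring_axioms]] by blast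
qed

text \<open>The cover is the image of an endomorphism \<^term>\<open>t\<close> over \<^term>\<open>M\<close> of a free module whose
  image is as small as possible: \<^term>\<open>t\<close> is then bijective on its image, which is
  therefore a retract.\<close>

lemma exists_projective_cover:
  fixes R :: "('r, 'e) ring_scheme" and M :: "('r, 'm) module"
  assumes M: "left_module R M" and fg: "finitely_generated R M" and fl: "finite_length R (regular R)"
  shows "\<exists>(P :: ('r, nat \<Rightarrow> 'r) module) e. projective_cover U R P M e \<and> finite_length R P"
proof -
  interpret M: left_module R M by fact
  note R = M.R.ring_axioms
  obtain n :: nat and g where g: "g \<in> lhom R (free R {..<n}) M"
    and surj: "g ` carrier (free R {..<n}) = carrier M"
    using finitely_generated_surj[OF M fg] by blast
  define F where "F = free R {..<n}"
  have F: "left_module R F" unfolding F_def by (rule left_module_free[OF R])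
  interpret F: left_module R F by fact
  have db: "\<exists>p \<xi>. dual_basis R F {..<n} p \<xi>"
    unfolding F_def using dual_basis_free[OF R] by blast
  have "finite_length R F" unfolding F_def free_def
    by (rule finite_length_direct_product[OF R]) (use fl left_module_regular[OF R] in auto)
  then obtain \<mu> :: "_ set \<Rightarrow> nat" where \<mu>: "\<And>W W'. submodule W R F \<Longrightarrow> submodule W' R F \<Longrightarrow> W \<subset> W' \<Longrightarrow> \<mu> W < \<mu> W'"
    by (rule finite_lengthE) blast
  note g = g[folded F_def] and surj = surj[folded F_def]
  define E where "E = {t \<in> lhom R F F. \<forall>x\<in>carrier F. g (t x) = g x}"
  have "(\<lambda>x\<in>carrier F. x) \<in> E" using id_lhom[OF F] by (simp add: E_def)
  then obtain t where tE: "t \<in> E" and tmin: "\<And>u. u \<in> E \<Longrightarrow> \<mu> (t ` carrier F) \<le> \<mu> (u ` carrier F)"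
    using ex_has_least_nat[of "\<lambda>t. t \<in> E" _ "\<lambda>t. \<mu> (t ` carrier F)"] by blast
  have t: "t \<in> lhom R F F" and gt: "\<And>x. x \<in> carrier F \<Longrightarrow> g (t x) = g x"
    using tE by (auto simp: E_def)
  have small: "u ` carrier F = t ` carrier F" if "u \<in> E" "u ` carrier F \<subseteq> t ` carrier F" for u
  proof (rule ccontr)
    have u: "u \<in> lhom R F F" using that(1) by (simp add: E_def)
    assume "u ` carrier F \<noteq> t ` carrier F"
    then have "\<mu> (u ` carrier F) < \<mu> (t ` carrier F)"
      using that(2) by (intro \<mu> submodule_image[OF F F] u t F.submodule_carrier) blast
    then show False using tmin[OF that(1)] by simp
  qed
  define Q where "Q = t ` carrier F"
  have Q: "submodule Q R F" unfolding Q_def by (rule submodule_image[OF F F t F.submodule_carrier])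
  note Qc = submoduleD(1)[OF Q]
  let ?P = "F\<lparr>carrier := Q\<rparr>"
  have P: "left_module R ?P" by (rule left_module_submodule[OF F Q])
  have tP: "t \<in> lhom R F ?P" using t unfolding Q_def lhom_def by auto
  \<comment> \<open>The square of \<open>t\<close> is again over \<open>M\<close> and its image lies
    in that of \<open>t\<close>, so least measure makes the two images equal: \<open>t\<close> maps
    \<open>Q\<close> onto \<open>Q\<close>.\<close>
  have tt: "compose (carrier F) t t \<in> E"
    using compose_lhom[OF F t t] gt lhomD(1)[OF t] by (auto simp: E_def compose_def)
  have tQ: "t ` Q = Q"
  proof -
    have e: "compose (carrier F) t t ` carrier F = t ` Q" by (auto simp: compose_def Q_def image_image)
    have "t ` Q \<subseteq> Q" unfolding Q_def using lhomD(1)[OF t] by auto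
    then show ?thesis using small[OF tt] e unfolding Q_def by simp
  qed
  have inc: "(\<lambda>x\<in>Q. x) \<in> lhom R ?P F" by (rule inclusion_lhom[OF F Q])
  have flP: "finite_length R ?P"
    by (rule finite_length_inj[OF P F inc _ \<open>finite_length R F\<close>]) (simp add: inj_on_def)
  have tQQ: "restrict t Q \<in> lhom R ?P ?P" by (rule restrict_lhom[OF F Q tP])
  \<comment> \<open>A surjective endomorphism of a module of finite length is injective.\<close>
  have inj: "inj_on (restrict t Q) (carrier ?P)"
    by (rule finite_length_surj_endomorphism[OF P flP tQQ]) (simp add: tQ)
  have "bij_betw (restrict t Q) (carrier ?P) (carrier ?P)"
    using inj tQ by (simp add: bij_betw_def)
  then obtain i where i: "i \<in> lhom R ?P ?P" "\<forall>x\<in>Q. i (restrict t Q x) = x"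
    using lhom_inverse[OF P P tQQ] by auto
  \<comment> \<open>Applying \<open>t\<close> and then undoing it on \<open>Q\<close> retracts
    \<open>F\<close> onto \<open>Q\<close>; this is where \<open>Q\<close> becomes
    projective.\<close>
  have r: "compose (carrier F) i t \<in> lhom R F ?P" by (rule compose_lhom[OF F tP i(1)])
  have ri: "compose (carrier F) i t ((\<lambda>x\<in>Q. x) x) = x" if "x \<in> carrier ?P" for x
    using that i(2) Qc by (simp add: compose_def)
  obtain p \<xi> where "dual_basis R F {..<n} p \<xi>" using db by blast
  from dual_basis_retract[OF F P inc r ri this]
  have pr: "projective U R ?P" by (rule dual_basis_projective[OF P])
  have gQ: "restrict g Q \<in> lhom R ?P M" by (rule restrict_lhom[OF F Q g])
  have "g ` Q = carrier M"
    using surj gt unfolding Q_def image_image by (metis (no_types, lifting) image_cong)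
  moreover have "superfluous R ?P (ker ?P M (restrict g Q))"
    unfolding superfluous_def
  proof (intro conjI allI impI)
    show "submodule (ker ?P M (restrict g Q)) R ?P" by (rule submodule_ker[OF P M gQ])
    fix L assume L: "submodule L R ?P \<and> L <+>\<^bsub>?P\<^esub> ker ?P M (restrict g Q) = carrier ?P"
    have LF: "submodule L R F" "L \<subseteq> Q" using L submodule_submodule_iff[OF F Q] by blast+
    have FL: "left_module R (F\<lparr>carrier := L\<rparr>)" by (rule left_module_submodule[OF F LF(1)])
    have gL: "restrict g L \<in> lhom R (F\<lparr>carrier := L\<rparr>) M"
      by (rule restrict_lhom[OF F LF(1) g])
    have "restrict g L ` L = carrier M"
    proof
      show "restrict g L ` L \<subseteq> carrier M" using lhomD(1)[OF gL] by auto
      show "carrier M \<subseteq> restrict g L ` L"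
      proof
        fix y assume "y \<in> carrier M"
        then obtain q where q: "q \<in> Q" "y = g q" using \<open>g ` Q = carrier M\<close> by blast
        then have "q \<in> L <+>\<^bsub>?P\<^esub> ker ?P M (restrict g Q)" using L by simp
        then obtain l z where lz: "l \<in> L" "z \<in> Q" "g z = \<zero>\<^bsub>M\<^esub>" "q = l \<oplus>\<^bsub>F\<^esub> z"
          by (auto simp: set_add_def' ker_def split: if_splits)
        then have "y = g l"
          using q lhomD(2)[OF g, of l z] lhomD(1)[OF g, of l] Qc LF by auto
        then show "y \<in> restrict g L ` L" using lz(1) by auto
      qed
    qed
    then have gs: "restrict g L ` carrier (F\<lparr>carrier := L\<rparr>) = carrier M" by simp
    obtain p \<xi> where "dual_basis R F {..<n} p \<xi>" using db by blast
    \<comment> \<open>Since \<open>L\<close> already maps onto \<open>M\<close>, the map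
      \<open>g\<close> lifts to an endomorphism of \<open>F\<close> over \<open>M\<close> with image
      inside \<open>L\<close>. Its image cannot be smaller than \<open>Q\<close>, so
      \<open>L\<close> is all of \<open>Q\<close>.\<close>
    from dual_basis_lift[OF F this FL M gL gs g]
    obtain u where u: "u \<in> lhom R F (F\<lparr>carrier := L\<rparr>)" "\<forall>x\<in>carrier F. restrict g L (u x) = g x"
      by (rule bexE)
    have uL: "u x \<in> L" if "x \<in> carrier F" for x using lhomD(1)[OF u(1) that] by simp
    have "u \<in> lhom R F F"
      using u(1) submoduleD(1)[OF LF(1)] by (auto simp: lhom_def)
    then have "u \<in> E" using u(2) uL by (auto simp: E_def)
    moreover have "u ` carrier F \<subseteq> Q" using uL LF(2) by auto
    ultimately have "u ` carrier F = Q" using small unfolding Q_def by blast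
    then show "L = carrier ?P" using uL LF(2) by auto
  qed
  ultimately have "projective_cover U R ?P M (restrict g Q)"
    using pr gQ by (simp add: projective_cover_def)
  then show ?thesis using flP by blast
qed

section \<open>The Auslander-Reiten formula\<close>

text \<open>Counterpart of \<open>factor_surj\<close>; the diagram chases below use the two
  together.\<close>

lemma factor_inj:
  assumes M: "left_module R M" and A: "left_module R A" and B: "left_module R B"
    and f: "f \<in> lhom R A B" and inj: "inj_on f (carrier A)"
    and k: "k \<in> lhom R M B" and im: "\<And>x. x \<in> carrier M \<Longrightarrow> k x \<in> f ` carrier A"
  shows "\<exists>h\<in>lhom R M A. \<forall>x\<in>carrier M. f (h x) = k x"
proof -
  interpret M: left_module R M by fact
  interpret A: left_module R A by fact
  define i where "i = inv_into (carrier A) f"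
  have i: "i (k x) \<in> carrier A" "f (i (k x)) = k x" if "x \<in> carrier M" for x
    using im[OF that] unfolding i_def by (simp_all add: inv_into_into f_inv_into_f)
  have ff: "x = y" if "f x = f y" "x \<in> carrier A" "y \<in> carrier A" for x y
    using inj that by (auto dest: inj_onD)
  have "restrict (\<lambda>x. i (k x)) (carrier M) \<in> lhom R M A"
  proof (rule lhomI)
    show "i (k x) \<in> carrier A" if "x \<in> carrier M" for x using i that by simp
    show "i (k (x \<oplus>\<^bsub>M\<^esub> y)) = i (k x) \<oplus>\<^bsub>A\<^esub> i (k y)" if "x \<in> carrier M" "y \<in> carrier M" for x y
      by (rule ff) (use i that i[of "x \<oplus>\<^bsub>M\<^esub> y"] lhomD(2)[OF f] lhomD(2)[OF k] in simp_all)
    show "i (k (a \<odot>\<^bsub>M\<^esub> x)) = a \<odot>\<^bsub>A\<^esub> i (k x)" if "a \<in> carrier R" "x \<in> carrier M" for a x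
      by (rule ff) (use i that i[of "a \<odot>\<^bsub>M\<^esub> x"] lhomD(3)[OF f] lhomD(3)[OF k] M.smult_closed A.smult_closed in simp_all)
  qed fact
  then show ?thesis using i by (intro bexI[of _ "restrict (\<lambda>x. i (k x)) (carrier M)"]) auto
qed

section \<open>Spaces of homomorphisms over the base field\<close>

lemma finsum_restrict_scalars: "finsum (restrict_scalars R M) f I = finsum M f I"
  by (simp add: finsum_def finprod_def restrict_scalars_def)

lemma finsum_regular: "finsum (regular R) f I = finsum R f I"
  by (simp add: finsum_def finprod_def regular_def)

text \<open>Shrinking the carrier of a product of copies of \<open>A\<close> lets the vector space
  laws be inherited from the product once closure is known.\<close>

definition hom_space ::
  "('k, 'r) module \<Rightarrow> ('r, 'p) module \<Rightarrow> ('r, 'a) module \<Rightarrow> ('k, 'p \<Rightarrow> 'a) module" where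
  "hom_space R P A =
     (direct_product (carrier P) (\<lambda>_. restrict_scalars R A))\<lparr>carrier := lhom R P A\<rparr>"

lemma hom_space_simps [simp]:
  "carrier (hom_space R P A) = lhom R P A"
  "\<zero>\<^bsub>hom_space R P A\<^esub> = (\<lambda>x\<in>carrier P. \<zero>\<^bsub>A\<^esub>)"
  "f \<oplus>\<^bsub>hom_space R P A\<^esub> g = (\<lambda>x\<in>carrier P. f x \<oplus>\<^bsub>A\<^esub> g x)"
  "c \<odot>\<^bsub>hom_space R P A\<^esub> f = (\<lambda>x\<in>carrier P. (c \<odot>\<^bsub>R\<^esub> \<one>\<^bsub>R\<^esub>) \<odot>\<^bsub>A\<^esub> f x)"
  by (simp_all add: hom_space_def)

context fin_dim_algebra
begin

lemma lhom_scalar_closed: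
  assumes M: "left_module R M" and N: "left_module R N" and f: "f \<in> lhom R M N" and c: "c \<in> carrier K"
  shows "(\<lambda>x\<in>carrier M. scalar c \<odot>\<^bsub>N\<^esub> f x) \<in> lhom R M N"
proof -
  interpret N: left_module R N by fact
  have "scalar c \<odot>\<^bsub>N\<^esub> (a \<odot>\<^bsub>N\<^esub> x) = a \<odot>\<^bsub>N\<^esub> (scalar c \<odot>\<^bsub>N\<^esub> x)" if "a \<in> carrier R" "x \<in> carrier N" for a x
    using that c N.smult_assoc[of a "scalar c" x] N.smult_assoc[of "scalar c" a x] scalar_commute[of c a]
    by simp
  then show ?thesis
    by (intro lhomI) (use c M lhomD[OF f] in \<open>auto simp: N.smult_closed N.smult_r_distr\<close>)
qed

lemma left_module_hom_space:
  assumes P: "left_module R P" and A: "left_module R A"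
  shows "left_module K (hom_space R P A)"
proof -
  let ?D = "direct_product (carrier P) (\<lambda>_. restrict_scalars R A)"
  have D: "left_module K ?D"
    by (rule left_module_direct_product[OF base.R.ring_axioms left_module_restrict_scalars[OF A]])
  interpret D: left_module K ?D by (rule D)
  have "submodule (lhom R P A) K ?D"
  proof (rule D.submoduleI)
    show "lhom R P A \<subseteq> carrier ?D" by (auto simp: lhom_def)
    show "\<zero>\<^bsub>?D\<^esub> \<in> lhom R P A" using zero_lhom[OF P A] by simp
    fix f assume f: "f \<in> lhom R P A"
    show "f \<oplus>\<^bsub>?D\<^esub> g \<in> lhom R P A" if "g \<in> lhom R P A" for g
      using lhom_add_closed[OF P A f that] by simp
    show "c \<odot>\<^bsub>?D\<^esub> f \<in> lhom R P A" if "c \<in> carrier K" for c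
      using lhom_scalar_closed[OF P A f that] by simp
  qed
  from left_module_submodule[OF D this] show ?thesis unfolding hom_space_def .
qed

lemma hom_space_precompose:
  assumes P: "left_module R P" and Q: "left_module R Q" and A: "left_module R A" and d: "d \<in> lhom R P Q"
  shows "(\<lambda>g\<in>lhom R Q A. compose (carrier P) g d) \<in> lhom K (hom_space R Q A) (hom_space R P A)"
proof -
  have "restrict (\<lambda>g. compose (carrier P) g d) (carrier (hom_space R Q A))
      \<in> lhom K (hom_space R Q A) (hom_space R P A)"
  proof (rule lhomI)
    show "compose (carrier P) g d \<in> carrier (hom_space R P A)" if "g \<in> carrier (hom_space R Q A)" for g
      using compose_lhom[OF P d] that by simp
  qed (use lhomD(1)[OF d] left_module_hom_space[OF Q A] in \<open>auto simp: compose_def\<close>)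
  then show ?thesis by simp
qed

lemma hom_space_postcompose:
  assumes P: "left_module R P" and A: "left_module R A" and f: "f \<in> lhom R A B"
  shows "(\<lambda>h\<in>lhom R P A. compose (carrier P) f h) \<in> lhom K (hom_space R P A) (hom_space R P B)"
proof -
  have "restrict (\<lambda>h. compose (carrier P) f h) (carrier (hom_space R P A))
      \<in> lhom K (hom_space R P A) (hom_space R P B)"
  proof (rule lhomI)
    show "compose (carrier P) f h \<in> carrier (hom_space R P B)" if "h \<in> carrier (hom_space R P A)" for h
      using compose_lhom[OF P _ f] that by simp
  qed (use lhomD[OF f] lhomD(1)[of _ R P A] left_module_hom_space[OF P A] in \<open>auto simp: compose_def fun_eq_iff\<close>)
  then show ?thesis by simp
qed

lemma lhom_restrict_scalars:
  assumes "left_module R M" "f \<in> lhom R M N"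
  shows "f \<in> lhom K (restrict_scalars R M) (restrict_scalars R N)"
proof -
  have "restrict f (carrier (restrict_scalars R M)) \<in> lhom K (restrict_scalars R M) (restrict_scalars R N)"
    by (rule lhomI) (use assms lhomD[OF assms(2)] left_module_restrict_scalars in auto)
  then show ?thesis using lhomD(4)[OF assms(2)] by (simp add: extensional_restrict)
qed

lemma lhom_restrict_scalars_right:
  assumes "left_module (opposite R) M" "f \<in> lhom (opposite R) M N"
  shows "f \<in> lhom K (restrict_scalars R M) (restrict_scalars R N)"
proof -
  interpret op: fin_dim_algebra K "opposite R" by (rule fin_dim_algebra_opposite)
  have "restrict_scalars (opposite R) L = restrict_scalars R L" for L :: "('r, 'l) module"
    by (simp add: restrict_scalars_def)
  then show ?thesis using op.lhom_restrict_scalars[OF assms] by metis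
qed

end

text \<open>Universes have disappeared here: exactness at \<open>P0\<close> and \<open>M\<close>,
  and finite dual bases of both projectives, carry the whole Auslander-Reiten formula.\<close>

locale presentation = fin_dim_algebra K R
  for K :: "'k ring" and R :: "('k, 'r) module" +
  fixes P1 :: "('r, 'p) module" and P0 :: "('r, 'q) module" and M :: "('r, 'm) module"
    and d :: "'p \<Rightarrow> 'q" and e :: "'q \<Rightarrow> 'm"
    and I :: "'i set" and p :: "'i \<Rightarrow> 'p" and \<xi> :: "'i \<Rightarrow> 'p \<Rightarrow> 'r"
    and J :: "'j set" and q :: "'j \<Rightarrow> 'q" and \<eta> :: "'j \<Rightarrow> 'q \<Rightarrow> 'r"
  assumes P1: "left_module R P1" and P0: "left_module R P0" and M: "left_module R M"
    and d: "d \<in> lhom R P1 P0" and e: "e \<in> lhom R P0 M"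
    and d_image: "d ` carrier P1 = ker P0 M e" and e_surj: "e ` carrier P0 = carrier M"
    and db1: "dual_basis R P1 I p \<xi>" and db0: "dual_basis R P0 J q \<eta>"
begin

sublocale P1: left_module R P1 by (rule P1)
sublocale P0: left_module R P0 by (rule P0)
sublocale M: left_module R M by (rule M)

abbreviation "D1 \<equiv> ring_dual R P1"
abbreviation "H \<equiv> (\<lambda>h. compose (carrier P1) h d) ` carrier (ring_dual R P0)"
abbreviation "Tr \<equiv> AB_transpose R P1 P0 d"
abbreviation "\<tau> \<equiv> field_dual K R Tr"
abbreviation "cls \<psi> \<equiv> H +>\<^bsub>D1\<^esub> \<psi>"

lemma D1: "left_module (opposite R) D1"
  by (rule left_module_ring_dual[OF P1])

lemma ed: "x \<in> carrier P1 \<Longrightarrow> e (d x) = \<zero>\<^bsub>M\<^esub>"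
  using d_image by (auto simp: ker_def)

lemma H_submodule: "submodule H (opposite R) D1"
proof -
  have D0: "left_module (opposite R) (ring_dual R P0)" by (rule left_module_ring_dual[OF P0])
  interpret D0: left_module "opposite R" "ring_dual R P0" by (rule D0)
  let ?c = "\<lambda>h. compose (carrier P1) h d"
  note dD = lhomD[OF d]
  have c: "restrict ?c (carrier (ring_dual R P0)) \<in> lhom (opposite R) (ring_dual R P0) D1"
  proof (rule lhomI)
    show "?c h \<in> carrier D1" if "h \<in> carrier (ring_dual R P0)" for h
      using compose_lhom[OF P1 d, of h "regular R"] that by simp
  qed (use dD D0 in \<open>auto simp: compose_def\<close>)
  have "submodule (restrict ?c (carrier (ring_dual R P0)) ` carrier (ring_dual R P0)) (opposite R) D1"
    by (rule submodule_image[OF D0 D1 c D0.submodule_carrier])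
  then show ?thesis by (simp only: image_restrict_eq)
qed

lemma Tr: "left_module (opposite R) Tr"
  unfolding AB_transpose_def by (rule left_module_quotient[OF D1 H_submodule])

lemma tau: "left_module R \<tau>"
  by (rule left_module_field_dual[OF Tr])

lemma cls_lhom: "(\<lambda>\<psi>\<in>carrier D1. cls \<psi>) \<in> lhom (opposite R) D1 Tr"
  unfolding AB_transpose_def by (rule quotient_proj_lhom[OF D1 H_submodule])

lemma cls:
  assumes "\<psi> \<in> lhom R P1 (regular R)"
  shows "cls \<psi> \<in> carrier Tr"
    and "\<chi> \<in> lhom R P1 (regular R) \<Longrightarrow> cls (\<psi> \<oplus>\<^bsub>D1\<^esub> \<chi>) = cls \<psi> \<oplus>\<^bsub>Tr\<^esub> cls \<chi>"
    and "r \<in> carrier R \<Longrightarrow> cls (r \<odot>\<^bsub>D1\<^esub> \<psi>) = r \<odot>\<^bsub>Tr\<^esub> cls \<psi>"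
    and "cls \<psi> = \<zero>\<^bsub>Tr\<^esub> \<longleftrightarrow> \<psi> \<in> H"
proof -
  interpret D1: left_module "opposite R" D1 by (rule D1)
  show "cls \<psi> \<in> carrier Tr" using lhomD(1)[OF cls_lhom, of \<psi>] assms by simp
  show "cls (\<psi> \<oplus>\<^bsub>D1\<^esub> \<chi>) = cls \<psi> \<oplus>\<^bsub>Tr\<^esub> cls \<chi>" if "\<chi> \<in> lhom R P1 (regular R)"
    using lhomD(2)[OF cls_lhom, of \<psi> \<chi>] D1.M.a_closed[of \<psi> \<chi>] assms that
    by (simp del: ring_dual_simps(3))
  show "cls (r \<odot>\<^bsub>D1\<^esub> \<psi>) = r \<odot>\<^bsub>Tr\<^esub> cls \<psi>" if "r \<in> carrier R"
    using lhomD(3)[OF cls_lhom, of r \<psi>] D1.smult_closed[of r \<psi>] assms that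
    by (simp del: ring_dual_simps(4))
  show "cls \<psi> = \<zero>\<^bsub>Tr\<^esub> \<longleftrightarrow> \<psi> \<in> H"
    using quotient_proj_zero_iff[OF D1 H_submodule, of \<psi>] assms unfolding AB_transpose_def by simp
qed

lemma Tr_cases:
  assumes "X \<in> carrier Tr"
  obtains \<psi> where "\<psi> \<in> lhom R P1 (regular R)" "X = cls \<psi>"
proof -
  have "X \<in> (\<lambda>\<psi>. cls \<psi>) ` carrier D1"
    using assms quotient_proj_surj[OF D1 H_submodule] unfolding AB_transpose_def by simp
  then show thesis by (elim imageE) (simp add: that)
qed

text \<open>This map is the image of the tensor of \<open>\<psi>\<close> and \<open>a\<close> under
  the canonical map from the tensor product of Hom(P, R) and \<open>A\<close> to Hom(P, A).\<close>

lemma rank_one_lhom: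
  assumes P: "left_module R P" and A: "left_module R A" and \<psi>: "\<psi> \<in> lhom R P (regular R)" and a: "a \<in> carrier A"
  shows "(\<lambda>x\<in>carrier P. \<psi> x \<odot>\<^bsub>A\<^esub> a) \<in> lhom R P A"
proof -
  interpret A: left_module R A by fact
  show ?thesis
    by (rule lhomI) (use lhomD[OF \<psi>] a P in \<open>auto simp: A.smult_closed A.smult_l_distr A.smult_assoc\<close>)
qed

text \<open>For \<open>P\<close> with a dual basis every homomorphism comes from a tensor, here an
  explicit one. Evaluating at \<open>x\<close> reduces the identity to the expansion of
  \<open>x\<close>.\<close>

lemma rank_one_decomposition:
  assumes P: "left_module R P" and A: "left_module R A" and db: "dual_basis R P I' p' \<xi>'"
    and h: "h \<in> lhom R P A"
  shows "h = (\<Oplus>\<^bsub>hom_space R P A\<^esub>i\<in>I'. (\<lambda>x\<in>carrier P. \<xi>' i x \<odot>\<^bsub>A\<^esub> h (p' i)))" (is "h = ?s")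
proof -
  interpret P: left_module R P by fact
  interpret A: left_module R A by fact
  note dd = dual_basisD[OF db]
  have HS: "left_module K (hom_space R P A)" by (rule left_module_hom_space[OF P A])
  interpret HS: left_module K "hom_space R P A" by (rule HS)
  have r: "(\<lambda>x\<in>carrier P. \<xi>' i x \<odot>\<^bsub>A\<^esub> h (p' i)) \<in> lhom R P A" if "i \<in> I'" for i
    by (rule rank_one_lhom[OF P A dd(3)[OF that]]) (use lhomD(1)[OF h dd(2)[OF that]] in simp)
  have s: "?s \<in> lhom R P A" using HS.M.finsum_closed[of "\<lambda>i. \<lambda>x\<in>carrier P. \<xi>' i x \<odot>\<^bsub>A\<^esub> h (p' i)" I'] r by auto
  show ?thesis
  proof (rule lhom_ext[OF h s])
    fix x assume x: "x \<in> carrier P"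
    let ?ev = "\<lambda>f\<in>carrier (hom_space R P A). f x"
    have ev: "?ev \<in> lhom K (hom_space R P A) (restrict_scalars R A)"
      by (rule lhomI) (use x HS lhomD(1) in auto)
    have c: "\<xi>' i x \<in> carrier R" if "i \<in> I'" for i using lhomD(1)[OF dd(3)[OF that] x] by simp
    have "?s x = ?ev ?s" using s by simp
    also have "\<dots> = (\<Oplus>\<^bsub>restrict_scalars R A\<^esub>i\<in>I'. ?ev (\<lambda>x\<in>carrier P. \<xi>' i x \<odot>\<^bsub>A\<^esub> h (p' i)))"
      by (rule lhom_finsum[OF HS left_module_restrict_scalars[OF A] ev dd(1)]) (use r in auto)
    also have "\<dots> = (\<Oplus>\<^bsub>A\<^esub>i\<in>I'. ?ev (\<lambda>x\<in>carrier P. \<xi>' i x \<odot>\<^bsub>A\<^esub> h (p' i)))"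
      by (rule finsum_restrict_scalars)
    also have "\<dots> = (\<Oplus>\<^bsub>A\<^esub>i\<in>I'. h (\<xi>' i x \<odot>\<^bsub>P\<^esub> p' i))"
      by (rule A.M.finsum_cong')
        (use r x c dd(2) lhomD(1,3)[OF h] in \<open>auto intro!: A.smult_closed P.smult_closed\<close>)
    also have "\<dots> = h (\<Oplus>\<^bsub>P\<^esub>i\<in>I'. \<xi>' i x \<odot>\<^bsub>P\<^esub> p' i)"
      by (rule lhom_finsum[OF P A h dd(1), symmetric]) (use c dd(2) in \<open>auto intro!: P.smult_closed\<close>)
    also have "\<dots> = h x" using dd(4)[OF x] by simp
    finally show "h x = ?s x" by simp
  qed
qed

text \<open>As \<^term>\<open>P1\<close> has a dual basis, functionals on \<open>Hom(P1, A)\<close> amount to pairings of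
  \<^term>\<open>A\<close> with \<^term>\<open>D1\<close> (send \<^term>\<open>\<phi>\<close> to \<^term>\<open>\<lambda>a \<psi>. \<phi> (\<lambda>x\<in>carrier P1. \<psi> x \<odot>\<^bsub>A\<^esub> a)\<close>).
  Those vanishing on \<open>Hom(P0, A) d\<close> factor through \<^term>\<open>Tr\<close>, that is, they are the
  homomorphisms from \<^term>\<open>A\<close> to \<^term>\<open>\<tau>\<close>.\<close>

definition functional_of ::
  "('r, 'a) module \<Rightarrow> ('a \<Rightarrow> ((('p \<Rightarrow> 'r) set) \<Rightarrow> 'k)) \<Rightarrow> ('p \<Rightarrow> 'a) \<Rightarrow> 'k" where
  "functional_of A \<alpha> = (\<lambda>h\<in>lhom R P1 A. \<Oplus>\<^bsub>K\<^esub>i\<in>I. \<alpha> (h (p i)) (cls (\<xi> i)))"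

context
  fixes A :: "('r, 'a) module" and \<alpha>
  assumes A: "left_module R A" and \<alpha>: "\<alpha> \<in> lhom R A \<tau>"
begin

interpretation A: left_module R A by (rule A)

lemma pairing:
  assumes a: "a \<in> carrier A"
  shows "X \<in> carrier Tr \<Longrightarrow> \<alpha> a X \<in> carrier K"
    and "\<lbrakk>X \<in> carrier Tr; Y \<in> carrier Tr\<rbrakk> \<Longrightarrow> \<alpha> a (X \<oplus>\<^bsub>Tr\<^esub> Y) = \<alpha> a X \<oplus>\<^bsub>K\<^esub> \<alpha> a Y"
    and "\<lbrakk>b \<in> carrier A; X \<in> carrier Tr\<rbrakk> \<Longrightarrow> \<alpha> (a \<oplus>\<^bsub>A\<^esub> b) X = \<alpha> a X \<oplus>\<^bsub>K\<^esub> \<alpha> b X"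
    and "\<lbrakk>r \<in> carrier R; X \<in> carrier Tr\<rbrakk> \<Longrightarrow> \<alpha> (r \<odot>\<^bsub>A\<^esub> a) X = \<alpha> a (r \<odot>\<^bsub>Tr\<^esub> X)"
    and "\<lbrakk>c \<in> carrier K; X \<in> carrier Tr\<rbrakk> \<Longrightarrow> \<alpha> (scalar c \<odot>\<^bsub>A\<^esub> a) X = c \<otimes>\<^bsub>K\<^esub> \<alpha> a X"
    and "\<alpha> a \<zero>\<^bsub>Tr\<^esub> = \<zero>\<^bsub>K\<^esub>"
    and "\<alpha> a \<in> lhom K (restrict_scalars R Tr) (regular K)"
proof -
  show \<alpha>a: "\<alpha> a \<in> lhom K (restrict_scalars R Tr) (regular K)"
    using lhomD(1)[OF \<alpha> a] by simp
  note D = lhomD[OF \<alpha>a, simplified]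
  show "X \<in> carrier Tr \<Longrightarrow> \<alpha> a X \<in> carrier K" by (rule D(1))
  show "\<lbrakk>X \<in> carrier Tr; Y \<in> carrier Tr\<rbrakk> \<Longrightarrow> \<alpha> a (X \<oplus>\<^bsub>Tr\<^esub> Y) = \<alpha> a X \<oplus>\<^bsub>K\<^esub> \<alpha> a Y" by (rule D(2))
  show "\<lbrakk>b \<in> carrier A; X \<in> carrier Tr\<rbrakk> \<Longrightarrow> \<alpha> (a \<oplus>\<^bsub>A\<^esub> b) X = \<alpha> a X \<oplus>\<^bsub>K\<^esub> \<alpha> b X"
    using lhomD(2)[OF \<alpha> a] by simp
  show sm: "\<alpha> (r \<odot>\<^bsub>A\<^esub> a) X = \<alpha> a (r \<odot>\<^bsub>Tr\<^esub> X)" if "r \<in> carrier R" "X \<in> carrier Tr" for r X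
    using lhomD(3)[OF \<alpha> that(1) a] that by simp
  show "\<lbrakk>c \<in> carrier K; X \<in> carrier Tr\<rbrakk> \<Longrightarrow> \<alpha> (scalar c \<odot>\<^bsub>A\<^esub> a) X = c \<otimes>\<^bsub>K\<^esub> \<alpha> a X"
    using sm[of "scalar c" X] D(3)[of c X] by simp
  show "\<alpha> a \<zero>\<^bsub>Tr\<^esub> = \<zero>\<^bsub>K\<^esub>"
    using lhom_zero[OF left_module_restrict_scalars_right[OF Tr] left_module_regular[OF base.R.ring_axioms] \<alpha>a]
    by simp
qed

lemma functional_of_lhom: "functional_of A \<alpha> \<in> lhom K (hom_space R P1 A) (regular K)"
proof -
  note dd = dual_basisD[OF db1]
  have c: "cls (\<xi> i) \<in> carrier Tr" if "i \<in> I" for i by (rule cls(1)[OF dd(3)[OF that]])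
  have hp: "h (p i) \<in> carrier A" if "h \<in> lhom R P1 A" "i \<in> I" for h i
    using lhomD(1)[OF that(1) dd(2)[OF that(2)]] .
  have s: "\<alpha> (h (p i)) (cls (\<xi> i)) \<in> carrier K" if "h \<in> lhom R P1 A" "i \<in> I" for h i
    using pairing(1)[OF hp[OF that] c[OF that(2)]] .
  have "restrict (\<lambda>h. \<Oplus>\<^bsub>K\<^esub>i\<in>I. \<alpha> (h (p i)) (cls (\<xi> i))) (carrier (hom_space R P1 A))
    \<in> lhom K (hom_space R P1 A) (regular K)"
  proof (rule lhomI)
    fix h assume "h \<in> carrier (hom_space R P1 A)"
    then have h: "h \<in> lhom R P1 A" by simp
    show "(\<Oplus>\<^bsub>K\<^esub>i\<in>I. \<alpha> (h (p i)) (cls (\<xi> i))) \<in> carrier (regular K)"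
      using base.R.finsum_closed[of "\<lambda>i. \<alpha> (h (p i)) (cls (\<xi> i))" I] s[OF h] by auto
    {
      fix k assume "k \<in> carrier (hom_space R P1 A)"
      then have k: "k \<in> lhom R P1 A" by simp
      have "(\<Oplus>\<^bsub>K\<^esub>i\<in>I. \<alpha> ((h \<oplus>\<^bsub>hom_space R P1 A\<^esub> k) (p i)) (cls (\<xi> i))) =
          (\<Oplus>\<^bsub>K\<^esub>i\<in>I. \<alpha> (h (p i)) (cls (\<xi> i)) \<oplus>\<^bsub>K\<^esub> \<alpha> (k (p i)) (cls (\<xi> i)))"
        by (rule base.R.finsum_cong') (use s h k hp c dd(2) pairing(3) in auto)
      also have "\<dots> = (\<Oplus>\<^bsub>K\<^esub>i\<in>I. \<alpha> (h (p i)) (cls (\<xi> i))) \<oplus>\<^bsub>K\<^esub> (\<Oplus>\<^bsub>K\<^esub>i\<in>I. \<alpha> (k (p i)) (cls (\<xi> i)))"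
        by (rule base.R.finsum_addf) (use s h k in auto)
      finally show "(\<Oplus>\<^bsub>K\<^esub>i\<in>I. \<alpha> ((h \<oplus>\<^bsub>hom_space R P1 A\<^esub> k) (p i)) (cls (\<xi> i))) =
          (\<Oplus>\<^bsub>K\<^esub>i\<in>I. \<alpha> (h (p i)) (cls (\<xi> i))) \<oplus>\<^bsub>regular K\<^esub> (\<Oplus>\<^bsub>K\<^esub>i\<in>I. \<alpha> (k (p i)) (cls (\<xi> i)))"
        by simp
    }
    fix b assume b: "b \<in> carrier K"
    have "(\<Oplus>\<^bsub>K\<^esub>i\<in>I. \<alpha> ((b \<odot>\<^bsub>hom_space R P1 A\<^esub> h) (p i)) (cls (\<xi> i))) =
        (\<Oplus>\<^bsub>K\<^esub>i\<in>I. b \<otimes>\<^bsub>K\<^esub> \<alpha> (h (p i)) (cls (\<xi> i)))"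
      by (rule base.R.finsum_cong') (use s h hp c dd(2) b pairing(5) in auto)
    also have "\<dots> = b \<otimes>\<^bsub>K\<^esub> (\<Oplus>\<^bsub>K\<^esub>i\<in>I. \<alpha> (h (p i)) (cls (\<xi> i)))"
      by (rule base.R.finsum_rdistr[symmetric]) (use s h dd(1) b in auto)
    finally show "(\<Oplus>\<^bsub>K\<^esub>i\<in>I. \<alpha> ((b \<odot>\<^bsub>hom_space R P1 A\<^esub> h) (p i)) (cls (\<xi> i))) =
        b \<odot>\<^bsub>regular K\<^esub> (\<Oplus>\<^bsub>K\<^esub>i\<in>I. \<alpha> (h (p i)) (cls (\<xi> i)))" by simp
  qed (rule left_module_hom_space[OF P1 A])
  then show ?thesis by (simp add: functional_of_def)
qed

text \<open>\<open>functional_of\<close> is written with a chosen dual basis; this shows that it is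
  the intended pairing, and so does not depend on the basis.\<close>

lemma functional_of_rank_one:
  assumes \<psi>: "\<psi> \<in> lhom R P1 (regular R)" and a: "a \<in> carrier A"
  shows "functional_of A \<alpha> (\<lambda>x\<in>carrier P1. \<psi> x \<odot>\<^bsub>A\<^esub> a) = \<alpha> a (cls \<psi>)"
proof -
  note dd = dual_basisD[OF db1]
  interpret D1: left_module "opposite R" D1 by (rule D1)
  have \<psi>p: "\<psi> (p i) \<in> carrier R" if "i \<in> I" for i using lhomD(1)[OF \<psi> dd(2)[OF that]] by simp
  have t: "\<psi> (p i) \<odot>\<^bsub>D1\<^esub> \<xi> i \<in> carrier D1" if "i \<in> I" for i
    using D1.smult_closed[of "\<psi> (p i)" "\<xi> i"] \<psi>p[OF that] dd(3)[OF that] by simp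
  \<comment> \<open>The functionals \<open>\<xi> i\<close> generate Hom(P1, R) as a right module,
    with the values of \<open>\<psi>\<close> at \<open>p i\<close> as coefficients.\<close>
  have \<psi>sum: "\<psi> = (\<Oplus>\<^bsub>D1\<^esub>i\<in>I. \<psi> (p i) \<odot>\<^bsub>D1\<^esub> \<xi> i)" (is "_ = ?s")
  proof -
    have s: "?s \<in> lhom R P1 (regular R)"
      using D1.M.finsum_closed[of "\<lambda>i. \<psi> (p i) \<odot>\<^bsub>D1\<^esub> \<xi> i" I] t by auto
    show ?thesis
    proof (rule lhom_ext[OF \<psi> s])
      fix x assume x: "x \<in> carrier P1"
      let ?ev = "\<lambda>f\<in>carrier D1. f x"
      have RR: "left_module (opposite R) (regular (opposite R))"
        by (rule left_module_regular[OF ring_opposite[OF R.ring_axioms]])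
      have ev: "?ev \<in> lhom (opposite R) D1 (regular (opposite R))"
        by (rule lhomI) (use x D1 lhomD(1)[of _ R P1 "regular R" x] in auto)
      have c: "\<xi> i x \<in> carrier R" if "i \<in> I" for i using lhomD(1)[OF dd(3)[OF that] x] by simp
      have "?s x = ?ev ?s" using s by simp
      also have "\<dots> = (\<Oplus>\<^bsub>regular (opposite R)\<^esub>i\<in>I. ?ev (\<psi> (p i) \<odot>\<^bsub>D1\<^esub> \<xi> i))"
        by (rule lhom_finsum[OF D1 RR ev dd(1)]) (use t in auto)
      also have "\<dots> = (\<Oplus>\<^bsub>R\<^esub>i\<in>I. ?ev (\<psi> (p i) \<odot>\<^bsub>D1\<^esub> \<xi> i))"
        by (simp add: finsum_def finprod_def regular_def opposite_def)
      also have "\<dots> = (\<Oplus>\<^bsub>R\<^esub>i\<in>I. \<psi> (\<xi> i x \<odot>\<^bsub>P1\<^esub> p i))"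
      proof (rule base.M.finsum_cong')
        fix i assume i: "i \<in> I"
        have "?ev (\<psi> (p i) \<odot>\<^bsub>D1\<^esub> \<xi> i) = \<xi> i x \<otimes>\<^bsub>R\<^esub> \<psi> (p i)" using t[OF i] x by simp
        also have "\<dots> = \<psi> (\<xi> i x \<odot>\<^bsub>P1\<^esub> p i)" using lhomD(3)[OF \<psi> c[OF i] dd(2)[OF i]] by simp
        finally show "?ev (\<psi> (p i) \<odot>\<^bsub>D1\<^esub> \<xi> i) = \<psi> (\<xi> i x \<odot>\<^bsub>P1\<^esub> p i)" .
      qed (use c dd(2) lhomD(1)[OF \<psi>] P1.smult_closed in auto)
      also have "\<dots> = (\<Oplus>\<^bsub>regular R\<^esub>i\<in>I. \<psi> (\<xi> i x \<odot>\<^bsub>P1\<^esub> p i))" by (simp add: finsum_regular)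
      also have "\<dots> = \<psi> (\<Oplus>\<^bsub>P1\<^esub>i\<in>I. \<xi> i x \<odot>\<^bsub>P1\<^esub> p i)"
        by (rule lhom_finsum[OF P1 left_module_regular[OF R.ring_axioms] \<psi> dd(1), symmetric])
          (use c dd(2) P1.smult_closed in auto)
      also have "\<dots> = \<psi> x" using dd(4)[OF x] by simp
      finally show "\<psi> x = ?s x" by simp
    qed
  qed
  have KD1: "left_module K (restrict_scalars R D1)" by (rule left_module_restrict_scalars_right[OF D1])
  let ?c = "\<lambda>\<psi>\<in>carrier D1. cls \<psi>"
  have cK: "?c \<in> lhom K (restrict_scalars R D1) (restrict_scalars R Tr)"
    by (rule lhom_restrict_scalars_right[OF D1 cls_lhom])
  let ?b = "compose (carrier (restrict_scalars R D1)) (\<alpha> a) ?c"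
  have b: "?b \<in> lhom K (restrict_scalars R D1) (regular K)"
    by (rule compose_lhom[OF KD1 cK pairing(7)[OF a]])
  have bv: "?b \<chi> = \<alpha> a (cls \<chi>)" if "\<chi> \<in> carrier D1" for \<chi> using that by (simp add: compose_def)
  have "functional_of A \<alpha> (\<lambda>x\<in>carrier P1. \<psi> x \<odot>\<^bsub>A\<^esub> a) = (\<Oplus>\<^bsub>K\<^esub>i\<in>I. \<alpha> ((\<lambda>x\<in>carrier P1. \<psi> x \<odot>\<^bsub>A\<^esub> a) (p i)) (cls (\<xi> i)))"
    using rank_one_lhom[OF P1 A \<psi> a] by (simp add: functional_of_def)
  \<comment> \<open>The ring element \<open>\<psi> (p i)\<close> moves from \<open>a\<close> to the
    class, because the action on \<open>\<tau>\<close> is precomposition.\<close>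
  also have "\<dots> = (\<Oplus>\<^bsub>K\<^esub>i\<in>I. ?b (\<psi> (p i) \<odot>\<^bsub>D1\<^esub> \<xi> i))"
  proof (rule base.R.finsum_cong')
    fix i assume i: "i \<in> I"
    have "\<alpha> ((\<lambda>x\<in>carrier P1. \<psi> x \<odot>\<^bsub>A\<^esub> a) (p i)) (cls (\<xi> i)) = \<alpha> a (\<psi> (p i) \<odot>\<^bsub>Tr\<^esub> cls (\<xi> i))"
      using pairing(4)[OF a \<psi>p[OF i] cls(1)[OF dd(3)[OF i]]] dd(2)[OF i] by simp
    also have "\<dots> = \<alpha> a (cls (\<psi> (p i) \<odot>\<^bsub>D1\<^esub> \<xi> i))"
      using cls(3)[OF dd(3)[OF i] \<psi>p[OF i]] by simp
    also have "\<dots> = ?b (\<psi> (p i) \<odot>\<^bsub>D1\<^esub> \<xi> i)" using bv[OF t[OF i]] by simp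
    finally show "\<alpha> ((\<lambda>x\<in>carrier P1. \<psi> x \<odot>\<^bsub>A\<^esub> a) (p i)) (cls (\<xi> i)) = ?b (\<psi> (p i) \<odot>\<^bsub>D1\<^esub> \<xi> i)" .
  qed (use lhomD(1)[OF b] t in auto)
  also have "\<dots> = (\<Oplus>\<^bsub>regular K\<^esub>i\<in>I. ?b (\<psi> (p i) \<odot>\<^bsub>D1\<^esub> \<xi> i))" by (simp only: finsum_regular)
  also have "\<dots> = ?b (\<Oplus>\<^bsub>restrict_scalars R D1\<^esub>i\<in>I. \<psi> (p i) \<odot>\<^bsub>D1\<^esub> \<xi> i)"
    by (rule lhom_finsum[OF KD1 left_module_regular[OF base.R.ring_axioms] b dd(1), symmetric])
      (use t in auto)
  also have "\<dots> = ?b \<psi>" using \<psi>sum by (simp only: finsum_restrict_scalars)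
  also have "\<dots> = \<alpha> a (cls \<psi>)" using bv \<psi> by simp
  finally show ?thesis .
qed

text \<open>It suffices to treat rank one maps. Restricted along \<open>d\<close>, such a map has
  coordinate \<open>\<eta> j\<close> after \<open>d\<close>, an element of \<open>H\<close>, whose
  class is zero.\<close>

lemma functional_of_vanishes:
  assumes g: "g \<in> lhom R P0 A"
  shows "functional_of A \<alpha> (compose (carrier P1) g d) = \<zero>\<^bsub>K\<^esub>"
proof -
  note dd = dual_basisD[OF db0]
  note f = functional_of_lhom
  have HS0: "left_module K (hom_space R P0 A)"
    by (rule left_module_hom_space[OF P0 A])
  let ?d = "\<lambda>g\<in>lhom R P0 A. compose (carrier P1) g d"
  have dl: "?d \<in> lhom K (hom_space R P0 A) (hom_space R P1 A)"
    by (rule hom_space_precompose[OF P1 P0 A d])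
  let ?F = "compose (carrier (hom_space R P0 A)) (functional_of A \<alpha>) ?d"
  have F: "?F \<in> lhom K (hom_space R P0 A) (regular K)" by (rule compose_lhom[OF HS0 dl f])
  have gq: "g (q j) \<in> carrier A" if "j \<in> J" for j using lhomD(1)[OF g dd(2)[OF that]] .
  have r: "(\<lambda>x\<in>carrier P0. \<eta> j x \<odot>\<^bsub>A\<^esub> g (q j)) \<in> lhom R P0 A" if "j \<in> J" for j
    by (rule rank_one_lhom[OF P0 A dd(3)[OF that] gq[OF that]])
  have z: "?F (\<lambda>x\<in>carrier P0. \<eta> j x \<odot>\<^bsub>A\<^esub> g (q j)) = \<zero>\<^bsub>K\<^esub>" if j: "j \<in> J" for j
  proof -
    have hd: "compose (carrier P1) (\<eta> j) d \<in> lhom R P1 (regular R)" by (rule compose_lhom[OF P1 d dd(3)[OF j]])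
    have "compose (carrier P1) (\<lambda>x\<in>carrier P0. \<eta> j x \<odot>\<^bsub>A\<^esub> g (q j)) d =
        (\<lambda>x\<in>carrier P1. compose (carrier P1) (\<eta> j) d x \<odot>\<^bsub>A\<^esub> g (q j))"
      using lhomD(1)[OF d] by (auto simp: compose_def fun_eq_iff)
    then have "?F (\<lambda>x\<in>carrier P0. \<eta> j x \<odot>\<^bsub>A\<^esub> g (q j)) = \<alpha> (g (q j)) (cls (compose (carrier P1) (\<eta> j) d))"
      using functional_of_rank_one[OF hd gq[OF j]] r[OF j] by (simp add: compose_eq)
    also have "cls (compose (carrier P1) (\<eta> j) d) = \<zero>\<^bsub>Tr\<^esub>"
      using cls(4)[OF hd] dd(3)[OF j] by auto
    also have "\<alpha> (g (q j)) \<zero>\<^bsub>Tr\<^esub> = \<zero>\<^bsub>K\<^esub>" by (rule pairing(6)[OF gq[OF j]])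
    finally show ?thesis .
  qed
  have "functional_of A \<alpha> (compose (carrier P1) g d) = ?F g" using g by (simp add: compose_eq)
  also have "\<dots> = ?F (\<Oplus>\<^bsub>hom_space R P0 A\<^esub>j\<in>J. (\<lambda>x\<in>carrier P0. \<eta> j x \<odot>\<^bsub>A\<^esub> g (q j)))"
    using rank_one_decomposition[OF P0 A db0 g] by simp
  also have "\<dots> = (\<Oplus>\<^bsub>regular K\<^esub>j\<in>J. ?F (\<lambda>x\<in>carrier P0. \<eta> j x \<odot>\<^bsub>A\<^esub> g (q j)))"
    by (rule lhom_finsum[OF HS0 left_module_regular[OF base.R.ring_axioms] F dd(1)]) (use r in auto)
  also have "\<dots> = (\<Oplus>\<^bsub>K\<^esub>j\<in>J. ?F (\<lambda>x\<in>carrier P0. \<eta> j x \<odot>\<^bsub>A\<^esub> g (q j)))" by (simp only: finsum_regular)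
  also have "\<dots> = (\<Oplus>\<^bsub>K\<^esub>j\<in>J. \<zero>\<^bsub>K\<^esub>)" by (rule base.R.finsum_cong') (use z in auto)
  also have "\<dots> = \<zero>\<^bsub>K\<^esub>" by simp
  finally show ?thesis .
qed

end

text \<open>For fixed \<open>a\<close>, sending \<open>\<psi>\<close> to the value of
  \<open>\<phi>\<close> at the rank one map of \<open>\<psi>\<close> and \<open>a\<close> kills
  \<open>H\<close>: if \<open>\<psi>\<close> extends over \<open>P0\<close>, so does the rank one
  map. The functional therefore descends to \<open>Tr\<close>, and linearity in \<open>a\<close> is
  checked on classes.\<close>

lemma hom_of_functional:
  fixes A :: "('r, 'a) module"
  assumes A: "left_module R A" and \<phi>: "\<phi> \<in> lhom K (hom_space R P1 A) (regular K)"
    and van: "\<And>g. g \<in> lhom R P0 A \<Longrightarrow> \<phi> (compose (carrier P1) g d) = \<zero>\<^bsub>K\<^esub>"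
  shows "\<exists>\<alpha>\<in>lhom R A \<tau>. \<forall>a\<in>carrier A. \<forall>\<psi>\<in>lhom R P1 (regular R).
    \<alpha> a (cls \<psi>) = \<phi> (\<lambda>x\<in>carrier P1. \<psi> x \<odot>\<^bsub>A\<^esub> a)"
proof -
  interpret A: left_module R A by fact
  have KD1: "left_module K (restrict_scalars R D1)" by (rule left_module_restrict_scalars_right[OF D1])
  have KTr: "left_module K (restrict_scalars R Tr)" by (rule left_module_restrict_scalars_right[OF Tr])
  have KK: "left_module K (regular K)" by (rule left_module_regular[OF base.R.ring_axioms])
  have cK: "(\<lambda>\<psi>\<in>carrier D1. cls \<psi>) \<in> lhom K (restrict_scalars R D1) (restrict_scalars R Tr)"
    by (rule lhom_restrict_scalars_right[OF D1 cls_lhom])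
  let ?r = "\<lambda>\<psi> a. \<lambda>x\<in>carrier P1. \<psi> x \<odot>\<^bsub>A\<^esub> a"
  have r: "?r \<psi> a \<in> lhom R P1 A" if "\<psi> \<in> lhom R P1 (regular R)" "a \<in> carrier A" for \<psi> a
    by (rule rank_one_lhom[OF P1 A that])
  note \<phi>D = lhomD[OF \<phi>, simplified]
  have "\<exists>t\<in>lhom K (restrict_scalars R Tr) (regular K). \<forall>\<psi>\<in>lhom R P1 (regular R). t (cls \<psi>) = \<phi> (?r \<psi> a)"
    if a: "a \<in> carrier A" for a
  proof -
    have f: "restrict (\<lambda>\<psi>. \<phi> (?r \<psi> a)) (carrier (restrict_scalars R D1)) \<in> lhom K (restrict_scalars R D1) (regular K)"
    proof (rule lhomI)
      fix \<psi> assume "\<psi> \<in> carrier (restrict_scalars R D1)"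
      then have \<psi>: "\<psi> \<in> lhom R P1 (regular R)" by simp
      note \<psi>D = lhomD(1)[OF \<psi>, simplified]
      show "\<phi> (?r \<psi> a) \<in> carrier (regular K)" using \<phi>D(1)[OF r[OF \<psi> a]] by simp
      show "\<phi> (?r (\<psi> \<oplus>\<^bsub>restrict_scalars R D1\<^esub> \<chi>) a) = \<phi> (?r \<psi> a) \<oplus>\<^bsub>regular K\<^esub> \<phi> (?r \<chi> a)"
        if "\<chi> \<in> carrier (restrict_scalars R D1)" for \<chi>
      proof -
        have \<chi>: "\<chi> \<in> lhom R P1 (regular R)" using that by simp
        note \<chi>D = lhomD(1)[OF \<chi>, simplified]
        have "?r (\<psi> \<oplus>\<^bsub>restrict_scalars R D1\<^esub> \<chi>) a = (\<lambda>x\<in>carrier P1. ?r \<psi> a x \<oplus>\<^bsub>A\<^esub> ?r \<chi> a x)"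
          using \<psi>D \<chi>D a by (auto simp: fun_eq_iff A.smult_l_distr)
        then show ?thesis using \<phi>D(2)[OF r[OF \<psi> a] r[OF \<chi> a]] by simp
      qed
      show "\<phi> (?r (c \<odot>\<^bsub>restrict_scalars R D1\<^esub> \<psi>) a) = c \<odot>\<^bsub>regular K\<^esub> \<phi> (?r \<psi> a)" if c: "c \<in> carrier K" for c
      proof -
        have "?r (c \<odot>\<^bsub>restrict_scalars R D1\<^esub> \<psi>) a = (\<lambda>x\<in>carrier P1. scalar c \<odot>\<^bsub>A\<^esub> ?r \<psi> a x)"
          using \<psi>D a c by (auto simp: fun_eq_iff scalar_commute A.smult_assoc)
        then show ?thesis using \<phi>D(3)[OF c r[OF \<psi> a]] by simp
      qed
    qed (rule KD1)
    have "\<exists>t\<in>lhom K (restrict_scalars R Tr) (regular K). \<forall>\<psi>\<in>carrier (restrict_scalars R D1).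
      t ((\<lambda>\<psi>\<in>carrier D1. cls \<psi>) \<psi>) = restrict (\<lambda>\<psi>. \<phi> (?r \<psi> a)) (carrier (restrict_scalars R D1)) \<psi>"
    proof (rule factor_surj[OF KD1 KK KTr cK _ f])
      show "(\<lambda>\<psi>\<in>carrier D1. cls \<psi>) ` carrier (restrict_scalars R D1) = carrier (restrict_scalars R Tr)"
        using quotient_proj_surj[OF D1 H_submodule] unfolding AB_transpose_def by simp
      fix \<psi> assume "\<psi> \<in> carrier (restrict_scalars R D1)"
        and 0: "(\<lambda>\<psi>\<in>carrier D1. cls \<psi>) \<psi> = \<zero>\<^bsub>restrict_scalars R Tr\<^esub>"
      then have \<psi>: "\<psi> \<in> lhom R P1 (regular R)" by simp
      then have "\<psi> \<in> H" using 0 cls(4)[OF \<psi>] by simp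
      then obtain h where h: "h \<in> lhom R P0 (regular R)" "\<psi> = compose (carrier P1) h d" by auto
      have "?r \<psi> a = compose (carrier P1) (\<lambda>x\<in>carrier P0. h x \<odot>\<^bsub>A\<^esub> a) d"
        using h lhomD(1)[OF d] by (auto simp: fun_eq_iff compose_def)
      then have "\<phi> (?r \<psi> a) = \<zero>\<^bsub>K\<^esub>" using van[OF rank_one_lhom[OF P0 A h(1) a]] by simp
      then show "restrict (\<lambda>\<psi>. \<phi> (?r \<psi> a)) (carrier (restrict_scalars R D1)) \<psi> = \<zero>\<^bsub>regular K\<^esub>"
        using \<psi> by simp
    qed
    then show ?thesis by (simp cong: ball_cong)
  qed
  then obtain \<alpha> where \<alpha>: "\<And>a. a \<in> carrier A \<Longrightarrow> \<alpha> a \<in> lhom K (restrict_scalars R Tr) (regular K)"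
    and \<alpha>c: "\<And>a \<psi>. a \<in> carrier A \<Longrightarrow> \<psi> \<in> lhom R P1 (regular R) \<Longrightarrow> \<alpha> a (cls \<psi>) = \<phi> (?r \<psi> a)"
    by metis
  interpret \<tau>: left_module R \<tau> by (rule tau)
  have eqI: "s = t" if "s \<in> lhom K (restrict_scalars R Tr) (regular K)" "t \<in> lhom K (restrict_scalars R Tr) (regular K)"
    "\<And>\<psi>. \<psi> \<in> lhom R P1 (regular R) \<Longrightarrow> s (cls \<psi>) = t (cls \<psi>)" for s t
  proof (rule lhom_ext[OF that(1,2)])
    fix X assume "X \<in> carrier (restrict_scalars R Tr)"
    then have "X \<in> carrier Tr" by simp
    then show "s X = t X" by (rule Tr_cases) (use that(3) in auto)
  qed
  have "restrict \<alpha> (carrier A) \<in> lhom R A \<tau>"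
  proof (rule lhomI)
    show "\<alpha> a \<in> carrier \<tau>" if "a \<in> carrier A" for a using \<alpha>[OF that] by simp
    show "\<alpha> (a \<oplus>\<^bsub>A\<^esub> b) = \<alpha> a \<oplus>\<^bsub>\<tau>\<^esub> \<alpha> b" if ab: "a \<in> carrier A" "b \<in> carrier A" for a b
    proof (rule eqI)
      show "\<alpha> (a \<oplus>\<^bsub>A\<^esub> b) \<in> lhom K (restrict_scalars R Tr) (regular K)" using \<alpha> ab by simp
      show "\<alpha> a \<oplus>\<^bsub>\<tau>\<^esub> \<alpha> b \<in> lhom K (restrict_scalars R Tr) (regular K)"
        using \<tau>.M.a_closed[of "\<alpha> a" "\<alpha> b"] \<alpha> ab by (simp del: field_dual_simps(3))
      fix \<psi> assume \<psi>: "\<psi> \<in> lhom R P1 (regular R)"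
      have "?r \<psi> (a \<oplus>\<^bsub>A\<^esub> b) = (\<lambda>x\<in>carrier P1. ?r \<psi> a x \<oplus>\<^bsub>A\<^esub> ?r \<psi> b x)"
        using lhomD(1)[OF \<psi>] ab by (auto simp: fun_eq_iff A.smult_r_distr)
      then show "\<alpha> (a \<oplus>\<^bsub>A\<^esub> b) (cls \<psi>) = (\<alpha> a \<oplus>\<^bsub>\<tau>\<^esub> \<alpha> b) (cls \<psi>)"
        using \<phi>D(2)[OF r[OF \<psi> ab(1)] r[OF \<psi> ab(2)]] \<alpha>c \<psi> ab cls(1)[OF \<psi>] by simp
    qed
    show "\<alpha> (s \<odot>\<^bsub>A\<^esub> a) = s \<odot>\<^bsub>\<tau>\<^esub> \<alpha> a" if s: "s \<in> carrier R" and a: "a \<in> carrier A" for s a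
    proof (rule eqI)
      show "\<alpha> (s \<odot>\<^bsub>A\<^esub> a) \<in> lhom K (restrict_scalars R Tr) (regular K)" using \<alpha> s a A.smult_closed by simp
      show "s \<odot>\<^bsub>\<tau>\<^esub> \<alpha> a \<in> lhom K (restrict_scalars R Tr) (regular K)"
        using \<tau>.smult_closed[of s "\<alpha> a"] \<alpha> s a by (simp del: field_dual_simps(4))
      fix \<psi> assume \<psi>: "\<psi> \<in> lhom R P1 (regular R)"
      interpret D1: left_module "opposite R" D1 by (rule D1)
      have s\<psi>: "s \<odot>\<^bsub>D1\<^esub> \<psi> \<in> lhom R P1 (regular R)"
        using D1.smult_closed[of s \<psi>] s \<psi> by (simp del: ring_dual_simps(4))
      \<comment> \<open>The rank one map is balanced: \<open>s\<close> may act on \<open>a\<close>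
        from the left or on \<open>\<psi>\<close> from the right.\<close>
      have "?r \<psi> (s \<odot>\<^bsub>A\<^esub> a) = ?r (s \<odot>\<^bsub>D1\<^esub> \<psi>) a"
        using lhomD(1)[OF \<psi>] s a by (auto simp: fun_eq_iff A.smult_assoc)
      then have "\<alpha> (s \<odot>\<^bsub>A\<^esub> a) (cls \<psi>) = \<alpha> a (cls (s \<odot>\<^bsub>D1\<^esub> \<psi>))"
        using \<alpha>c[OF a s\<psi>] \<alpha>c[OF _ \<psi>, of "s \<odot>\<^bsub>A\<^esub> a"] s a A.smult_closed by simp
      then show "\<alpha> (s \<odot>\<^bsub>A\<^esub> a) (cls \<psi>) = (s \<odot>\<^bsub>\<tau>\<^esub> \<alpha> a) (cls \<psi>)"
        using cls(3)[OF \<psi> s] cls(1)[OF \<psi>] by simp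
    qed
  qed (rule A)
  then show ?thesis using \<alpha>c by (intro bexI[of _ "restrict \<alpha> (carrier A)"]) auto
qed

end

section \<open>Lifting maps from M versus extending maps into the translate\<close>

lemma short_exact_modulesD:
  assumes "short_exact_modules R A B C f g"
  shows "left_module R A" "left_module R B" "left_module R C" "f \<in> lhom R A B" "g \<in> lhom R B C"
    "inj_on f (carrier A)" "f ` carrier A = {b \<in> carrier B. g b = \<zero>\<^bsub>C\<^esub>}" "g ` carrier B = carrier C"
  using assms by (auto simp: short_exact_modules_def short_exact_def)

context presentation
begin

text \<open>The universal property of \<open>M\<close> as the cokernel of \<open>d\<close>.\<close>

lemma hom_eq_zero_on_image:
  assumes N: "left_module R N" and b: "b \<in> lhom R P0 N"
    and 0: "\<And>x. x \<in> carrier P1 \<Longrightarrow> b (d x) = \<zero>\<^bsub>N\<^esub>"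
  shows "\<exists>u\<in>lhom R M N. \<forall>y\<in>carrier P0. u (e y) = b y"
proof (rule factor_surj[OF P0 N M e e_surj b])
  fix y assume "y \<in> carrier P0" "e y = \<zero>\<^bsub>M\<^esub>"
  then have "y \<in> d ` carrier P1" using d_image by (simp add: ker_def)
  then show "b y = \<zero>\<^bsub>N\<^esub>" using 0 by auto
qed

lemma tau_injective_relative:
  assumes seq: "short_exact_modules R A B C f g"
    and lift: "\<And>u. u \<in> lhom R M C \<Longrightarrow> \<exists>v\<in>lhom R M B. \<forall>x\<in>carrier M. g (v x) = u x"
  shows "injective_relative R \<tau> A B f"
  unfolding injective_relative_def
proof
  fix \<alpha> assume \<alpha>: "\<alpha> \<in> lhom R A \<tau>"
  note A = short_exact_modulesD(1)[OF seq] and B = short_exact_modulesD(2)[OF seq]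
    and C = short_exact_modulesD(3)[OF seq] and f = short_exact_modulesD(4)[OF seq]
    and g = short_exact_modulesD(5)[OF seq] and inj = short_exact_modulesD(6)[OF seq]
    and img = short_exact_modulesD(7)[OF seq]
  interpret A: left_module R A by (rule A)
  interpret B: left_module R B by (rule B)
  interpret C: left_module R C by (rule C)
  have HB: "left_module K (hom_space R P1 B)" by (rule left_module_hom_space[OF P1 B])
  define \<phi> where "\<phi> = functional_of A \<alpha>"
  have \<phi>: "\<phi> \<in> lhom K (hom_space R P1 A) (regular K)"
    unfolding \<phi>_def by (rule functional_of_lhom[OF A \<alpha>])
  let ?s = "\<lambda>h\<in>lhom R P1 A. compose (carrier P1) f h" and ?t = "\<lambda>b\<in>lhom R P0 B. compose (carrier P1) b d"
  have "\<exists>\<psi>\<in>lhom K (hom_space R P1 B) (regular K).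
      (\<forall>h\<in>carrier (hom_space R P1 A). \<psi> (?s h) = \<phi> h) \<and> (\<forall>b\<in>carrier (hom_space R P0 B). \<psi> (?t b) = \<zero>\<^bsub>K\<^esub>)"
  proof (rule extend_functional_along[OF K.field_axioms HB left_module_hom_space[OF P1 A]
        left_module_hom_space[OF P0 B] hom_space_postcompose[OF P1 A f] hom_space_precompose[OF P1 P0 B d] \<phi>])
    \<comment> \<open>Here \<open>f\<close> after \<open>h\<close> equals minus \<open>b\<close>
      after \<open>d\<close>. The lifting hypothesis has to make \<open>h\<close> itself extend over
      \<open>P0\<close>.\<close>
    fix h b assume "h \<in> carrier (hom_space R P1 A)" "b \<in> carrier (hom_space R P0 B)"
      and z: "?s h \<oplus>\<^bsub>hom_space R P1 B\<^esub> ?t b = \<zero>\<^bsub>hom_space R P1 B\<^esub>"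
    then have *: "h \<in> lhom R P1 A" "b \<in> lhom R P0 B" by simp_all
    let ?b = "\<lambda>y\<in>carrier P0. \<ominus>\<^bsub>B\<^esub> b y"
    have b: "?b \<in> lhom R P0 B" by (rule lhom_minus_closed[OF P0 B *(2)])
    have fh: "f (h x) = ?b (d x)" if x: "x \<in> carrier P1" for x
    proof -
      have "f (h x) \<oplus>\<^bsub>B\<^esub> b (d x) = \<zero>\<^bsub>B\<^esub>"
        using fun_cong[OF z, of x] x * by (simp add: compose_eq)
      then have "f (h x) = \<ominus>\<^bsub>B\<^esub> b (d x)"
        using B.M.minus_equality[of "f (h x)" "b (d x)"] lhomD(1)[OF f lhomD(1)[OF *(1) x]]
          lhomD(1)[OF *(2) lhomD(1)[OF d x]] by simp
      then show ?thesis using lhomD(1)[OF d x] by simp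
    qed
    have gb: "compose (carrier P0) g ?b \<in> lhom R P0 C" by (rule compose_lhom[OF P0 b g])
    have "compose (carrier P0) g ?b (d x) = \<zero>\<^bsub>C\<^esub>" if x: "x \<in> carrier P1" for x
    proof -
      have "f (h x) \<in> f ` carrier A" using lhomD(1)[OF *(1) x] by blast
      then have "g (f (h x)) = \<zero>\<^bsub>C\<^esub>" using img by blast
      then show ?thesis using fh[OF x] lhomD(1)[OF d x] by (simp add: compose_eq)
    qed
    \<comment> \<open>On the image of \<open>d\<close> the map \<open>?b\<close> agrees with
      \<open>f\<close> after \<open>h\<close>, so \<open>g\<close> kills it there. The induced map
      on \<open>M\<close> is the one to be lifted.\<close>
    from hom_eq_zero_on_image[OF C gb this]
    obtain u where u: "u \<in> lhom R M C" "\<forall>y\<in>carrier P0. u (e y) = compose (carrier P0) g ?b y" by blast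
    obtain v where v: "v \<in> lhom R M B" "\<forall>x\<in>carrier M. g (v x) = u x" using lift[OF u(1)] by blast
    let ?ve = "compose (carrier P0) v e"
    have ve: "?ve \<in> lhom R P0 B" by (rule compose_lhom[OF P0 e v(1)])
    \<comment> \<open>Subtracting the lift leaves values in the image of \<open>f\<close> and
      changes nothing along \<open>d\<close>, because \<open>e\<close> after \<open>d\<close> is
      zero. The resulting map into \<open>A\<close> extends \<open>h\<close>.\<close>
    let ?k = "\<lambda>y\<in>carrier P0. ?b y \<ominus>\<^bsub>B\<^esub> ?ve y"
    have k: "?k \<in> lhom R P0 B" by (rule lhom_diff_closed[OF P0 B b ve])
    have "?k y \<in> f ` carrier A" if y: "y \<in> carrier P0" for y
    proof -
      note c = lhomD(1)[OF b y] lhomD(1)[OF ve y] lhomD(1)[OF e y]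
      have "g (?b y \<ominus>\<^bsub>B\<^esub> ?ve y) = g (?b y) \<ominus>\<^bsub>C\<^esub> g (?ve y)"
        by (rule lhom_diff[OF B C g c(1,2)])
      also have "g (?ve y) = g (?b y)" using u(2) v(2) y c by (simp add: compose_eq)
      finally have "g (?b y \<ominus>\<^bsub>B\<^esub> ?ve y) = \<zero>\<^bsub>C\<^esub>"
        using lhomD(1)[OF g c(1)] by (simp add: a_minus_def C.M.r_neg)
      moreover have "?b y \<ominus>\<^bsub>B\<^esub> ?ve y \<in> carrier B" using c by (intro B.M.minus_closed)
      ultimately show ?thesis unfolding img using y by simp
    qed
    from factor_inj[OF P0 A B f inj k this]
    obtain a' where a': "a' \<in> lhom R P0 A" "\<forall>y\<in>carrier P0. f (a' y) = ?k y" by blast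
    have "h = compose (carrier P1) a' d"
    proof (rule lhom_ext[OF *(1) compose_lhom[OF P1 d a'(1)]])
      fix x assume x: "x \<in> carrier P1"
      note dx = lhomD(1)[OF d x]
      have "?ve (d x) = \<zero>\<^bsub>B\<^esub>" using ed[OF x] lhom_zero[OF M B v(1)] dx by (simp add: compose_eq)
      then have "f (a' (d x)) = ?b (d x)"
        using a'(2) dx lhomD(1)[OF b dx] B.M.minus_equality[of "\<zero>\<^bsub>B\<^esub>" "\<zero>\<^bsub>B\<^esub>"] by (simp add: a_minus_def)
      then have "f (a' (d x)) = f (h x)" using fh[OF x] by simp
      then show "h x = compose (carrier P1) a' d x"
        using inj lhomD(1)[OF *(1) x] lhomD(1)[OF a'(1) dx] x by (simp add: compose_eq inj_on_def)
    qed
    then show "\<phi> h = \<zero>\<^bsub>K\<^esub>" using functional_of_vanishes[OF A \<alpha> a'(1)] by (simp add: \<phi>_def)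
  qed
  then obtain \<phi>' where \<phi>': "\<phi>' \<in> lhom K (hom_space R P1 B) (regular K)"
    and ext: "\<And>h. h \<in> lhom R P1 A \<Longrightarrow> \<phi>' (compose (carrier P1) f h) = \<phi> h"
    and van: "\<And>b. b \<in> lhom R P0 B \<Longrightarrow> \<phi>' (compose (carrier P1) b d) = \<zero>\<^bsub>K\<^esub>" by auto
  obtain \<alpha>' where \<alpha>': "\<alpha>' \<in> lhom R B \<tau>" and \<alpha>'c: "\<And>b \<psi>. b \<in> carrier B \<Longrightarrow> \<psi> \<in> lhom R P1 (regular R) \<Longrightarrow>
      \<alpha>' b (cls \<psi>) = \<phi>' (\<lambda>x\<in>carrier P1. \<psi> x \<odot>\<^bsub>B\<^esub> b)"
    using hom_of_functional[OF B \<phi>' van] by blast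
  \<comment> \<open>Functionals on \<open>Tr\<close> are compared on classes, where they are values
    of \<open>\<phi>'\<close> and \<open>\<phi>\<close> at rank one maps.\<close>
  have "\<alpha>' (f a) = \<alpha> a" if a: "a \<in> carrier A" for a
  proof (rule lhom_ext)
    note fa = lhomD(1)[OF f a]
    show "\<alpha>' (f a) \<in> lhom K (restrict_scalars R Tr) (regular K)" using lhomD(1)[OF \<alpha>' fa] by simp
    show "\<alpha> a \<in> lhom K (restrict_scalars R Tr) (regular K)" using lhomD(1)[OF \<alpha> a] by simp
    fix X assume "X \<in> carrier (restrict_scalars R Tr)"
    then have "X \<in> carrier Tr" by simp
    then obtain \<psi> where \<psi>: "\<psi> \<in> lhom R P1 (regular R)" "X = cls \<psi>" by (rule Tr_cases)
    let ?h = "\<lambda>x\<in>carrier P1. \<psi> x \<odot>\<^bsub>A\<^esub> a"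
    have h: "?h \<in> lhom R P1 A" by (rule rank_one_lhom[OF P1 A \<psi>(1) a])
    have "(\<lambda>x\<in>carrier P1. \<psi> x \<odot>\<^bsub>B\<^esub> f a) = compose (carrier P1) f ?h"
      using lhomD(1)[OF \<psi>(1)] lhomD(3)[OF f _ a] by (auto simp: compose_def fun_eq_iff)
    then have "\<alpha>' (f a) X = \<phi> ?h" using \<alpha>'c[OF fa \<psi>(1)] ext[OF h] \<psi>(2) by simp
    also have "\<dots> = \<alpha> a X" unfolding \<phi>_def using functional_of_rank_one[OF A \<alpha> \<psi>(1) a] \<psi>(2) by simp
    finally show "\<alpha>' (f a) X = \<alpha> a X" .
  qed
  then show "\<exists>\<alpha>'\<in>lhom R B \<tau>. \<forall>x\<in>carrier A. \<alpha>' (f x) = \<alpha> x" using \<alpha>' by blast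
qed

lemma lift_if_tau_injective_relative:
  assumes seq: "short_exact_modules R A B C f g"
    and ext: "injective_relative R \<tau> A B f" and u: "u \<in> lhom R M C"
  shows "\<exists>v\<in>lhom R M B. \<forall>x\<in>carrier M. g (v x) = u x"
proof -
  note A = short_exact_modulesD(1)[OF seq] and B = short_exact_modulesD(2)[OF seq]
    and C = short_exact_modulesD(3)[OF seq] and f = short_exact_modulesD(4)[OF seq]
    and g = short_exact_modulesD(5)[OF seq] and inj = short_exact_modulesD(6)[OF seq]
    and img = short_exact_modulesD(7)[OF seq] and gsurj = short_exact_modulesD(8)[OF seq]
  interpret A: left_module R A by (rule A)
  interpret B: left_module R B by (rule B)
  interpret C: left_module R C by (rule C)
  note dd = dual_basisD[OF db1]
  have HA: "left_module K (hom_space R P1 A)" by (rule left_module_hom_space[OF P1 A])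
  interpret HA: left_module K "hom_space R P1 A" by (rule HA)
  have KK: "left_module K (regular K)" by (rule left_module_regular[OF base.R.ring_axioms])
  \<comment> \<open>A lift of \<open>u\<close> after \<open>e\<close> along \<open>g\<close>. Along
    \<open>d\<close> it takes values in the kernel of \<open>g\<close>, and \<open>h\<close> below
    records it as a map into \<open>A\<close>.\<close>
  obtain b where b: "b \<in> lhom R P0 B" "\<forall>y\<in>carrier P0. g (b y) = compose (carrier P0) u e y"
    using dual_basis_lift[OF P0 db0 B C g gsurj compose_lhom[OF P0 e u]] by blast
  have bd: "compose (carrier P1) b d \<in> lhom R P1 B" by (rule compose_lhom[OF P1 d b(1)])
  have "compose (carrier P1) b d x \<in> f ` carrier A" if x: "x \<in> carrier P1" for x
  proof -
    note dx = lhomD(1)[OF d x]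
    have "g (b (d x)) = \<zero>\<^bsub>C\<^esub>"
      using b(2) dx ed[OF x] lhom_zero[OF M C u] by (simp add: compose_eq)
    then show ?thesis using img lhomD(1)[OF b(1) dx] x by (simp add: compose_eq)
  qed
  from factor_inj[OF P1 A B f inj bd this]
  obtain h where h: "h \<in> lhom R P1 A" "\<forall>x\<in>carrier P1. f (h x) = compose (carrier P1) b d x" by blast
  \<comment> \<open>Modulo the maps that extend over \<open>P0\<close>, \<open>h\<close> is the
    obstruction to lifting \<open>u\<close>.\<close>
  have "\<exists>a\<in>lhom R P0 A. h = compose (carrier P1) a d"
  proof (rule ccontr)
    assume nh: "\<not> ?thesis"
    let ?s = "\<lambda>c\<in>carrier K. c \<odot>\<^bsub>hom_space R P1 A\<^esub> h" and ?t = "\<lambda>a\<in>lhom R P0 A. compose (carrier P1) a d"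
    have hH: "h \<in> carrier (hom_space R P1 A)" using h(1) by simp
    \<comment> \<open>If the obstruction is not trivial, a functional takes the value one at
      \<open>h\<close> and zero on all maps extending over \<open>P0\<close>. The map
      \<open>?s\<close> parametrizes the line through \<open>h\<close>, and the identity of
      \<open>K\<close> is prescribed on it.\<close>
    have "\<exists>\<phi>\<in>lhom K (hom_space R P1 A) (regular K).
        (\<forall>c\<in>carrier (regular K). \<phi> (?s c) = (\<lambda>c\<in>carrier (regular K). c) c) \<and>
        (\<forall>a\<in>carrier (hom_space R P0 A). \<phi> (?t a) = \<zero>\<^bsub>K\<^esub>)"
    proof (rule extend_functional_along[OF K.field_axioms HA KK left_module_hom_space[OF P0 A]
          scaling_lhom[OF HA hH] hom_space_precompose[OF P1 P0 A d] id_lhom[OF KK]])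
      fix c a assume "c \<in> carrier (regular K)" "a \<in> carrier (hom_space R P0 A)"
        and z: "?s c \<oplus>\<^bsub>hom_space R P1 A\<^esub> ?t a = \<zero>\<^bsub>hom_space R P1 A\<^esub>"
      then have *: "a \<in> lhom R P0 A" "c \<in> carrier K" by simp_all
      have "c = \<zero>\<^bsub>K\<^esub>"
      proof (rule ccontr)
        assume "c \<noteq> \<zero>\<^bsub>K\<^esub>"
        then have i: "inv\<^bsub>K\<^esub> c \<in> carrier K" "inv\<^bsub>K\<^esub> c \<otimes>\<^bsub>K\<^esub> c = \<one>\<^bsub>K\<^esub>"
          using *(2) K.field_Units by (auto simp: base.R.Units_inv_closed base.R.Units_l_inv)
        \<comment> \<open>Minus the inverse of \<open>c\<close>: multiplying the relation between
          \<open>h\<close> and \<open>a\<close> by it exhibits \<open>h\<close> as a map that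
          extends over \<open>P0\<close>, a contradiction.\<close>
        let ?i = "\<ominus>\<^bsub>K\<^esub> (inv\<^bsub>K\<^esub> c)"
        have ic: "?i \<in> carrier K" using i by simp
        let ?a = "\<lambda>y\<in>carrier P0. scalar ?i \<odot>\<^bsub>A\<^esub> a y"
        have a: "?a \<in> lhom R P0 A" by (rule lhom_scalar_closed[OF P0 A *(1) ic])
        have "h = compose (carrier P1) ?a d"
        proof (rule lhom_ext[OF h(1) compose_lhom[OF P1 d a]])
          fix x assume x: "x \<in> carrier P1"
          note y = lhomD(1)[OF d x] lhomD(1)[OF h(1) x]
          note y' = lhomD(1)[OF *(1) y(1)]
          have "a (d x) \<oplus>\<^bsub>A\<^esub> scalar c \<odot>\<^bsub>A\<^esub> h x = \<zero>\<^bsub>A\<^esub>"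
            using fun_cong[OF z, of x] x y y' * by (simp add: compose_eq A.M.a_comm A.smult_closed)
          then have "scalar ?i \<odot>\<^bsub>A\<^esub> a (d x) \<oplus>\<^bsub>A\<^esub> scalar ?i \<odot>\<^bsub>A\<^esub> (scalar c \<odot>\<^bsub>A\<^esub> h x) = \<zero>\<^bsub>A\<^esub>"
            using A.smult_r_distr[of "scalar ?i" "a (d x)" "scalar c \<odot>\<^bsub>A\<^esub> h x"] y y' ic *(2)
            by (simp add: A.smult_closed A.smult_r_null)
          moreover have "scalar ?i \<odot>\<^bsub>A\<^esub> (scalar c \<odot>\<^bsub>A\<^esub> h x) = \<ominus>\<^bsub>A\<^esub> h x"
          proof -
            have "scalar ?i \<odot>\<^bsub>A\<^esub> (scalar c \<odot>\<^bsub>A\<^esub> h x) = scalar (?i \<otimes>\<^bsub>K\<^esub> c) \<odot>\<^bsub>A\<^esub> h x"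
              using y ic *(2) by (simp add: scalar_mult A.smult_assoc)
            also have "?i \<otimes>\<^bsub>K\<^esub> c = \<ominus>\<^bsub>K\<^esub> \<one>\<^bsub>K\<^esub>" using i *(2) by (simp add: base.R.l_minus)
            also have "scalar (\<ominus>\<^bsub>K\<^esub> \<one>\<^bsub>K\<^esub>) = \<ominus>\<^bsub>R\<^esub> \<one>\<^bsub>R\<^esub>" by (simp add: base.smult_l_minus)
            finally show ?thesis using A.smult_minus_one[OF y(2)] by simp
          qed
          ultimately have "scalar ?i \<odot>\<^bsub>A\<^esub> a (d x) \<ominus>\<^bsub>A\<^esub> h x = \<zero>\<^bsub>A\<^esub>" by (simp add: a_minus_def)
          then have "scalar ?i \<odot>\<^bsub>A\<^esub> a (d x) = h x"
            using y y' ic by (simp add: A.M.right_minus_eq A.smult_closed)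
          then show "h x = compose (carrier P1) ?a d x" using x y by (simp add: compose_eq)
        qed
        then show False using nh a by blast
      qed
      then show "(\<lambda>c\<in>carrier (regular K). c) c = \<zero>\<^bsub>K\<^esub>" by simp
    qed
    then obtain \<phi> where \<phi>: "\<phi> \<in> lhom K (hom_space R P1 A) (regular K)"
      and \<phi>s: "\<phi> (\<one>\<^bsub>K\<^esub> \<odot>\<^bsub>hom_space R P1 A\<^esub> h) = \<one>\<^bsub>K\<^esub>"
      and van: "\<And>a. a \<in> lhom R P0 A \<Longrightarrow> \<phi> (compose (carrier P1) a d) = \<zero>\<^bsub>K\<^esub>" by force
    have \<phi>h: "\<phi> h = \<one>\<^bsub>K\<^esub>" using \<phi>s HA.smult_one[OF hH] by simp
    obtain \<alpha> where \<alpha>: "\<alpha> \<in> lhom R A \<tau>" and \<alpha>c: "\<And>a \<psi>. a \<in> carrier A \<Longrightarrow> \<psi> \<in> lhom R P1 (regular R) \<Longrightarrow>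
        \<alpha> a (cls \<psi>) = \<phi> (\<lambda>x\<in>carrier P1. \<psi> x \<odot>\<^bsub>A\<^esub> a)"
      using hom_of_functional[OF A \<phi> van] by blast
    obtain \<alpha>' where \<alpha>': "\<alpha>' \<in> lhom R B \<tau>" "\<forall>x\<in>carrier A. \<alpha>' (f x) = \<alpha> x"
      using ext \<alpha> unfolding injective_relative_def by blast
    let ?t = "\<lambda>i. \<lambda>x\<in>carrier P1. \<xi> i x \<odot>\<^bsub>A\<^esub> h (p i)"
    have hp: "h (p i) \<in> carrier A" if "i \<in> I" for i using lhomD(1)[OF h(1) dd(2)[OF that]] .
    have t: "?t i \<in> lhom R P1 A" if "i \<in> I" for i
      by (rule rank_one_lhom[OF P1 A dd(3)[OF that] hp[OF that]])
    \<comment> \<open>Expanding \<open>h\<close> into rank one maps turns \<open>\<phi> h\<close>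
      into the functional of \<open>\<alpha>'\<close> at \<open>b\<close> after \<open>d\<close>.
      That map extends over \<open>P0\<close>, so the value is zero.\<close>
    have "\<one>\<^bsub>K\<^esub> = \<phi> (\<Oplus>\<^bsub>hom_space R P1 A\<^esub>i\<in>I. (?t i))"
      using \<phi>h rank_one_decomposition[OF P1 A db1 h(1)] by simp
    also have "\<dots> = (\<Oplus>\<^bsub>regular K\<^esub>i\<in>I. \<phi> (?t i))"
      by (rule lhom_finsum[OF HA KK \<phi> dd(1)]) (use t in auto)
    also have "\<dots> = (\<Oplus>\<^bsub>K\<^esub>i\<in>I. \<phi> (?t i))" by (rule finsum_regular)
    also have "\<dots> = (\<Oplus>\<^bsub>K\<^esub>i\<in>I. \<alpha>' (compose (carrier P1) b d (p i)) (cls (\<xi> i)))"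
    proof (rule base.R.finsum_cong')
      show "(\<lambda>i. \<alpha>' (compose (carrier P1) b d (p i)) (cls (\<xi> i))) \<in> I \<rightarrow> carrier K"
        using pairing(1)[OF B \<alpha>'(1) lhomD(1)[OF bd dd(2)] cls(1)[OF dd(3)]] by auto
      fix i assume i: "i \<in> I"
      have "\<phi> (?t i) = \<alpha> (h (p i)) (cls (\<xi> i))" using \<alpha>c[OF hp[OF i] dd(3)[OF i]] by simp
      also have "\<dots> = \<alpha>' (f (h (p i))) (cls (\<xi> i))" using \<alpha>'(2) hp[OF i] by simp
      also have "f (h (p i)) = compose (carrier P1) b d (p i)" using h(2) dd(2)[OF i] by simp
      finally show "\<phi> (?t i) = \<alpha>' (compose (carrier P1) b d (p i)) (cls (\<xi> i))" .
    qed simp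
    also have "\<dots> = functional_of B \<alpha>' (compose (carrier P1) b d)"
      using bd by (simp add: functional_of_def)
    also have "\<dots> = \<zero>\<^bsub>K\<^esub>" by (rule functional_of_vanishes[OF B \<alpha>'(1) b(1)])
    finally show False using K.one_not_zero by simp
  qed
  then obtain a where a: "a \<in> lhom R P0 A" "h = compose (carrier P1) a d" by blast
  let ?fa = "compose (carrier P0) f a"
  have fa: "?fa \<in> lhom R P0 B" by (rule compose_lhom[OF P0 a(1) f])
  \<comment> \<open>The correction by \<open>f\<close> after \<open>a\<close> is invisible to
    \<open>g\<close> and makes the map vanish on the image of \<open>d\<close>, so that it descends
    to \<open>M\<close>.\<close>
  let ?k = "\<lambda>y\<in>carrier P0. b y \<ominus>\<^bsub>B\<^esub> ?fa y"
  have k: "?k \<in> lhom R P0 B" by (rule lhom_diff_closed[OF P0 B b(1) fa])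
  have "?k (d x) = \<zero>\<^bsub>B\<^esub>" if x: "x \<in> carrier P1" for x
  proof -
    note dx = lhomD(1)[OF d x]
    have "?fa (d x) = b (d x)" using h(2) a(2) x dx by (auto simp: compose_eq)
    then show ?thesis using dx lhomD(1)[OF b(1) dx] by (simp add: a_minus_def B.M.r_neg)
  qed
  from hom_eq_zero_on_image[OF B k this]
  obtain v where v: "v \<in> lhom R M B" "\<forall>y\<in>carrier P0. v (e y) = ?k y" by blast
  have "g (v x) = u x" if "x \<in> carrier M" for x
  proof -
    from that have "x \<in> e ` carrier P0" using e_surj by simp
    then obtain y where y: "y \<in> carrier P0" "x = e y" by blast
    note c = lhomD(1)[OF b(1) y(1)] lhomD(1)[OF fa y(1)] lhomD(1)[OF a(1) y(1)]
    have "f (a y) \<in> f ` carrier A" using c(3) by blast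
    then have 0: "g (?fa y) = \<zero>\<^bsub>C\<^esub>" using img y(1) by (simp add: compose_eq)
    have "g (v x) = g (b y \<ominus>\<^bsub>B\<^esub> ?fa y)" using v(2) y by simp
    also have "\<dots> = g (b y) \<ominus>\<^bsub>C\<^esub> \<zero>\<^bsub>C\<^esub>" using lhom_diff[OF B C g c(1,2)] 0 by simp
    also have "\<dots> = g (b y)"
      using lhomD(1)[OF g c(1)] C.M.minus_equality[of "\<zero>\<^bsub>C\<^esub>" "\<zero>\<^bsub>C\<^esub>"] by (simp add: a_minus_def)
    also have "\<dots> = u x" using b(2) y by (simp add: compose_eq)
    finally show ?thesis .
  qed
  then show ?thesis using v(1) by blast
qed

end

section \<open>Pure-injective modules\<close>

lemma pure_exact_lift:
  assumes "pure_exact R S A B C f g" "M \<in> S" "u \<in> lhom R M C"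
  shows "\<exists>v\<in>lhom R M B. \<forall>x\<in>carrier M. g (v x) = u x"
proof -
  have "compose (carrier M) g ` lhom R M B = lhom R M C"
    using assms(1,2) by (auto simp: pure_exact_def short_exact_def lhom_group_def)
  then have "u \<in> compose (carrier M) g ` lhom R M B" using assms(3) by simp
  then obtain v where "v \<in> lhom R M B" "u = compose (carrier M) g v" by blast
  then show ?thesis by (intro bexI[of _ v]) (auto simp: compose_eq)
qed

text \<open>Hom(M, -) is left exact, so surjectivity onto Hom(M, C) is all that purity adds to
  exactness.\<close>

lemma pure_exactI:
  assumes seq: "short_exact_modules R A B C f g" and S: "\<And>M. M \<in> S \<Longrightarrow> left_module R M"
    and lift: "\<And>M u. \<lbrakk>M \<in> S; u \<in> lhom R M C\<rbrakk> \<Longrightarrow> \<exists>v\<in>lhom R M B. \<forall>x\<in>carrier M. g (v x) = u x"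
  shows "pure_exact R S A B C f g"
  unfolding pure_exact_def
proof (intro conjI ballI)
  note A = short_exact_modulesD(1)[OF seq] and B = short_exact_modulesD(2)[OF seq]
    and C = short_exact_modulesD(3)[OF seq] and f = short_exact_modulesD(4)[OF seq]
    and g = short_exact_modulesD(5)[OF seq] and inj = short_exact_modulesD(6)[OF seq]
    and img = short_exact_modulesD(7)[OF seq]
  show "short_exact_modules R A B C f g" by (fact seq)
  fix M assume "M \<in> S"
  note M = S[OF this] and lift = lift[OF this]
  have "inj_on (compose (carrier M) f) (lhom R M A)"
  proof (rule inj_onI)
    fix h k assume hk: "h \<in> lhom R M A" "k \<in> lhom R M A" "compose (carrier M) f h = compose (carrier M) f k"
    show "h = k"
    proof (rule lhom_ext[OF hk(1,2)])
      fix x assume x: "x \<in> carrier M"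
      then have "f (h x) = f (k x)" using fun_cong[OF hk(3), of x] by (simp add: compose_eq)
      then show "h x = k x" using inj lhomD(1)[OF hk(1) x] lhomD(1)[OF hk(2) x] by (auto dest: inj_onD)
    qed
  qed
  moreover have "compose (carrier M) f ` lhom R M A =
      {b \<in> lhom R M B. compose (carrier M) g b = (\<lambda>x\<in>carrier M. \<zero>\<^bsub>C\<^esub>)}"
  proof (intro equalityI subsetI)
    fix b assume "b \<in> compose (carrier M) f ` lhom R M A"
    then obtain h where h: "h \<in> lhom R M A" "b = compose (carrier M) f h" by blast
    have "g (f (h x)) = \<zero>\<^bsub>C\<^esub>" if "x \<in> carrier M" for x
      using img lhomD(1)[OF h(1) that] by blast
    then show "b \<in> {b \<in> lhom R M B. compose (carrier M) g b = (\<lambda>x\<in>carrier M. \<zero>\<^bsub>C\<^esub>)}"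
      using compose_lhom[OF M h(1) f] by (auto simp: h(2) compose_eq intro!: extensionalityI[of _ "carrier M"])
  next
    fix b assume "b \<in> {b \<in> lhom R M B. compose (carrier M) g b = (\<lambda>x\<in>carrier M. \<zero>\<^bsub>C\<^esub>)}"
    then have b: "b \<in> lhom R M B" and gb: "compose (carrier M) g b = (\<lambda>x\<in>carrier M. \<zero>\<^bsub>C\<^esub>)" by auto
    have "b x \<in> f ` carrier A" if x: "x \<in> carrier M" for x
      using fun_cong[OF gb, of x] x img lhomD(1)[OF b x] by (simp add: compose_eq)
    from factor_inj[OF M A B f inj b this]
    obtain h where h: "h \<in> lhom R M A" "\<forall>x\<in>carrier M. f (h x) = b x" by blast
    have "b = compose (carrier M) f h"
      by (rule lhom_ext[OF b compose_lhom[OF M h(1) f]]) (use h in \<open>simp add: compose_eq\<close>)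
    then show "b \<in> compose (carrier M) f ` lhom R M A" using h(1) by blast
  qed
  moreover have "compose (carrier M) g ` lhom R M B = lhom R M C"
  proof (intro equalityI subsetI)
    fix u assume "u \<in> compose (carrier M) g ` lhom R M B"
    then show "u \<in> lhom R M C" using compose_lhom[OF M _ g] by blast
  next
    fix u assume u: "u \<in> lhom R M C"
    obtain v where v: "v \<in> lhom R M B" "\<forall>x\<in>carrier M. g (v x) = u x" using lift[OF u] by blast
    have "u = compose (carrier M) g v"
      by (rule lhom_ext[OF u compose_lhom[OF M v(1) g]]) (use v in \<open>simp add: compose_eq\<close>)
    then show "u \<in> compose (carrier M) g ` lhom R M B" using v(1) by blast
  qed
  ultimately show "short_exact (lhom_group R M A) (lhom_group R M B) (lhom_group R M C)
      (compose (carrier M) f) (compose (carrier M) g)"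
    by (simp add: short_exact_def lhom_group_def)
qed

section \<open>Retracts of injective modules and indecomposability\<close>

lemma injective_relative_retract:
  assumes E: "left_module R E" and B: "left_module R B" and A: "left_module R A"
    and s: "s \<in> lhom R Q E" and r: "r \<in> lhom R E Q" and rs: "\<And>x. x \<in> carrier Q \<Longrightarrow> r (s x) = x"
    and f: "f \<in> lhom R A B" and inj: "injective_relative R E A B f"
  shows "injective_relative R Q A B f"
  unfolding injective_relative_def
proof
  fix h assume h: "h \<in> lhom R A Q"
  obtain h' where h': "h' \<in> lhom R B E" "\<forall>x\<in>carrier A. h' (f x) = compose (carrier A) s h x"
    using inj compose_lhom[OF A h s] unfolding injective_relative_def by blast
  have "r (h' (f x)) = h x" if "x \<in> carrier A" for x
    using h'(2) that rs[OF lhomD(1)[OF h that]] by (simp add: compose_eq)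
  then show "\<exists>h'\<in>lhom R B Q. \<forall>x\<in>carrier A. h' (f x) = h x"
    using compose_lhom[OF B h'(1) r] f by (intro bexI[of _ "compose (carrier B) r h'"]) (auto simp: compose_eq lhomD(1))
qed

lemma injective_retract:
  assumes E: "injective U R E" and Q: "left_module R Q"
    and s: "s \<in> lhom R Q E" and r: "r \<in> lhom R E Q" and rs: "\<And>x. x \<in> carrier Q \<Longrightarrow> r (s x) = x"
  shows "injective U R Q"
  unfolding injective_def
proof (intro conjI allI impI Q)
  fix A B C f g assume seq: "short_exact_modules R (A :: (_, 'a) module) (B :: (_, 'a) module) (C :: (_, 'a) module) f g"
  then have "injective_relative R E A B f" using E unfolding injective_def by blast
  then show "injective_relative R Q A B f"
    using injective_relative_retract[OF _ short_exact_modulesD(2,1)[OF seq] s r rs short_exact_modulesD(4)[OF seq]] E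
    unfolding injective_def by blast
qed

lemma internal_direct_sum_commute:
  assumes M: "left_module R M" and "internal_direct_sum R M A B"
  shows "internal_direct_sum R M B A"
proof -
  interpret M: left_module R M by fact
  have A: "submodule A R M" and B: "submodule B R M"
    using assms by (auto simp: internal_direct_sum_def)
  have "X <+>\<^bsub>M\<^esub> Y \<subseteq> Y <+>\<^bsub>M\<^esub> X" if XY: "X \<subseteq> carrier M" "Y \<subseteq> carrier M" for X Y
  proof
    fix z assume "z \<in> X <+>\<^bsub>M\<^esub> Y"
    then obtain x y where z: "x \<in> X" "y \<in> Y" "z = x \<oplus>\<^bsub>M\<^esub> y" by (auto simp: set_add_def')
    then have "z = y \<oplus>\<^bsub>M\<^esub> x" using XY by (auto intro: M.M.a_comm)
    then show "z \<in> Y <+>\<^bsub>M\<^esub> X" using z by (auto simp: set_add_def')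
  qed
  then have "B <+>\<^bsub>M\<^esub> A = A <+>\<^bsub>M\<^esub> B"
    using submoduleD(5)[OF A] submoduleD(5)[OF B] by (intro equalityI)
  then show ?thesis using assms by (auto simp: internal_direct_sum_def)
qed

text \<open>Among the retracts of \<^term>\<open>D\<close> in which the image of \<^term>\<open>x\<close> survives, one of least
  length is indecomposable.\<close>

lemma indecomposable_retract:
  assumes D: "left_module R D" and inj: "injective U R D" and fl: "finite_length R D"
    and N: "left_module R N" and x: "x \<in> carrier N" and h: "h \<in> lhom R N D" and hx: "h x \<noteq> \<zero>\<^bsub>D\<^esub>"
  shows "\<exists>Q h'. indecomposable R (D\<lparr>carrier := Q\<rparr>) \<and> injective U R (D\<lparr>carrier := Q\<rparr>) \<and>
    h' \<in> lhom R N (D\<lparr>carrier := Q\<rparr>) \<and> h' x \<noteq> \<zero>\<^bsub>D\<^esub>"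
proof -
  interpret D: left_module R D by fact
  obtain \<mu> :: "_ set \<Rightarrow> nat" where \<mu>: "\<And>W W'. submodule W R D \<Longrightarrow> submodule W' R D \<Longrightarrow> W \<subset> W' \<Longrightarrow> \<mu> W < \<mu> W'"
    by (rule finite_lengthE[OF fl]) blast
  define ok where "ok Q \<longleftrightarrow> submodule Q R D \<and> (\<exists>r\<in>lhom R D (D\<lparr>carrier := Q\<rparr>). \<forall>y\<in>Q. r y = y) \<and>
    (\<exists>h\<in>lhom R N (D\<lparr>carrier := Q\<rparr>). h x \<noteq> \<zero>\<^bsub>D\<^esub>)" for Q
  have "ok (carrier D)"
    unfolding ok_def using D.submodule_carrier h hx
    by (auto intro!: bexI[of _ "\<lambda>y\<in>carrier D. y"] id_lhom[OF D])
  then obtain Q where okQ: "ok Q" and min: "\<And>Q'. ok Q' \<Longrightarrow> \<mu> Q \<le> \<mu> Q'"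
    using ex_has_least_nat[of ok _ \<mu>] by blast
  let ?E = "D\<lparr>carrier := Q\<rparr>"
  have Q: "submodule Q R D" using okQ unfolding ok_def by blast
  obtain r where r: "r \<in> lhom R D ?E" "\<forall>y\<in>Q. r y = y" using okQ unfolding ok_def by blast
  obtain h' where h': "h' \<in> lhom R N ?E" "h' x \<noteq> \<zero>\<^bsub>D\<^esub>" using okQ unfolding ok_def by blast
  have E: "left_module R ?E" by (rule left_module_submodule[OF D Q])
  have h'x: "h' x \<in> Q" using lhomD(1)[OF h'(1) x] by simp
  have inc: "(\<lambda>y\<in>Q. y) \<in> lhom R ?E D" by (rule inclusion_lhom[OF D Q])
  \<comment> \<open>If the projection to \<open>A\<close> still detects \<open>x\<close> and the
    complement \<open>B\<close> is not zero, then \<open>A\<close> is a strictly smaller admissible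
    retract of \<open>D\<close>.\<close>
  have key: "B = {\<zero>\<^bsub>D\<^esub>}" if AB: "internal_direct_sum R ?E A B" and p: "p \<in> lhom R ?E (?E\<lparr>carrier := A\<rparr>)"
    "\<forall>a\<in>A. p a = a" "p (h' x) \<noteq> \<zero>\<^bsub>D\<^esub>" for A B p
  proof (rule ccontr)
    assume nB: "B \<noteq> {\<zero>\<^bsub>D\<^esub>}"
    have A: "submodule A R ?E" "submodule B R ?E" "A \<inter> B = {\<zero>\<^bsub>D\<^esub>}"
      using AB by (auto simp: internal_direct_sum_def)
    then have AD: "submodule A R D" "A \<subseteq> Q" "B \<subseteq> Q" "\<zero>\<^bsub>D\<^esub> \<in> B"
      using submodule_submodule_iff[OF D Q] submoduleD(2)[OF A(2)] by auto
    have pA: "p \<in> lhom R ?E (D\<lparr>carrier := A\<rparr>)" using p(1) by simp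
    have "compose (carrier D) p r \<in> lhom R D (D\<lparr>carrier := A\<rparr>)" by (rule compose_lhom[OF D r(1) pA])
    moreover have "\<forall>y\<in>A. compose (carrier D) p r y = y"
      using r(2) p(2) AD submoduleD(1)[OF AD(1)] by (auto simp: compose_eq)
    moreover have "compose (carrier N) p h' \<in> lhom R N (D\<lparr>carrier := A\<rparr>)" by (rule compose_lhom[OF N h'(1) pA])
    moreover have "compose (carrier N) p h' x \<noteq> \<zero>\<^bsub>D\<^esub>" using p(3) x by (simp add: compose_eq)
    ultimately have "ok A" unfolding ok_def using AD(1) by blast
    moreover have "A \<subset> Q" using A(3) nB AD by blast
    ultimately show False using \<mu>[OF AD(1) Q] min[of A] by simp
  qed
  have "indecomposable R ?E"
    unfolding indecomposable_def
  proof (intro conjI allI impI)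
    show "carrier ?E \<noteq> {\<zero>\<^bsub>?E\<^esub>}" using h'x h'(2) by auto
    fix A B assume AB: "internal_direct_sum R ?E A B"
    note BA = internal_direct_sum_commute[OF E AB]
    obtain p where p: "p \<in> lhom R ?E (?E\<lparr>carrier := A\<rparr>)" "\<forall>a\<in>A. p a = a"
      "\<forall>y\<in>carrier ?E. \<exists>b\<in>B. y = p y \<oplus>\<^bsub>?E\<^esub> b"
      using internal_direct_sum_projection[OF E AB] by blast
    obtain p' where p': "p' \<in> lhom R ?E (?E\<lparr>carrier := B\<rparr>)" "\<forall>a\<in>B. p' a = a"
      using internal_direct_sum_projection[OF E BA] by blast
    show "A = {\<zero>\<^bsub>?E\<^esub>} \<or> B = {\<zero>\<^bsub>?E\<^esub>}"
    proof (cases "p (h' x) = \<zero>\<^bsub>D\<^esub>")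
      case False
      then show ?thesis using key[OF AB p(1,2)] by simp
    next
      case True
      \<comment> \<open>When the projection to \<open>A\<close> kills \<open>h' x\<close>, that
        element lies in \<open>B\<close>, and the projection to \<open>B\<close> detects
        \<open>x\<close> instead.\<close>
      obtain b where b: "b \<in> B" "h' x = p (h' x) \<oplus>\<^bsub>D\<^esub> b" using p(3) h'x by auto
      have "b \<in> carrier D" using b(1) AB Q
        by (auto simp: internal_direct_sum_def dest!: submoduleD(1)) (use submoduleD(1)[OF Q] in auto)
      then have "h' x \<in> B" using b True by simp
      then have "p' (h' x) \<noteq> \<zero>\<^bsub>D\<^esub>" using p'(2) h'(2) by simp
      then show ?thesis using key[OF BA p'(1,2)] by simp
    qed
  qed
  moreover have "injective U R ?E"
    by (rule injective_retract[OF inj E inc r(1)]) (use r(2) in simp)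
  ultimately show ?thesis using h' by blast
qed

section \<open>The injective cogenerator Hom(R, K)\<close>

context fin_dim_algebra
begin

lemma left_module_right_regular: "left_module (opposite R) (regular (opposite R))"
  by (rule left_module_regular[OF ring_opposite[OF R.ring_axioms]])

text \<open>\<^term>\<open>regular (opposite R)\<close> is \<^term>\<open>R\<close> as a right module, so this is \<open>Hom(R, K)\<close>.\<close>

abbreviation "DR \<equiv> field_dual K R (regular (opposite R))"

lemma left_module_DR: "left_module R DR"
  by (rule left_module_field_dual[OF left_module_right_regular])

text \<open>One direction of the adjunction between Hom_K(N, K) and Hom_R(N, Hom_K(R, K));
  evaluation at the unit is the other.\<close>

lemma coinduced_hom:
  assumes N: "left_module R N" and l: "l \<in> lhom K (restrict_scalars R N) (regular K)"
  shows "(\<lambda>y\<in>carrier N. \<lambda>r\<in>carrier R. l (r \<odot>\<^bsub>N\<^esub> y)) \<in> lhom R N DR"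
proof (rule lhomI)
  interpret N: left_module R N by fact
  note D = lhomD[OF l, simplified]
  have KR: "left_module K (restrict_scalars R (regular (opposite R)))"
    by (rule left_module_restrict_scalars_right[OF left_module_right_regular])
  fix y assume y: "y \<in> carrier N"
  have "restrict (\<lambda>r. l (r \<odot>\<^bsub>N\<^esub> y)) (carrier (restrict_scalars R (regular (opposite R))))
      \<in> lhom K (restrict_scalars R (regular (opposite R))) (regular K)"
    by (rule lhomI)
      (use KR y D N.smult_closed N.smult_l_distr N.smult_assoc scalar_commute in auto)
  then show "(\<lambda>r\<in>carrier R. l (r \<odot>\<^bsub>N\<^esub> y)) \<in> carrier DR" by simp
  show "(\<lambda>r\<in>carrier R. l (r \<odot>\<^bsub>N\<^esub> (y \<oplus>\<^bsub>N\<^esub> z))) = (\<lambda>r\<in>carrier R. l (r \<odot>\<^bsub>N\<^esub> y)) \<oplus>\<^bsub>DR\<^esub> (\<lambda>r\<in>carrier R. l (r \<odot>\<^bsub>N\<^esub> z))"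
    if "z \<in> carrier N" for z
    using y that D N.smult_closed N.smult_r_distr by (auto simp: fun_eq_iff)
  show "(\<lambda>r\<in>carrier R. l (r \<odot>\<^bsub>N\<^esub> (s \<odot>\<^bsub>N\<^esub> y))) = s \<odot>\<^bsub>DR\<^esub> (\<lambda>r\<in>carrier R. l (r \<odot>\<^bsub>N\<^esub> y))"
    if "s \<in> carrier R" for s
    using y that N.smult_assoc by (auto simp: fun_eq_iff)
qed fact

text \<open>A homomorphism into \<open>DR\<close> is determined by its values at the unit, which
  form a \<open>K\<close>-linear functional. Over a field this functional extends along
  \<open>f\<close>, and the extension coinduces a homomorphism on \<open>B\<close>.\<close>

lemma injective_DR: "injective U R DR"
  unfolding injective_def
proof (intro conjI allI impI left_module_DR)
  fix A B C f g assume seq: "short_exact_modules R (A :: (_, 'a) module) (B :: (_, 'a) module) (C :: (_, 'a) module) f g"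
  note A = short_exact_modulesD(1)[OF seq] and B = short_exact_modulesD(2)[OF seq]
    and f = short_exact_modulesD(4)[OF seq] and inj = short_exact_modulesD(6)[OF seq]
  interpret A: left_module R A by (rule A)
  interpret B: left_module R B by (rule B)
  have KB: "left_module K (restrict_scalars R B)" by (rule left_module_restrict_scalars[OF B])
  show "injective_relative R DR A B f"
    unfolding injective_relative_def
  proof
    fix h assume h: "h \<in> lhom R A DR"
    have hc: "h a r \<in> carrier K" if "a \<in> carrier A" "r \<in> carrier R" for a r
    proof -
      have "h a \<in> lhom K (restrict_scalars R (regular (opposite R))) (regular K)"
        using lhomD(1)[OF h that(1)] by simp
      from lhomD(1)[OF this, of r] show ?thesis using that(2) by simp
    qed
    have ha: "h (a \<oplus>\<^bsub>A\<^esub> b) r = h a r \<oplus>\<^bsub>K\<^esub> h b r" if "a \<in> carrier A" "b \<in> carrier A" "r \<in> carrier R" for a b r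
      using lhomD(2)[OF h that(1,2)] that(3) by simp
    have hs: "h (s \<odot>\<^bsub>A\<^esub> a) r = h a (r \<otimes>\<^bsub>R\<^esub> s)" if "a \<in> carrier A" "s \<in> carrier R" "r \<in> carrier R" for a r s
      using lhomD(3)[OF h that(2,1)] that(3) by simp
    have hk: "h a (scalar c) = c \<otimes>\<^bsub>K\<^esub> h a \<one>\<^bsub>R\<^esub>" if "a \<in> carrier A" "c \<in> carrier K" for a c
    proof -
      have "h a \<in> lhom K (restrict_scalars R (regular (opposite R))) (regular K)"
        using lhomD(1)[OF h that(1)] by simp
      from lhomD(3)[OF this that(2), of "\<one>\<^bsub>R\<^esub>"] show ?thesis using that(2) by simp
    qed
    have KA: "left_module K (restrict_scalars R A)" by (rule left_module_restrict_scalars[OF A])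
    have "restrict (\<lambda>a. h a \<one>\<^bsub>R\<^esub>) (carrier (restrict_scalars R A)) \<in> lhom K (restrict_scalars R A) (regular K)"
      by (rule lhomI) (use KA hc ha hs hk in auto)
    note hl = this
    have h0: "h a \<one>\<^bsub>R\<^esub> = \<zero>\<^bsub>K\<^esub>" if "a \<in> carrier A" "f a = \<zero>\<^bsub>B\<^esub>" for a
    proof -
      have "a = \<zero>\<^bsub>A\<^esub>" using inj lhom_zero[OF A B f] that by (metis A.M.zero_closed inj_onD)
      then show ?thesis using lhom_zero[OF A left_module_DR h] by simp
    qed
    have "\<exists>l\<in>lhom K (restrict_scalars R B) (regular K). \<forall>a\<in>carrier (restrict_scalars R A).
        l (f a) = restrict (\<lambda>a. h a \<one>\<^bsub>R\<^esub>) (carrier (restrict_scalars R A)) a"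
      by (rule extend_functional_kernel[OF K.field_axioms KB KA lhom_restrict_scalars[OF A f] hl])
        (simp add: h0)
    then obtain l where l: "l \<in> lhom K (restrict_scalars R B) (regular K)"
      "\<And>a. a \<in> carrier A \<Longrightarrow> l (f a) = h a \<one>\<^bsub>R\<^esub>" by auto
    have "(\<lambda>y\<in>carrier B. \<lambda>r\<in>carrier R. l (r \<odot>\<^bsub>B\<^esub> y)) (f a) = h a" if a: "a \<in> carrier A" for a
    proof -
      have "h a \<in> extensional (carrier R)" using lhomD(1)[OF h a] lhomD(4) by force
      moreover have "l (r \<odot>\<^bsub>B\<^esub> f a) = h a r" if r: "r \<in> carrier R" for r
      proof -
        have "l (r \<odot>\<^bsub>B\<^esub> f a) = l (f (r \<odot>\<^bsub>A\<^esub> a))" using lhomD(3)[OF f r a] by simp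
        also have "\<dots> = h a r" using l(2)[of "r \<odot>\<^bsub>A\<^esub> a"] hs[OF a r, of "\<one>\<^bsub>R\<^esub>"] a r A.smult_closed by simp
        finally show ?thesis .
      qed
      ultimately show ?thesis using lhomD(1)[OF f a] by (auto simp: fun_eq_iff extensional_def)
    qed
    then show "\<exists>h'\<in>lhom R B DR. \<forall>x\<in>carrier A. h' (f x) = h x" using coinduced_hom[OF B l(1)] by blast
  qed
qed

lemma DR_cogenerator:
  assumes N: "left_module R N" and x: "x \<in> carrier N" "x \<noteq> \<zero>\<^bsub>N\<^esub>"
  shows "\<exists>h\<in>lhom R N DR. h x \<noteq> \<zero>\<^bsub>DR\<^esub>"
proof -
  interpret N: left_module R N by fact
  have KN: "left_module K (restrict_scalars R N)" by (rule left_module_restrict_scalars[OF N])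
  interpret KN: left_module K "restrict_scalars R N" by (rule KN)
  have KK: "left_module K (regular K)" by (rule left_module_regular[OF base.R.ring_axioms])
  have xN: "x \<in> carrier (restrict_scalars R N)" using x(1) by simp
  \<comment> \<open>Makes the functional sending each scalar multiple of \<open>x\<close> to its
    scalar well defined; it then extends to all of \<open>N\<close> and has value one at
    \<open>x\<close>.\<close>
  have "a = \<zero>\<^bsub>K\<^esub>" if a: "a \<in> carrier K" "scalar a \<odot>\<^bsub>N\<^esub> x = \<zero>\<^bsub>N\<^esub>" for a
  proof (rule ccontr)
    assume "a \<noteq> \<zero>\<^bsub>K\<^esub>"
    then have i: "inv\<^bsub>K\<^esub> a \<in> carrier K" "inv\<^bsub>K\<^esub> a \<otimes>\<^bsub>K\<^esub> a = \<one>\<^bsub>K\<^esub>"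
      using a(1) K.field_Units by (auto simp: base.R.Units_inv_closed base.R.Units_l_inv)
    have "x = (inv\<^bsub>K\<^esub> a \<otimes>\<^bsub>K\<^esub> a) \<odot>\<^bsub>restrict_scalars R N\<^esub> x" using i x KN.smult_one by simp
    also have "\<dots> = inv\<^bsub>K\<^esub> a \<odot>\<^bsub>restrict_scalars R N\<^esub> (a \<odot>\<^bsub>restrict_scalars R N\<^esub> x)"
      using i(1) a(1) x by (intro KN.smult_assoc) auto
    also have "\<dots> = \<zero>\<^bsub>N\<^esub>" using a(2) KN.smult_r_null[OF i(1)] by simp
    finally show False using x(2) by simp
  qed
  then have "\<exists>l\<in>lhom K (restrict_scalars R N) (regular K). \<forall>c\<in>carrier (regular K).
      l ((\<lambda>c\<in>carrier K. c \<odot>\<^bsub>restrict_scalars R N\<^esub> x) c) = (\<lambda>c\<in>carrier (regular K). c) c"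
    by (intro extend_functional_kernel[OF K.field_axioms KN KK scaling_lhom[OF KN xN] id_lhom[OF KK]]) auto
  then obtain l where l: "l \<in> lhom K (restrict_scalars R N) (regular K)"
    "\<And>c. c \<in> carrier K \<Longrightarrow> l (scalar c \<odot>\<^bsub>N\<^esub> x) = c" by auto
  let ?h = "\<lambda>y\<in>carrier N. \<lambda>r\<in>carrier R. l (r \<odot>\<^bsub>N\<^esub> y)"
  have "?h x \<one>\<^bsub>R\<^esub> = \<one>\<^bsub>K\<^esub>" using l(2)[of "\<one>\<^bsub>K\<^esub>"] x by simp
  then have "?h x \<noteq> \<zero>\<^bsub>DR\<^esub>" using K.one_not_zero by (auto dest: fun_cong[of _ _ "\<one>\<^bsub>R\<^esub>"])
  then show ?thesis using coinduced_hom[OF N l(1)] by blast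
qed

lemma finite_length_algebra: "finite_length R (regular R)"
proof (rule finite_length_restrict_scalars)
  show RR: "left_module R (regular R)" by (rule left_module_regular[OF R.ring_axioms])
  obtain F where F: "finite F" "F \<subseteq> carrier R"
    "\<And>x. x \<in> carrier R \<Longrightarrow> \<exists>c\<in>F \<rightarrow> carrier K. x = (\<Oplus>\<^bsub>R\<^esub>v\<in>F. c v \<odot>\<^bsub>R\<^esub> v)"
    by (rule finite_dimensionalE[OF finite_dimensional]) blast
  \<comment> \<open>In the restricted module a scalar acts through its multiple of the unit, which
    agrees with its own action on the algebra.\<close>
  have "(\<Oplus>\<^bsub>restrict_scalars R (regular R)\<^esub>v\<in>F. c v \<odot>\<^bsub>restrict_scalars R (regular R)\<^esub> v)
      = (\<Oplus>\<^bsub>R\<^esub>v\<in>F. c v \<odot>\<^bsub>R\<^esub> v)" if c: "c \<in> F \<rightarrow> carrier K" for c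
    unfolding finsum_restrict_scalars finsum_regular
  proof (rule base.M.finsum_cong')
    fix v assume "v \<in> F"
    then have "c v \<in> carrier K" "v \<in> carrier R" using c F(2) by auto
    then show "c v \<odot>\<^bsub>restrict_scalars R (regular R)\<^esub> v = c v \<odot>\<^bsub>R\<^esub> v"
      by (simp add: smult_mult_left)
  qed (use c F(2) in auto)
  then have "finite_dimensional K (restrict_scalars R (regular R))"
    unfolding finite_dimensional_def using F by (intro exI[of _ F]) (auto; metis)
  then show "finite_length K (restrict_scalars R (regular R))"
    by (rule finite_length_finite_dimensional[OF K.field_axioms left_module_restrict_scalars[OF RR]])
qed

text \<open>Evaluation on a finite spanning set of \<open>R\<close> embeds \<open>DR\<close> into a
  finite power of \<open>K\<close>.\<close>

lemma finite_length_DR: "finite_length R DR"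
proof (rule finite_length_restrict_scalars[OF left_module_DR])
  let ?V = "restrict_scalars R (regular (opposite R))"
  have V: "left_module K ?V" by (rule left_module_restrict_scalars_right[OF left_module_right_regular])
  have KK: "left_module K (regular K)" by (rule left_module_regular[OF base.R.ring_axioms])
  have KD: "left_module K (restrict_scalars R DR)" by (rule left_module_restrict_scalars[OF left_module_DR])
  have KF: "left_module K (free K F)" for F :: "'r set" by (rule left_module_free[OF base.R.ring_axioms])
  obtain F where F: "finite F" "F \<subseteq> carrier R"
    "\<And>x. x \<in> carrier R \<Longrightarrow> \<exists>c\<in>F \<rightarrow> carrier K. x = (\<Oplus>\<^bsub>R\<^esub>v\<in>F. c v \<odot>\<^bsub>R\<^esub> v)"
    by (rule finite_dimensionalE[OF finite_dimensional]) blast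
  have fs: "finsum ?V f F = finsum R f F" for f
    by (simp add: finsum_def finprod_def restrict_scalars_def regular_def opposite_def)
  let ?e = "restrict (\<lambda>\<phi>. \<lambda>v\<in>F. \<phi> v) (carrier (restrict_scalars R DR))"
  have e: "?e \<in> lhom K (restrict_scalars R DR) (free K F)"
  proof (rule lhomI[OF _ _ _ KD])
    fix \<phi> assume "\<phi> \<in> carrier (restrict_scalars R DR)"
    then have \<phi>: "\<phi> \<in> lhom K ?V (regular K)" by simp
    note D = lhomD[OF \<phi>, simplified]
    show "(\<lambda>v\<in>F. \<phi> v) \<in> carrier (free K F)" using D(1) F(2) by auto
    show "(\<lambda>v\<in>F. (\<phi> \<oplus>\<^bsub>restrict_scalars R DR\<^esub> \<psi>) v) = (\<lambda>v\<in>F. \<phi> v) \<oplus>\<^bsub>free K F\<^esub> (\<lambda>v\<in>F. \<psi> v)"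
      if "\<psi> \<in> carrier (restrict_scalars R DR)" for \<psi>
      using F(2) by (auto simp: fun_eq_iff)
    show "(\<lambda>v\<in>F. (c \<odot>\<^bsub>restrict_scalars R DR\<^esub> \<phi>) v) = c \<odot>\<^bsub>free K F\<^esub> (\<lambda>v\<in>F. \<phi> v)" if "c \<in> carrier K" for c
      using that D(3) F(2) by (auto simp: fun_eq_iff)
  qed
  have "inj_on ?e (carrier (restrict_scalars R DR))"
  proof (rule inj_on_lhom[OF KD KF e])
    fix \<phi> assume "\<phi> \<in> carrier (restrict_scalars R DR)" and 0: "?e \<phi> = \<zero>\<^bsub>free K F\<^esub>"
    then have \<phi>: "\<phi> \<in> lhom K ?V (regular K)" by simp
    note D = lhomD[OF \<phi>, simplified]
    have \<phi>0: "\<phi> v = \<zero>\<^bsub>K\<^esub>" if "v \<in> F" for v using fun_cong[OF 0, of v] that \<phi> by simp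
    have "\<phi> x = \<zero>\<^bsub>K\<^esub>" if x: "x \<in> carrier R" for x
    proof -
      obtain c where c: "c \<in> F \<rightarrow> carrier K" "x = (\<Oplus>\<^bsub>R\<^esub>v\<in>F. c v \<odot>\<^bsub>R\<^esub> v)" using F(3)[OF x] by blast
      have "\<phi> x = \<phi> (\<Oplus>\<^bsub>?V\<^esub>v\<in>F. c v \<odot>\<^bsub>R\<^esub> v)" by (simp only: c(2) fs)
      also have "\<dots> = (\<Oplus>\<^bsub>regular K\<^esub>v\<in>F. \<phi> (c v \<odot>\<^bsub>R\<^esub> v))"
        by (rule lhom_finsum[OF V KK \<phi> F(1)]) (use c F(2) in auto)
      also have "\<dots> = (\<Oplus>\<^bsub>K\<^esub>v\<in>F. \<phi> (c v \<odot>\<^bsub>R\<^esub> v))" by (rule finsum_regular)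
      also have "\<dots> = (\<Oplus>\<^bsub>K\<^esub>v\<in>F. \<zero>\<^bsub>K\<^esub>)"
      proof (rule base.R.finsum_cong')
        fix v assume v: "v \<in> F"
        then have "c v \<in> carrier K" "v \<in> carrier R" using c(1) F(2) by auto
        then have "\<phi> (c v \<odot>\<^bsub>R\<^esub> v) = c v \<otimes>\<^bsub>K\<^esub> \<phi> v" using D(3)[of "c v" v] by (simp add: smult_mult_right)
        then show "\<phi> (c v \<odot>\<^bsub>R\<^esub> v) = \<zero>\<^bsub>K\<^esub>" using \<phi>0[OF v] \<open>c v \<in> carrier K\<close> by simp
      qed auto
      finally show ?thesis by simp
    qed
    then show "\<phi> = \<zero>\<^bsub>restrict_scalars R DR\<^esub>"
      using D(4) by (auto simp: fun_eq_iff extensional_def)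
  qed
  moreover have "finite_length K (free K F)" unfolding free_def
    using F(1) by (intro finite_length_direct_product)
      (auto simp: base.R.ring_axioms left_module_regular finite_length_field[OF K.field_axioms])
  ultimately show "finite_length K (restrict_scalars R DR)"
    using finite_length_inj[OF KD KF e] by blast
qed

text \<open>\<open>DR\<close> has elements in \<open>'r \<Rightarrow> 'k\<close>, whereas members of
  \<open>indecomposable_injectives\<close> have elements in \<open>tau_elem\<close>. So it is the
  copy of \<open>DR\<close> along \<open>k\<close> whose retracts are searched.\<close>

lemma indecomposable_injective_separates:
  fixes N :: "('r, 'n) module" and k :: "('r \<Rightarrow> 'k) \<Rightarrow> ('k, 'r) tau_elem"
  assumes k: "inj k" and N: "left_module R N" and x: "x \<in> carrier N" "x \<noteq> \<zero>\<^bsub>N\<^esub>"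
  shows "\<exists>E\<in>indecomposable_injectives U R. \<exists>h\<in>lhom R N E. h x \<noteq> \<zero>\<^bsub>E\<^esub>"
proof -
  let ?D = "transport k DR"
  have kD: "inj_on k (carrier DR)" using k by (rule inj_on_subset) simp
  note t = transport[OF left_module_DR kD]
  have bij: "bij_betw (restrict k (carrier DR)) (carrier DR) (carrier ?D)"
    using kD t(3) by (auto simp: bij_betw_def)
  obtain i where i: "i \<in> lhom R ?D DR" "\<forall>x\<in>carrier DR. i (restrict k (carrier DR) x) = x"
    "\<forall>y\<in>carrier ?D. restrict k (carrier DR) (i y) = y"
    using lhom_inverse[OF left_module_DR t(1,2) bij] by blast
  have inj: "injective U R ?D"
    by (rule injective_retract[OF injective_DR t(1) i(1) t(2)]) (use i(3) in blast)
  have "inj_on i (carrier ?D)" 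
    by (rule inj_on_inverseI[where g = "restrict k (carrier DR)"]) (rule i(3)[rule_format])
  then have fl: "finite_length R ?D"
    by (rule finite_length_inj[OF t(1) left_module_DR i(1) _ finite_length_DR])
  obtain h where h: "h \<in> lhom R N DR" "h x \<noteq> \<zero>\<^bsub>DR\<^esub>" using DR_cogenerator[OF N x] by blast
  let ?h = "compose (carrier N) (restrict k (carrier DR)) h"
  have h': "?h \<in> lhom R N ?D" by (rule compose_lhom[OF N h(1) t(2)])
  have "?h x \<noteq> \<zero>\<^bsub>?D\<^esub>"
  proof
    assume "?h x = \<zero>\<^bsub>?D\<^esub>"
    then have "i (?h x) = \<zero>\<^bsub>DR\<^esub>" using lhom_zero[OF t(1) left_module_DR i(1)] by simp
    then show False using i(2) h(2) lhomD(1)[OF h(1) x(1)] x(1) by (simp add: compose_eq)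
  qed
  from indecomposable_retract[OF t(1) inj fl N x(1) h' this]
  obtain Q h'' where "indecomposable R (?D\<lparr>carrier := Q\<rparr>)" "injective U R (?D\<lparr>carrier := Q\<rparr>)"
    "h'' \<in> lhom R N (?D\<lparr>carrier := Q\<rparr>)" "h'' x \<noteq> \<zero>\<^bsub>?D\<^esub>" by blast
  then show ?thesis
    by (intro bexI[of _ "?D\<lparr>carrier := Q\<rparr>"] bexI[of _ h'']) (auto simp: indecomposable_injectives_def)
qed

section \<open>The chosen presentation behind the translate\<close>

lemma finite_length_of_finitely_generated:
  assumes P: "left_module R P" and fg: "finitely_generated R P"
  shows "finite_length R P"
proof -
  obtain n :: nat and g where g: "g \<in> lhom R (free R {..<n}) P"
    "g ` carrier (free R {..<n}) = carrier P"
    using finitely_generated_surj[OF P fg] by blast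
  have "finite_length R (free R {..<n})" unfolding free_def
    by (rule finite_length_direct_product[OF R.ring_axioms])
      (use finite_length_algebra left_module_regular[OF R.ring_axioms] in auto)
  then show ?thesis using finite_length_surj[OF left_module_free[OF R.ring_axioms] P g] by blast
qed

text \<open>Nothing is known about the chosen module until one minimal presentation exists.
  Afterwards any choice has finitely generated projective terms, hence dual bases.\<close>

lemma AR_translate_presentation:
  fixes M :: "('r, 'm) module" and j :: "(nat \<Rightarrow> 'r) \<Rightarrow> 'u"
  assumes M: "left_module R M" and fd: "finite_dimensional K (restrict_scalars R M)" and j: "inj j"
  shows "\<exists>(P1 :: ('r, nat \<Rightarrow> 'r) module) (P0 :: ('r, nat \<Rightarrow> 'r) module) d e
      (I :: nat set) p \<xi> (J :: nat set) q \<eta>.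
    presentation K R P1 P0 M d e I p \<xi> J q \<eta> \<and>
    AR_translate TYPE('u) K R M = field_dual K R (AB_transpose R P1 P0 d)"
proof -
  have "finite_length K (restrict_scalars R M)"
    by (rule finite_length_finite_dimensional[OF K.field_axioms left_module_restrict_scalars[OF M] fd])
  then have fgM: "finitely_generated R M"
    by (rule finite_length_imp_finitely_generated[OF M finite_length_restrict_scalars[OF M]])
  \<comment> \<open>Finite length passes to submodules, so the kernel of a first cover is finitely
    generated and admits a cover in turn.\<close>
  have kerfg: "left_module R (P\<lparr>carrier := ker P M e\<rparr>) \<and> finitely_generated R (P\<lparr>carrier := ker P M e\<rparr>)"
    if "projective_cover TYPE('u) R P M e" for P :: "('r, nat \<Rightarrow> 'r) module" and e
  proof -
    have P: "left_module R P" and e: "e \<in> lhom R P M"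
      using that by (auto simp: projective_cover_def projective_def)
    have k: "submodule (ker P M e) R P" by (rule submodule_ker[OF P M e])
    have Pk: "left_module R (P\<lparr>carrier := ker P M e\<rparr>)" by (rule left_module_submodule[OF P k])
    have "finite_length R P"
      by (rule finite_length_of_finitely_generated[OF P projective_cover_finitely_generated[OF that M fgM]])
    moreover have "(\<lambda>x\<in>ker P M e. x) \<in> lhom R (P\<lparr>carrier := ker P M e\<rparr>) P"
      by (rule inclusion_lhom[OF P k])
    ultimately have "finite_length R (P\<lparr>carrier := ker P M e\<rparr>)"
      by (intro finite_length_inj[OF Pk P]) (auto simp: inj_on_def)
    then show ?thesis using finite_length_imp_finitely_generated[OF Pk] Pk by blast
  qed
  obtain P0 :: "('r, nat \<Rightarrow> 'r) module" and e where P0: "projective_cover TYPE('u) R P0 M e"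
    using exists_projective_cover[OF M fgM finite_length_algebra] by blast
  obtain P1 :: "('r, nat \<Rightarrow> 'r) module" and d
    where P1: "projective_cover TYPE('u) R P1 (P0\<lparr>carrier := ker P0 M e\<rparr>) d"
    using exists_projective_cover[OF _ _ finite_length_algebra] kerfg[OF P0] by blast
  have "\<exists>T (P1 :: ('r, nat \<Rightarrow> 'r) module) (P0 :: ('r, nat \<Rightarrow> 'r) module) d e.
      minimal_projective_presentation TYPE('u) R P1 P0 M d e \<and> T = field_dual K R (AB_transpose R P1 P0 d)"
    unfolding minimal_projective_presentation_def using P0 P1 by blast
  from someI_ex[OF this]
  obtain P1 P0 :: "('r, nat \<Rightarrow> 'r) module" and d e
    where mpp: "minimal_projective_presentation TYPE('u) R P1 P0 M d e"
      and T: "AR_translate TYPE('u) K R M = field_dual K R (AB_transpose R P1 P0 d)"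
    unfolding AR_translate_def by blast
  have c0: "projective_cover TYPE('u) R P0 M e" and c1: "projective_cover TYPE('u) R P1 (P0\<lparr>carrier := ker P0 M e\<rparr>) d"
    using mpp by (auto simp: minimal_projective_presentation_def)
  have pr: "projective TYPE('u) R P0" "projective TYPE('u) R P1"
    using c0 c1 by (auto simp: projective_cover_def)
  have jj: "inj_on j X" for X using j by (rule inj_on_subset) simp
  obtain J :: "nat set" and q \<eta> where "dual_basis R P0 J q \<eta>"
    using projective_dual_basis[OF pr(1) projective_cover_finitely_generated[OF c0 M fgM] j jj] by blast
  moreover obtain I :: "nat set" and p \<xi> where "dual_basis R P1 I p \<xi>"
    using projective_dual_basis[OF pr(2) projective_cover_finitely_generated[OF c1] j jj] kerfg[OF c0] by blast
  moreover have "d \<in> lhom R P1 P0" "d ` carrier P1 = ker P0 M e"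
    using c1 by (auto simp: projective_cover_def lhom_def ker_def)
  ultimately have "presentation K R P1 P0 M d e I p \<xi> J q \<eta>"
    using c0 pr M fin_dim_algebra_axioms
    by (auto simp: presentation_def presentation_axioms_def projective_cover_def projective_def)
  then show ?thesis using T by blast
qed

text \<open>This eliminates the choice: the final proof knows the translate only through these two
  facts.\<close>

lemma AR_translate:
  fixes M :: "('r, 'm) module" and j :: "(nat \<Rightarrow> 'r) \<Rightarrow> 'u"
    and A :: "('r, 'a) module" and B :: "('r, 'b) module" and C :: "('r, 'c) module"
  assumes M: "left_module R M" and fd: "finite_dimensional K (restrict_scalars R M)" and j: "inj j"
  shows left_module_AR_translate: "left_module R (AR_translate TYPE('u) K R M)"
    and injective_relative_AR_translate_iff: "short_exact_modules R A B C f g \<Longrightarrow>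
      injective_relative R (AR_translate TYPE('u) K R M) A B f \<longleftrightarrow>
      (\<forall>u\<in>lhom R M C. \<exists>v\<in>lhom R M B. \<forall>x\<in>carrier M. g (v x) = u x)"
proof -
  obtain P1 P0 :: "('r, nat \<Rightarrow> 'r) module" and d e and I J :: "nat set" and p \<xi> q \<eta>
    where pres: "presentation K R P1 P0 M d e I p \<xi> J q \<eta>"
      and T: "AR_translate TYPE('u) K R M = field_dual K R (AB_transpose R P1 P0 d)"
    using AR_translate_presentation[OF M fd j] by metis
  show "left_module R (AR_translate TYPE('u) K R M)"
    unfolding T by (rule presentation.tau[OF pres])
  show "injective_relative R (AR_translate TYPE('u) K R M) A B f \<longleftrightarrow>
      (\<forall>u\<in>lhom R M C. \<exists>v\<in>lhom R M B. \<forall>x\<in>carrier M. g (v x) = u x)"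
    if seq: "short_exact_modules R A B C f g"
    unfolding T
    using presentation.tau_injective_relative[OF pres seq]
      presentation.lift_if_tau_injective_relative[OF pres seq] by blast
qed

end

text \<open>Purity is tested on sequences inside \<open>'u\<close>, while \<open>N\<close> and
  \<open>P\<close> live in types of their own. The maps \<open>i\<close>, \<open>a\<close>,
  \<open>b\<close> and \<open>b'\<close> translate between the embedding and its copy.\<close>

lemma exact_completion:
  fixes N :: "('r, 'n) module" and P :: "('r, 'p) module" and j :: "'p \<Rightarrow> 'u"
  assumes N: "left_module R N" and P: "left_module R P" and s: "s \<in> lhom R N P"
    and inj: "inj_on s (carrier N)" and j: "inj_on j (carrier P)"
  shows "\<exists>(A :: ('r, 'u) module) (B :: ('r, 'u) module) (C :: ('r, 'u) module) f g.
    short_exact_modules R A B C f g \<and>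
    (\<exists>i\<in>lhom R N A. \<exists>a\<in>lhom R A N. \<exists>b\<in>lhom R P B. \<exists>b'\<in>lhom R B P.
      (\<forall>x\<in>carrier N. a (i x) = x \<and> f (i x) = b (s x)) \<and> (\<forall>y\<in>carrier A. i (a y) = y) \<and>
      (\<forall>y\<in>carrier P. b' (b y) = y))"
proof -
  let ?B = "transport j P"
  note t = transport[OF P j]
  note B = t(1) and b = t(2)
  let ?b = "restrict j (carrier P)"
  interpret N: left_module R N by (rule N)
  have bij: "bij_betw ?b (carrier P) (carrier ?B)"
    using j t(3) by (auto simp: bij_betw_def)
  obtain b' where b': "b' \<in> lhom R ?B P" "\<forall>y\<in>carrier P. b' (?b y) = y"
    using lhom_inverse[OF P B b bij] by blast
  let ?bs = "compose (carrier N) ?b s"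
  have bs: "?bs \<in> lhom R N ?B" by (rule compose_lhom[OF N s b])
  define H where "H = ?bs ` carrier N"
  have H: "submodule H R ?B" unfolding H_def by (rule submodule_image[OF N B bs N.submodule_carrier])
  let ?A = "?B\<lparr>carrier := H\<rparr>"
  have A: "left_module R ?A" by (rule left_module_submodule[OF B H])
  have i: "?bs \<in> lhom R N ?A" using bs unfolding H_def lhom_def by auto
  have "inj_on ?bs (carrier N)"
  proof (rule inj_onI)
    fix x y assume xy: "x \<in> carrier N" "y \<in> carrier N" "?bs x = ?bs y"
    then have "j (s x) = j (s y)" using lhomD(1)[OF s] by (simp add: compose_eq)
    then have "s x = s y" using j xy lhomD(1)[OF s] by (auto dest: inj_onD)
    then show "x = y" using inj xy by (auto dest: inj_onD)
  qed
  then have "bij_betw ?bs (carrier N) (carrier ?A)" by (simp add: bij_betw_def H_def)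
  then obtain a where a: "a \<in> lhom R ?A N" "\<forall>x\<in>carrier N. a (?bs x) = x" "\<forall>y\<in>carrier ?A. ?bs (a y) = y"
    using lhom_inverse[OF N A i] by blast
  \<comment> \<open>Cosets are sets of elements of \<open>'u\<close>; taking a representative of
    each brings the quotient back into \<open>'u\<close>.\<close>
  let ?Q = "quotient_module ?B H" and ?r = "\<lambda>X. SOME x. x \<in> X"
  note Q = left_module_quotient[OF B H] and \<pi> = quotient_proj_lhom[OF B H]
    and \<pi>surj = quotient_proj_surj[OF B H] and \<pi>0 = quotient_proj_zero_iff[OF B H]
  interpret B: left_module R ?B by (rule B)
  interpret H: abelian_subgroup H ?B
    using H by (intro abelian_subgroupI3 additive_subgroupI) (auto simp: submodule_def B.M.abelian_group_axioms)
  have "H +>\<^bsub>?B\<^esub> (?r X) = X" if "X \<in> carrier ?Q" for X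
  proof -
    from that have "X \<in> (\<lambda>x. H +>\<^bsub>?B\<^esub> x) ` carrier ?B" using \<pi>surj by simp
    then obtain x where x: "x \<in> carrier ?B" "X = H +>\<^bsub>?B\<^esub> x" by blast
    then have "x \<in> X" using H.a_rcos_self by blast
    then have "?r X \<in> X" by (rule someI)
    then show ?thesis using H.a_repr_independence'[of "?r X" x] x by simp
  qed
  then have r: "inj_on ?r (carrier ?Q)" by (rule inj_on_inverseI)
  let ?C = "transport ?r ?Q"
  note tC = transport[OF Q r]
  let ?g = "compose (carrier ?B) (restrict ?r (carrier ?Q)) (\<lambda>x\<in>carrier ?B. H +>\<^bsub>?B\<^esub> x)"
  have g: "?g \<in> lhom R ?B ?C" by (rule compose_lhom[OF B \<pi> tC(2)])
  have \<pi>c: "H +>\<^bsub>?B\<^esub> x \<in> carrier ?Q" if "x \<in> carrier ?B" for x using that \<pi>surj by blast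
  have gx: "?g x = ?r (H +>\<^bsub>?B\<^esub> x)" if "x \<in> carrier ?B" for x
    using that \<pi>c[OF that] by (simp add: compose_eq)
  interpret Q: left_module R ?Q by (rule Q)
  have zC: "\<zero>\<^bsub>?C\<^esub> = ?r (\<zero>\<^bsub>?Q\<^esub>)" using lhom_zero[OF Q tC(1,2)] by simp
  have "short_exact_modules R ?A ?B ?C (\<lambda>x\<in>H. x) ?g"
    unfolding short_exact_modules_def short_exact_def
  proof (intro conjI A B tC(1) g)
    show "(\<lambda>x\<in>H. x) \<in> lhom R ?A ?B" by (rule inclusion_lhom[OF B H])
    show "inj_on (\<lambda>x\<in>H. x) (carrier ?A)" by (simp add: inj_on_def)
    have "?g x = \<zero>\<^bsub>?C\<^esub> \<longleftrightarrow> x \<in> H" if x: "x \<in> carrier ?B" for x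
      using gx[OF x] zC inj_on_eq_iff[OF r \<pi>c[OF x] Q.M.zero_closed] \<pi>0[OF x] by simp
    then show "(\<lambda>x\<in>H. x) ` carrier ?A = {x \<in> carrier ?B. ?g x = \<zero>\<^bsub>?C\<^esub>}"
      using submoduleD(1)[OF H] by auto
    have "?g ` carrier ?B = (\<lambda>x. ?r (H +>\<^bsub>?B\<^esub> x)) ` carrier ?B" by (rule image_cong[OF refl gx])
    also have "\<dots> = ?r ` carrier ?Q" unfolding \<pi>surj[symmetric] image_image ..
    finally show "?g ` carrier ?B = carrier ?C" using tC(3) by simp
  qed
  moreover have "(\<lambda>x\<in>H. x) (?bs x) = ?b (s x)" if "x \<in> carrier N" for x
    using that by (simp add: H_def compose_eq)
  ultimately show ?thesis using i a b b' by (intro exI conjI) (assumption, blast)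
qed

text \<open>A set of functions is decoded to an element of \<open>'r\<close> by choosing a member
  and evaluating it at \<open>undefined\<close>. Singletons of constant functions reach every
  element, so nothing of the coded function is lost.\<close>

lemma embed_functions: "\<exists>k :: ('r \<Rightarrow> 'k) \<Rightarrow> ('k, 'r) tau_elem. inj k"
proof (intro exI injI ext)
  fix \<phi> \<psi> :: "'r \<Rightarrow> 'k" and r
  assume "(\<lambda>s :: ((nat \<Rightarrow> 'r) \<Rightarrow> 'r) set. \<phi> ((SOME f. f \<in> s) (\<lambda>_. undefined))) =
    (\<lambda>s. \<psi> ((SOME f. f \<in> s) (\<lambda>_. undefined)))"
  from fun_cong[OF this, of "{\<lambda>_. r}"] show "\<phi> r = \<psi> r" by simp
qed

text \<open>A sequence is coded by its indicator function, and the singleton of that function by an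
  indicator again. Two distinct values are needed at each of the two levels.\<close>

lemma embed_sequences:
  fixes a b :: 'r and c c' :: 'k
  assumes "a \<noteq> b" "c \<noteq> c'"
  shows "\<exists>k :: (nat \<Rightarrow> 'r) \<Rightarrow> ('k, 'r) tau_elem. inj k"
proof (intro exI injI)
  fix x x' :: "nat \<Rightarrow> 'r"
  assume "(\<lambda>s. if s = {\<lambda>y. if y = x then a else b} then c else c') =
    (\<lambda>s. if s = {\<lambda>y. if y = x' then a else b} then c else c')"
  from fun_cong[OF this, of "{\<lambda>y. if y = x then a else b}"]
  have "(\<lambda>y. if y = x then a else b) = (\<lambda>y. if y = x' then a else b)"
    using assms(2) by (simp split: if_splits)
  from fun_cong[OF this, of x] show "x = x'" using assms(1) by (simp split: if_splits)
qed

theorem theorem4p6: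
  fixes K :: "'k ring" and R :: "('k, 'r) module"
    and S :: "('r, 'm) module set" and N :: "('r, 'n) module"
    and \<iota> :: "('k, 'r, 'n) universe_bound \<Rightarrow> 'u"
  assumes "fin_dim_algebra K R"
    and "\<And>M. M \<in> S \<Longrightarrow> left_module R M \<and> indecomposable R M \<and>
           finite_dimensional K (restrict_scalars R M)"
    and "left_module R N"
    and "inj \<iota>"
  shows "pure_injective TYPE('u) R S N \<longleftrightarrow>
    (\<exists>(I :: 'u set) X.
       (\<forall>i\<in>I. X i \<in> AR_translate TYPE('u) K R ` S \<union> indecomposable_injectives TYPE('u) R) \<and>
       direct_summand R N (direct_product I X))"
proof -
  interpret fin_dim_algebra K R by fact
  note N = assms(3)
  interpret N: left_module R N by (rule N)
  let ?\<tau> = "AR_translate TYPE('u) K R" and ?E = "indecomposable_injectives TYPE('u) R"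
  have M: "left_module R M" "finite_dimensional K (restrict_scalars R M)" if "M \<in> S" for M
    using assms(2)[OF that] by auto
  \<comment> \<open>A member of \<open>S\<close> is nonzero, so zero and one differ in
    \<open>R\<close>, as \<open>embed_sequences\<close> requires. This is why the embedding is
    stated relative to a member of \<open>S\<close>.\<close>
  have emb: "\<exists>j :: (nat \<Rightarrow> 'r) \<Rightarrow> 'u. inj j" if "M \<in> S" for M
  proof -
    interpret M: left_module R M by (rule M(1)[OF that])
    have "\<one>\<^bsub>R\<^esub> \<noteq> \<zero>\<^bsub>R\<^esub>"
    proof
      assume "\<one>\<^bsub>R\<^esub> = \<zero>\<^bsub>R\<^esub>"
      then have "x = \<zero>\<^bsub>M\<^esub>" if "x \<in> carrier M" for x
        using that M.smult_one M.smult_l_null by metis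
      then have "carrier M = {\<zero>\<^bsub>M\<^esub>}" by blast
      then show False using assms(2)[OF that] by (simp add: indecomposable_def)
    qed
    then obtain k :: "(nat \<Rightarrow> 'r) \<Rightarrow> ('k, 'r) tau_elem" where "inj k"
      using embed_sequences[of "\<one>\<^bsub>R\<^esub>" "\<zero>\<^bsub>R\<^esub>" "\<one>\<^bsub>K\<^esub>" "\<zero>\<^bsub>K\<^esub>"] K.one_not_zero by blast
    have "inj (\<lambda>x. \<iota> (\<lambda>_. k x))"
    proof (rule injI)
      fix x y assume "\<iota> (\<lambda>_. k x) = \<iota> (\<lambda>_. k y)"
      from fun_cong[OF injD[OF assms(4), OF this]] show "x = y" using \<open>inj k\<close> by (simp add: inj_eq)
    qed
    then show ?thesis by blast
  qed
  have \<tau>: "left_module R (?\<tau> M)" if MS: "M \<in> S" for M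
    using left_module_AR_translate[OF M[OF MS]] emb[OF MS] by blast
  have \<tau>_iff: "injective_relative R (?\<tau> M) A B f \<longleftrightarrow>
      (\<forall>u\<in>lhom R M C. \<exists>v\<in>lhom R M B. \<forall>x\<in>carrier M. g (v x) = u x)"
    if MS: "M \<in> S" and seq: "short_exact_modules R A B C f g"
    for M and A B C :: "('r, 'u) module" and f g
    using injective_relative_AR_translate_iff[OF M[OF MS] _ seq] emb[OF MS] by blast
  have X: "left_module R X" if "X \<in> ?\<tau> ` S \<union> ?E" for X
    using that \<tau> by (auto simp: indecomposable_injectives_def injective_def)
  show ?thesis
  proof
    assume pi: "pure_injective TYPE('u) R S N"
    \<comment> \<open>Pairs of a module and a homomorphism become indices in \<open>'u\<close>: a
      pair is coded by its indicator, with two constant functions as values, and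
      \<open>\<iota>\<close> is applied.\<close>
    define \<kappa> :: "('r, ('k, 'r) tau_elem) module \<times> ('n \<Rightarrow> ('k, 'r) tau_elem) \<Rightarrow> 'u"
      where "\<kappa> z = \<iota> (\<lambda>w. if w = z then (\<lambda>_. \<one>\<^bsub>K\<^esub>) else (\<lambda>_. \<zero>\<^bsub>K\<^esub>))" for z
    have \<kappa>: "inj \<kappa>"
    proof (rule injI)
      fix z z' assume "\<kappa> z = \<kappa> z'"
      then have "(\<lambda>w. if w = z then (\<lambda>_. \<one>\<^bsub>K\<^esub>) else (\<lambda>_. \<zero>\<^bsub>K\<^esub>)) =
          (\<lambda>w. if w = z' then (\<lambda>_ :: ((nat \<Rightarrow> 'r) \<Rightarrow> 'r) set. \<one>\<^bsub>K\<^esub>) else (\<lambda>_. \<zero>\<^bsub>K\<^esub>))"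
        unfolding \<kappa>_def using assms(4) by (auto dest: injD)
      from fun_cong[OF fun_cong[OF this, of z], of "{}"] show "z = z'"
        using K.one_not_zero by (simp split: if_splits)
    qed
    define Z where "Z = {(X, h). X \<in> ?\<tau> ` S \<union> ?E \<and> h \<in> lhom R N X}"
    define I where "I = \<kappa> ` Z"
    define X where "X u = fst (inv_into UNIV \<kappa> u)" for u
    define H where "H u = snd (inv_into UNIV \<kappa> u)" for u
    have XI: "X u \<in> ?\<tau> ` S \<union> ?E" "H u \<in> lhom R N (X u)" if "u \<in> I" for u
      using that \<kappa> unfolding I_def X_def H_def Z_def by auto
    have XH: "\<kappa> (Y, h) \<in> I" "X (\<kappa> (Y, h)) = Y" "H (\<kappa> (Y, h)) = h"
      if "Y \<in> ?\<tau> ` S \<union> ?E" "h \<in> lhom R N Y" for Y h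
      using that \<kappa> unfolding I_def X_def H_def Z_def by auto
    have LM: "left_module R (X u)" if "u \<in> I" for u by (rule X[OF XI(1)[OF that]])
    let ?P = "direct_product I X"
    have P: "left_module R ?P"
      by (rule left_module_direct_product[OF R.ring_axioms LM])
    let ?s = "\<lambda>x\<in>carrier N. \<lambda>u\<in>I. H u x"
    have s: "?s \<in> lhom R N ?P" by (rule direct_product_tuple_lhom[OF N XI(2)])
    have factor: "\<exists>h'\<in>lhom R ?P Y. \<forall>x\<in>carrier N. h' (?s x) = h x"
      if Yh: "Y \<in> ?\<tau> ` S \<union> ?E" "h \<in> lhom R N Y" for Y h
    proof -
      note xh = XH[OF Yh]
      let ?p = "\<lambda>x\<in>carrier ?P. x (\<kappa> (Y, h))"
      have "?p \<in> lhom R ?P (X (\<kappa> (Y, h)))"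
        by (rule direct_product_proj_lhom[OF R.ring_axioms LM xh(1)])
      then have "?p \<in> lhom R ?P Y" by (simp only: xh(2))
      moreover have "?p (?s x) = h x" if "x \<in> carrier N" for x
        using lhomD(1)[OF s that] that xh by (simp del: direct_product_simps)
      ultimately show ?thesis by blast
    qed
    have inj: "inj_on ?s (carrier N)"
    proof (rule inj_on_lhom[OF N P s], rule ccontr)
      fix x assume x: "x \<in> carrier N" and 0: "?s x = \<zero>\<^bsub>?P\<^esub>" and nz: "x \<noteq> \<zero>\<^bsub>N\<^esub>"
      obtain k :: "('r \<Rightarrow> 'k) \<Rightarrow> ('k, 'r) tau_elem" where k: "inj k" using embed_functions by blast
      obtain Y h where Y: "Y \<in> ?E" "h \<in> lhom R N Y" "h x \<noteq> \<zero>\<^bsub>Y\<^esub>"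
        using indecomposable_injective_separates[OF k N x nz] by blast
      then obtain h' where h': "h' \<in> lhom R ?P Y" "\<forall>x\<in>carrier N. h' (?s x) = h x"
        using factor[of Y h] by blast
      have "h x = h' (?s x)" using h'(2) x by simp
      also have "\<dots> = \<zero>\<^bsub>Y\<^esub>" unfolding 0 using lhom_zero[OF P _ h'(1)] X Y(1) by blast
      finally show False using Y(3) by simp
    qed
    \<comment> \<open>Reindexed along \<open>\<kappa>\<close>, a point of the product becomes a
      function on pairs, an element of \<open>universe_bound\<close>. As \<open>I\<close> lies in
      the range of \<open>\<kappa>\<close>, no coordinate is lost.\<close>
    define j where "j x = \<iota> (\<lambda>z. x (\<kappa> z))" for x
    have j: "inj_on j (carrier ?P)"
    proof (rule inj_onI)
      fix x y assume xy: "x \<in> carrier ?P" "y \<in> carrier ?P" "j x = j y"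
      then have "(\<lambda>z. x (\<kappa> z)) = (\<lambda>z. y (\<kappa> z))" unfolding j_def using assms(4) by (auto dest: injD)
      then have "x u = y u" if "u \<in> I" for u using that unfolding I_def by (metis imageE)
      then show "x = y" using xy(1,2) by (intro extensionalityI[of _ I]) (auto simp: PiE_def)
    qed
    obtain A B C :: "('r, 'u) module" and f g i a b b' where seq: "short_exact_modules R A B C f g"
      and i: "i \<in> lhom R N A" and a: "a \<in> lhom R A N" and b: "b \<in> lhom R ?P B" and b': "b' \<in> lhom R B ?P"
      and ai: "\<And>x. x \<in> carrier N \<Longrightarrow> a (i x) = x" and fi: "\<And>x. x \<in> carrier N \<Longrightarrow> f (i x) = b (?s x)"
      and ia: "\<And>y. y \<in> carrier A \<Longrightarrow> i (a y) = y" and bb: "\<And>y. y \<in> carrier ?P \<Longrightarrow> b' (b y) = y"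
      using exact_completion[OF N P s inj j] by blast
    note A = short_exact_modulesD(1)[OF seq] and B = short_exact_modulesD(2)[OF seq]
    \<comment> \<open>The factorization through the product, carried over to the copies
      \<open>A\<close> and \<open>B\<close> in \<open>'u\<close>.\<close>
    have ext: "injective_relative R Y A B f" if Y: "Y \<in> ?\<tau> ` S \<union> ?E" for Y
      unfolding injective_relative_def
    proof
      fix h assume h: "h \<in> lhom R A Y"
      obtain h' where h': "h' \<in> lhom R ?P Y" "\<forall>x\<in>carrier N. h' (?s x) = compose (carrier N) h i x"
        using factor[OF Y compose_lhom[OF N i h]] by blast
      have "compose (carrier B) h' b' (f y) = h y" if y: "y \<in> carrier A" for y
      proof -
        note ay = lhomD(1)[OF a y]
        have fy: "f y = b (?s (a y))" using fi[OF ay] ia[OF y] by simp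
        have "b' (f y) = ?s (a y)" unfolding fy by (rule bb[OF lhomD(1)[OF s ay]])
        then show ?thesis
          using h'(2) ay ia[OF y] lhomD(1)[OF short_exact_modulesD(4)[OF seq] y] by (simp add: compose_eq)
      qed
      then show "\<exists>h'\<in>lhom R B Y. \<forall>x\<in>carrier A. h' (f x) = h x"
        using compose_lhom[OF B b' h'(1)] by blast
    qed
    have "pure_exact R S A B C f g"
      by (rule pure_exactI[OF seq M(1)]) (use \<tau>_iff[OF _ seq] ext in blast)+
    then have "injective_relative R N A B f" using pi unfolding pure_injective_def by blast
    \<comment> \<open>Extending the identification \<open>a\<close> of \<open>A\<close> with
      \<open>N\<close> over \<open>B\<close> gives, after \<open>b\<close>, a retraction of the
      product onto \<open>N\<close>.\<close>
    then obtain r where r: "r \<in> lhom R B N" "\<forall>x\<in>carrier A. r (f x) = a x"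
      using a unfolding injective_relative_def by blast
    have "compose (carrier ?P) r b (?s x) = x" if x: "x \<in> carrier N" for x
    proof -
      have "compose (carrier ?P) r b (?s x) = r (b (?s x))" by (rule compose_eq[OF lhomD(1)[OF s x]])
      also have "\<dots> = r (f (i x))" by (simp only: fi[OF x])
      also have "\<dots> = x" using r(2) lhomD(1)[OF i x] ai[OF x] by simp
      finally show ?thesis .
    qed
    then have "direct_summand R N ?P"
      unfolding direct_summand_iff_retract[OF N P] using s compose_lhom[OF P b r(1)] by blast
    then show "\<exists>(I :: 'u set) X. (\<forall>i\<in>I. X i \<in> ?\<tau> ` S \<union> ?E) \<and> direct_summand R N (direct_product I X)"
      using XI(1) by blast
  next
    assume "\<exists>(I :: 'u set) X. (\<forall>i\<in>I. X i \<in> ?\<tau> ` S \<union> ?E) \<and> direct_summand R N (direct_product I X)"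
    then obtain I :: "'u set" and X' where XI: "\<And>i. i \<in> I \<Longrightarrow> X' i \<in> ?\<tau> ` S \<union> ?E"
      and ds: "direct_summand R N (direct_product I X')" by blast
    have LM: "left_module R (X' i)" if "i \<in> I" for i by (rule X[OF XI[OF that]])
    let ?P = "direct_product I X'"
    have P: "left_module R ?P"
      by (rule left_module_direct_product[OF R.ring_axioms LM])
    obtain s r where sr: "s \<in> lhom R N ?P" "r \<in> lhom R ?P N" "\<And>x. x \<in> carrier N \<Longrightarrow> r (s x) = x"
      using ds unfolding direct_summand_iff_retract[OF N P] by blast
    show "pure_injective TYPE('u) R S N"
      unfolding pure_injective_def
    proof (intro conjI allI impI N)
      fix A B C :: "('r, 'u) module" and f g assume pure: "pure_exact R S A B C f g"
      then have seq: "short_exact_modules R A B C f g" by (simp add: pure_exact_def)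
      note A = short_exact_modulesD(1)[OF seq] and B = short_exact_modulesD(2)[OF seq]
        and f = short_exact_modulesD(4)[OF seq]
      have ext: "injective_relative R (X' i) A B f" if "i \<in> I" for i
      proof -
        from XI[OF that] consider M where "M \<in> S" "X' i = ?\<tau> M" | "X' i \<in> ?E" by blast
        then show ?thesis
        proof cases
          case 1
          then show ?thesis using \<tau>_iff[OF 1(1) seq] pure_exact_lift[OF pure 1(1)] by simp
        next
          case 2
          then show ?thesis using seq unfolding indecomposable_injectives_def injective_def by blast
        qed
      qed
      have "injective_relative R ?P A B f"
        unfolding injective_relative_def
      proof
        fix h assume h: "h \<in> lhom R A ?P"
        have "\<exists>k. k \<in> lhom R B (X' i) \<and> (\<forall>x\<in>carrier A. k (f x) = h x i)" if i: "i \<in> I" for i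
        proof -
          let ?p = "\<lambda>x\<in>carrier ?P. x i"
          have "compose (carrier A) ?p h \<in> lhom R A (X' i)"
            by (rule compose_lhom[OF A h direct_product_proj_lhom[OF R.ring_axioms LM i]])
          then obtain k where k: "k \<in> lhom R B (X' i)" "\<forall>x\<in>carrier A. k (f x) = compose (carrier A) ?p h x"
            using ext[OF i] unfolding injective_relative_def by blast
          have "k (f x) = h x i" if "x \<in> carrier A" for x
            using k(2) lhomD(1)[OF h that] that by (simp add: compose_eq del: direct_product_simps)
          then show ?thesis using k(1) by blast
        qed
        then obtain k where k: "\<And>i. i \<in> I \<Longrightarrow> k i \<in> lhom R B (X' i)"
          "\<And>i x. i \<in> I \<Longrightarrow> x \<in> carrier A \<Longrightarrow> k i (f x) = h x i" by metis
        have "(\<lambda>m\<in>carrier B. \<lambda>i\<in>I. k i m) \<in> lhom R B ?P"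
          by (rule direct_product_tuple_lhom[OF B k(1)])
        moreover have "(\<lambda>m\<in>carrier B. \<lambda>i\<in>I. k i m) (f x) = h x" if x: "x \<in> carrier A" for x
        proof -
          have "h x \<in> extensional I" using lhomD(1)[OF h x] by (simp add: PiE_def)
          then show ?thesis using k(2) x lhomD(1)[OF f x] by (auto simp: fun_eq_iff extensional_def)
        qed
        ultimately show "\<exists>h'\<in>lhom R B ?P. \<forall>x\<in>carrier A. h' (f x) = h x"
          by (intro bexI[of _ "\<lambda>m\<in>carrier B. \<lambda>i\<in>I. k i m"] ballI)
      qed
      then show "injective_relative R N A B f"
        using injective_relative_retract[OF P B A sr(1,2) _ f] sr(3) by blast
    qed
  qed
qed

end
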